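(* Let $K$ be a virtual knot, let $v$ be the minimum number of virtual crossings in any diagram of $K$, and let $o$ be the minimum number of odd crossings in any diagram of $K$. Then the parity virtual Alexander polynomial of $K$ satisfies $$q\text{-width}\,\Phi\Delta(K)\le 2v \qquad\text{and}\qquad \theta\text{-width}\,\Phi\Delta(K)\le 2o .$$
   Context: A virtual knot diagram is an immersion of an oriented circle $S^1$ into the plane whose double points are decorated either as classical crossings (over/under information) or as virtual crossings (circled, no over/under information). A virtual knot is an equivalence class of such diagrams under the Reidemeister moves I, II, III on classical crossings, the virtual Reidemeister moves I, II, III (the same moves with all crossings virtual), and virtual Reidemeister move IV (an arc with two consecutive virtual crossings is moved past a classical crossing). Parity: label the classical crossings, choose a base point, traverse the knot and record the label of each classical crossing when encountered; each label occurs twice in the resulting cyclic word. A classical crossing is even (respectively odd) if the number of letters between its two occurrences is even (respectively odd). Virtual semi-arcs are the edges of the diagram that begin and end at a (classical or virtual) crossing, with no crossing in the interior; a diagram with $n\ge 1$ crossings in total has $2n$ virtual semi-arcs, labelled $a_1,\dots,a_{2n}$. Each crossing gives two relations in the free group on $a_1,\dots,a_{2n},s,q,\theta$. Draw the crossing with both strands oriented upward; let $x,y$ be the labels of the incoming bottom-left and bottom-right semi-arcs, and $z,w$ the labels of the outgoing top-left and top-right semi-arcs. A classical crossing is positive if the over strand runs from $x$ to $w$, and negative if the over strand runs from $y$ to $z$. The relations are: - even positive crossing: $z=xysx^{-1}s^{-1}$, $w=sxs^{-1}$; - even negative crossing: $z=s^{-1}ys$, $w=s^{-1}y^{-1}sxy$;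 - odd crossing of either sign: $z=\theta^{-1}y\theta$, $w=\theta x\theta^{-1}$; - virtual crossing: $z=q^{-1}yq$, $w=qxq^{-1}$. A relation $u=W$ is written as the relator $Wu^{-1}$; let $r_1,\dots,r_{2n}$ be the relators so obtained, and let $r_{2n+1}=[s,q]$, $r_{2n+2}=[s,\theta]$, $r_{2n+3}=[\theta,q]$, where $[a,b]=aba^{-1}b^{-1}$. Let $M$ be the $(2n+3)\times(2n+3)$ matrix of Fox free derivatives of $r_1,\dots,r_{2n+3}$ with respect to $a_1,\dots,a_{2n},s,q,\theta$, evaluated in $\mathbb{Z}[s^{\pm1},t^{\pm1},q^{\pm1},\theta^{\pm1}]$ by sending every $a_i$ to $t$ and $s,q,\theta$ to themselves. The parity virtual Alexander polynomial $\Phi\Delta(K)=\Phi\Delta_K(s,t,q,\theta)$ is the greatest common divisor of the $(2n+2)\times(2n+2)$ minors of $M$; it is defined up to units of the ring, is (up to units) an invariant of the virtual knot, and equals, up to units, the determinant of the $2n\times 2n$ matrix $A=(\partial r_i/\partial a_j)_{1\le i,j\le 2n}$ of Fox free derivatives (evaluated in $\mathbb{Z}[s^{\pm1},t^{\pm1},q^{\pm1},\theta^{\pm1}]$ by sending every $a_i$ to $t$ and $s,q,\theta$ to themselves). For a diagram without crossings, $\Phi\Delta=0$. For a variable $x$, the $x$-width of a Laurent polynomial $f$ is the maximum degree of $x$ in $f$ minus the minimum degree of $x$ in $f$; the width of the zero polynomial is taken to be $0$. *)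

theory Defs
  imports
    "HOL-Analysis.Derivative"
    "HOL-Library.Poly_Mapping"
    "Jordan_Normal_Form.Determinant"
begin

section \<open>Virtual knot diagrams\<close>

text \<open>
  The oriented circle is R/Z, so a closed curve in the plane is a 1-periodic map; a value of the
  parameter stands for its class modulo 1.
  The field \<open>virt\<close> is read only at double points, and \<open>over\<close> only at parameters of classical
  double points, where it says that the strand passing at that parameter is the over strand.
\<close>

record vdiagram =
  curve :: "real \<Rightarrow> complex"
  over :: "real \<Rightarrow> bool"
  virt :: "complex set"

definition meets :: "vdiagram \<Rightarrow> real \<Rightarrow> real \<Rightarrow> bool" where
  "meets D t t' \<longleftrightarrow> t - t' \<notin> \<int> \<and> curve D t = curve D t'"

definition crossing_params :: "vdiagram \<Rightarrow> real set" where
  "crossing_params D = {t \<in> {0..<1}. \<exists>t'. meets D t t'}"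

definition crossings :: "vdiagram \<Rightarrow> complex set" where
  "crossings D = curve D ` crossing_params D"

definition velocity :: "vdiagram \<Rightarrow> real \<Rightarrow> complex" where
  "velocity D t = vector_derivative (curve D) (at t)"

text \<open>
  The determinant of the two velocities: it is nonzero iff they are linearly independent, and
  positive iff the direction at \<open>t'\<close> lies counterclockwise from the direction at \<open>t\<close>.
\<close>

definition turn :: "vdiagram \<Rightarrow> real \<Rightarrow> real \<Rightarrow> real" where
  "turn D t t' = Im (cnj (velocity D t) * velocity D t')"

definition vknot_diagram :: "vdiagram \<Rightarrow> bool" where
  "vknot_diagram D \<longleftrightarrow>
     (\<forall>t. curve D (t + 1) = curve D t \<and> over D (t + 1) = over D t) \<and>
     curve D C1_differentiable_on UNIV \<and>
     (\<forall>t. velocity D t \<noteq> 0) \<and>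
     finite (crossing_params D) \<and>
     (\<forall>t t'. meets D t t' \<longrightarrow> turn D t t' \<noteq> 0) \<and>
     (\<forall>t t' t''. meets D t t' \<longrightarrow> meets D t t'' \<longrightarrow> t' - t'' \<in> \<int>) \<and>
     (\<forall>t t'. meets D t t' \<longrightarrow> curve D t \<notin> virt D \<longrightarrow> over D t' = (\<not> over D t))"


section \<open>Reidemeister moves\<close>

text \<open>
  Planar isotopy: an orientation-preserving C1 diffeomorphism of the plane (the Jacobian
  determinant at \<open>z\<close> is \<open>Im (cnj (h' z 1) * h' z \<i>)\<close>), together with an
  orientation-preserving reparametrization of the circle.
\<close>

definition plane_diffeo :: "(complex \<Rightarrow> complex) \<Rightarrow> bool" where
  "plane_diffeo h \<longleftrightarrow> bij h \<and>
     (\<exists>h'. (\<forall>z. (h has_derivative h' z) (at z)) \<and>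
           continuous_on UNIV (\<lambda>z. h' z 1) \<and> continuous_on UNIV (\<lambda>z. h' z \<i>) \<and>
           (\<forall>z. Im (cnj (h' z 1) * h' z \<i>) > 0))"

definition circle_diffeo :: "(real \<Rightarrow> real) \<Rightarrow> bool" where
  "circle_diffeo \<phi> \<longleftrightarrow> \<phi> C1_differentiable_on UNIV \<and>
     (\<forall>t. vector_derivative \<phi> (at t) > 0) \<and> (\<forall>t. \<phi> (t + 1) = \<phi> t + 1)"

definition planar_isotopy :: "vdiagram \<Rightarrow> vdiagram \<Rightarrow> bool" where
  "planar_isotopy D D' \<longleftrightarrow>
     (\<exists>h \<phi>. plane_diffeo h \<and> circle_diffeo \<phi> \<and>
        (\<forall>t. curve D' t = h (curve D (\<phi> t))) \<and>
        (\<forall>t t'. meets D' t t' \<longrightarrow>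
           (curve D' t \<in> virt D' \<longleftrightarrow> curve D (\<phi> t) \<in> virt D) \<and>
           (curve D' t \<notin> virt D' \<longrightarrow> over D' t = over D (\<phi> t))))"

definition circle_arc :: "real \<Rightarrow> real \<Rightarrow> real set" where
  "circle_arc a b = {t. \<exists>n::int. a < t + of_int n \<and> t + of_int n < b}"

text \<open>
  The two diagrams agree, decorations included, outside an open disc which contains in both cases
  exactly the given disjoint arcs of the circle, listed in cyclic order. The disc is taken round,
  which is no restriction up to planar isotopy.
\<close>

definition agree_outside_disc :: "(real \<times> real) list \<Rightarrow> vdiagram \<Rightarrow> vdiagram \<Rightarrow> bool" where
  "agree_outside_disc I D D' \<longleftrightarrow>
     (let es = concat (map (\<lambda>(a, b). [a, b]) I);
          T = (\<Union>(a, b)\<in>set I. circle_arc a b)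
      in sorted_wrt (<) es \<and> last es < hd es + 1 \<and>
         (\<exists>c r. r > 0 \<and>
            (\<forall>t. (curve D t \<in> ball c r \<longleftrightarrow> t \<in> T) \<and> (curve D' t \<in> ball c r \<longleftrightarrow> t \<in> T)) \<and>
            (\<forall>t. t \<notin> T \<longrightarrow> curve D' t = curve D t \<and> over D' t = over D t \<and>
                            (curve D t \<in> virt D' \<longleftrightarrow> curve D t \<in> virt D))))"

text \<open>
  First move, classical or virtual according to the decoration of the new crossing: an arc
  without crossings is replaced by an arc with one self-crossing.
\<close>

definition reidemeister1 :: "vdiagram \<Rightarrow> vdiagram \<Rightarrow> bool" where
  "reidemeister1 D D' \<longleftrightarrow>
     (\<exists>a b u v. agree_outside_disc [(a, b)] D D' \<and>
        inj_on (curve D) {a<..<b} \<and>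
        (\<forall>x y. a < x \<and> x < y \<and> y < b \<longrightarrow> (curve D' x = curve D' y \<longleftrightarrow> x = u \<and> y = v)) \<and>
        a < u \<and> u < v \<and> v < b)"

text \<open>
  Second move: two disjoint simple arcs are replaced by two simple arcs that cross twice. The two
  crossings are both virtual, or both classical with the same arc over. That the crossings go
  across in opposite directions is automatic for arcs in a disc whose end points are those of
  disjoint arcs; it is part of the picture of the move and is recorded explicitly.
\<close>

definition reidemeister2 :: "vdiagram \<Rightarrow> vdiagram \<Rightarrow> bool" where
  "reidemeister2 D D' \<longleftrightarrow>
     (\<exists>a b c d u\<^sub>1 u\<^sub>2 w\<^sub>1 w\<^sub>2. agree_outside_disc [(a, b), (c, d)] D D' \<and>
        inj_on (curve D) ({a<..<b} \<union> {c<..<d}) \<and>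
        inj_on (curve D') {a<..<b} \<and> inj_on (curve D') {c<..<d} \<and>
        u\<^sub>1 \<in> {a<..<b} \<and> u\<^sub>2 \<in> {a<..<b} \<and> u\<^sub>1 \<noteq> u\<^sub>2 \<and> w\<^sub>1 \<in> {c<..<d} \<and> w\<^sub>2 \<in> {c<..<d} \<and>
        (\<forall>x\<in>{a<..<b}. \<forall>y\<in>{c<..<d}.
           curve D' x = curve D' y \<longleftrightarrow> (x = u\<^sub>1 \<and> y = w\<^sub>1) \<or> (x = u\<^sub>2 \<and> y = w\<^sub>2)) \<and>
        turn D' u\<^sub>1 w\<^sub>1 * turn D' u\<^sub>2 w\<^sub>2 < 0 \<and>
        ((curve D' u\<^sub>1 \<in> virt D' \<and> curve D' u\<^sub>2 \<in> virt D') \<or>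
         (curve D' u\<^sub>1 \<notin> virt D' \<and> curve D' u\<^sub>2 \<notin> virt D' \<and> over D' u\<^sub>1 = over D' u\<^sub>2)))"

text \<open>
  Three simple arcs, numbered 0, 1, 2, of which any two cross exactly once; \<open>\<tau> i j\<close> is the
  parameter on arc \<open>i\<close> of its crossing with arc \<open>j\<close>. The last condition says that, when the
  triangle formed by the arcs is traversed along arcs 0, 1, 2, all three corners turn to the same
  side. It is automatic for arcs in a disc, and is part of the picture: the quadrants facing the
  triangle at its corners are its interior angles.
\<close>

definition triangle :: "vdiagram \<Rightarrow> (nat \<Rightarrow> real) \<Rightarrow> (nat \<Rightarrow> real) \<Rightarrow> (nat \<Rightarrow> nat \<Rightarrow> real) \<Rightarrow> bool" where
  "triangle D a b \<tau> \<longleftrightarrow>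
     (\<forall>i<3. inj_on (curve D) {a i<..<b i}) \<and>
     (\<forall>i<3. \<forall>j<3. i \<noteq> j \<longrightarrow> \<tau> i j \<in> {a i<..<b i} \<and>
        (\<forall>x\<in>{a i<..<b i}. \<forall>y\<in>{a j<..<b j}.
           curve D x = curve D y \<longleftrightarrow> x = \<tau> i j \<and> y = \<tau> j i)) \<and>
     (\<exists>\<sigma>. \<forall>i<3. let j = (i + 1) mod 3; k = (i + 2) mod 3
        in sgn ((\<tau> i j - \<tau> i k) * (\<tau> j k - \<tau> j i) * turn D (\<tau> i j) (\<tau> j i)) = \<sigma>)"

text \<open>
  Third move: the triangle is turned over, so that the order of the two crossings on each arc is
  reversed while each crossing keeps its decoration and its sense (the latter is again automatic,
  the end points being fixed). In the first case of the last condition some arc has two virtual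
  crossings, and the crossing of the other two arcs is virtual (virtual move III) or classical
  (virtual move IV). In the second case all crossings are classical and some arc passes over both
  others (classical move III).
\<close>

definition reidemeister3 :: "vdiagram \<Rightarrow> vdiagram \<Rightarrow> bool" where
  "reidemeister3 D D' \<longleftrightarrow>
     (\<exists>a b \<tau> \<tau>'. agree_outside_disc (map (\<lambda>i. (a i, b i)) [0..<3]) D D' \<and>
        triangle D a b \<tau> \<and> triangle D' a b \<tau>' \<and>
        (\<forall>i<3. \<forall>j<3. \<forall>k<3. distinct [i, j, k] \<longrightarrow> (\<tau> i j < \<tau> i k \<longleftrightarrow> \<tau>' i k < \<tau>' i j)) \<and>
        (\<forall>i<3. \<forall>j<3. i \<noteq> j \<longrightarrow>
           turn D (\<tau> i j) (\<tau> j i) * turn D' (\<tau>' i j) (\<tau>' j i) > 0 \<and>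
           (curve D' (\<tau>' i j) \<in> virt D' \<longleftrightarrow> curve D (\<tau> i j) \<in> virt D) \<and>
           (curve D (\<tau> i j) \<notin> virt D \<longrightarrow> over D' (\<tau>' i j) = over D (\<tau> i j))) \<and>
        ((\<exists>i<3. \<forall>j<3. j \<noteq> i \<longrightarrow> curve D (\<tau> i j) \<in> virt D) \<or>
         (\<forall>i<3. \<forall>j<3. i \<noteq> j \<longrightarrow> curve D (\<tau> i j) \<notin> virt D) \<and>
         (\<exists>i<3. \<forall>j<3. j \<noteq> i \<longrightarrow> over D (\<tau> i j))))"

definition vmove :: "vdiagram \<Rightarrow> vdiagram \<Rightarrow> bool" where
  "vmove D D' \<longleftrightarrow> vknot_diagram D \<and> vknot_diagram D' \<and>
     (planar_isotopy D D' \<or> reidemeister1 D D' \<or> reidemeister2 D D' \<or> reidemeister3 D D')"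

definition virtual_knot :: "vdiagram set \<Rightarrow> bool" where
  "virtual_knot K \<longleftrightarrow> (\<exists>D. vknot_diagram D \<and> K = {D'. equivclp vmove D D'})"


section \<open>Parity and crossing numbers\<close>

definition classical_params :: "vdiagram \<Rightarrow> real set" where
  "classical_params D = {t \<in> crossing_params D. curve D t \<notin> virt D}"

text \<open>The base point is the parameter 0.\<close>

definition odd_crossing :: "vdiagram \<Rightarrow> complex \<Rightarrow> bool" where
  "odd_crossing D p \<longleftrightarrow>
     (\<exists>t\<in>classical_params D. \<exists>t'\<in>classical_params D. t < t' \<and> curve D t = p \<and> curve D t' = p \<and>
        odd (card {u \<in> classical_params D. t < u \<and> u < t'}))"

definition num_virtual :: "vdiagram \<Rightarrow> nat" where
  "num_virtual D = card (crossings D \<inter> virt D)"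

definition num_odd :: "vdiagram \<Rightarrow> nat" where
  "num_odd D = card {p \<in> crossings D. odd_crossing D p}"

definition min_virtual :: "vdiagram set \<Rightarrow> nat" where
  "min_virtual K = (LEAST m. \<exists>D\<in>K. num_virtual D = m)"

definition min_odd :: "vdiagram set \<Rightarrow> nat" where
  "min_odd K = (LEAST m. \<exists>D\<in>K. num_odd D = m)"


section \<open>Crossing relators\<close>

text \<open>
  Going round the circle from the base point one makes \<open>2n\<close> passages through crossings. The
  semi-arc \<open>Arc i\<close> is the one that ends at passage \<open>i\<close>; it begins at the cyclically preceding
  passage. A word in the free group is a list of generators, each with \<open>True\<close> (the generator
  itself) or \<open>False\<close> (its inverse).
\<close>

datatype gen = Arc nat | S | Q | Theta

type_synonym gword = "(gen \<times> bool) list"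

abbreviation gpos :: "gen \<Rightarrow> gen \<times> bool" where "gpos g \<equiv> (g, True)"
abbreviation gneg :: "gen \<Rightarrow> gen \<times> bool" where "gneg g \<equiv> (g, False)"

definition passages :: "vdiagram \<Rightarrow> real list" where
  "passages D = sorted_list_of_set (crossing_params D)"

definition mate :: "vdiagram \<Rightarrow> nat \<Rightarrow> nat" where
  "mate D i = (THE j. j < length (passages D) \<and> j \<noteq> i \<and>
                      curve D (passages D ! j) = curve D (passages D ! i))"

text \<open>
  With both strands drawn upward, the strand from bottom left to top right is the one from which
  the other is reached by turning counterclockwise.
\<close>

definition left_to_right :: "vdiagram \<Rightarrow> nat \<Rightarrow> bool" where
  "left_to_right D i \<longleftrightarrow> turn D (passages D ! i) (passages D ! mate D i) > 0"

datatype crossing_kind = EvenPos | EvenNeg | OddClassical | Virtual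

definition kind_at :: "vdiagram \<Rightarrow> nat \<Rightarrow> crossing_kind" where
  "kind_at D i =
     (let t = passages D ! i in
      if curve D t \<in> virt D then Virtual
      else if odd_crossing D (curve D t) then OddClassical
      else if left_to_right D i = over D t then EvenPos
      else EvenNeg)"

text \<open>
  The words for the outgoing top-left semi-arc \<open>z\<close> and top-right semi-arc \<open>w\<close> in terms of the
  incoming bottom-left semi-arc \<open>x\<close> and bottom-right semi-arc \<open>y\<close>.
\<close>

fun z_word :: "crossing_kind \<Rightarrow> gen \<Rightarrow> gen \<Rightarrow> gword" where
  "z_word EvenPos x y = [gpos x, gpos y, gpos S, gneg x, gneg S]"
| "z_word EvenNeg x y = [gneg S, gpos y, gpos S]"
| "z_word OddClassical x y = [gneg Theta, gpos y, gpos Theta]"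
| "z_word Virtual x y = [gneg Q, gpos y, gpos Q]"

fun w_word :: "crossing_kind \<Rightarrow> gen \<Rightarrow> gen \<Rightarrow> gword" where
  "w_word EvenPos x y = [gpos S, gpos x, gneg S]"
| "w_word EvenNeg x y = [gneg S, gneg y, gpos S, gpos x, gpos y]"
| "w_word OddClassical x y = [gpos Theta, gpos x, gneg Theta]"
| "w_word Virtual x y = [gpos Q, gpos x, gneg Q]"

text \<open>
  The two relators of a crossing are indexed by its two passages: the one for \<open>w\<close> by the passage
  from \<open>x\<close> to \<open>w\<close>, the one for \<open>z\<close> by the passage from \<open>y\<close> to \<open>z\<close>.
\<close>

definition crossing_relator :: "vdiagram \<Rightarrow> nat \<Rightarrow> gword" where
  "crossing_relator D i =
     (if left_to_right D i then w_word (kind_at D i) (Arc i) (Arc (mate D i))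
      else z_word (kind_at D i) (Arc (mate D i)) (Arc i))
     @ [gneg (Arc (Suc i mod length (passages D)))]"

definition gcomm :: "gen \<Rightarrow> gen \<Rightarrow> gword" where
  "gcomm a b = [gpos a, gpos b, gneg a, gneg b]"

definition relators :: "vdiagram \<Rightarrow> gword list" where
  "relators D = map (crossing_relator D) [0..<length (passages D)]
     @ [gcomm S Q, gcomm S Theta, gcomm Theta Q]"

definition generators :: "vdiagram \<Rightarrow> gen list" where
  "generators D = map Arc [0..<length (passages D)] @ [S, Q, Theta]"


section \<open>Fox derivatives and Laurent polynomials\<close>

text \<open>
  The free derivative of a word is an element of the integral group ring of the free group,
  represented by a list of integer multiples of words.
\<close>

fun fox :: "gen \<Rightarrow> gword \<Rightarrow> (int \<times> gword) list" where
  "fox g [] = []"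
| "fox g ((h, True) # u) =
     (if h = g then [(1, [])] else []) @ map (\<lambda>(c, v). (c, gpos h # v)) (fox g u)"
| "fox g ((h, False) # u) =
     (if h = g then [(- 1, [gneg h])] else []) @ map (\<lambda>(c, v). (c, gneg h # v)) (fox g u)"

text \<open>
  Laurent polynomials over the integers in four variables: the integral group ring of the free
  abelian group of exponent vectors.
\<close>

datatype lvar = Var_s | Var_t | Var_q | Var_theta

type_synonym laurent = "(lvar \<Rightarrow>\<^sub>0 int) \<Rightarrow>\<^sub>0 int"

definition lpower :: "lvar \<Rightarrow> int \<Rightarrow> laurent" where
  "lpower x k = Poly_Mapping.single (Poly_Mapping.single x k) 1"

fun gen_var :: "gen \<Rightarrow> lvar" where
  "gen_var (Arc i) = Var_t"
| "gen_var S = Var_s"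
| "gen_var Q = Var_q"
| "gen_var Theta = Var_theta"

definition eval_word :: "gword \<Rightarrow> laurent" where
  "eval_word u = prod_list (map (\<lambda>(g, e). lpower (gen_var g) (if e then 1 else - 1)) u)"

definition eval_group_ring :: "(int \<times> gword) list \<Rightarrow> laurent" where
  "eval_group_ring F = sum_list (map (\<lambda>(c, u). of_int c * eval_word u) F)"

definition fox_matrix :: "vdiagram \<Rightarrow> laurent mat" where
  "fox_matrix D =
     (let m = length (passages D) + 3
      in mat m m (\<lambda>(i, j). eval_group_ring (fox (generators D ! j) (relators D ! i))))"

definition is_gcd :: "'a::comm_ring_1 \<Rightarrow> 'a set \<Rightarrow> bool" where
  "is_gcd f A \<longleftrightarrow> (\<forall>x\<in>A. f dvd x) \<and> (\<forall>g. (\<forall>x\<in>A. g dvd x) \<longrightarrow> g dvd f)"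

text \<open>
  \<open>f\<close> is a representative, up to units, of the parity virtual Alexander polynomial.
\<close>

definition diagram_pva :: "vdiagram \<Rightarrow> laurent \<Rightarrow> bool" where
  "diagram_pva D f \<longleftrightarrow>
     (if crossing_params D = {} then f = 0
      else is_gcd f {det (mat_delete (fox_matrix D) i j) |i j.
                       i < dim_row (fox_matrix D) \<and> j < dim_col (fox_matrix D)})"

definition parity_virtual_alexander :: "vdiagram set \<Rightarrow> laurent \<Rightarrow> bool" where
  "parity_virtual_alexander K f \<longleftrightarrow> (\<exists>D\<in>K. diagram_pva D f)"

definition width :: "lvar \<Rightarrow> laurent \<Rightarrow> int" where
  "width x f =
     (if f = 0 then 0
      else let E = (\<lambda>m. Poly_Mapping.lookup m x) ` Poly_Mapping.keys f in Max E - Min E)"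

end

theory Submission
  imports Defs
begin

text \<open>
  The bound has two halves. For a single diagram, the parity virtual Alexander polynomial is, as far
  as the exponents of q and \<open>\<theta>\<close> are concerned, the determinant of the square matrix of Fox derivatives
  with respect to the semi-arcs; q occurs in it only in the rows that belong to passages through
  virtual crossings, and \<open>\<theta>\<close> only in those of odd crossings. Each such row contributes at most 1 to
  the width of the determinant, and every crossing has two passages. So the widths are at most twice
  the numbers of virtual and odd crossings of that diagram (\<open>width_q_alexander\<close>,
  \<open>width_theta_alexander\<close>). The second half is that the determinant is the same, up to units, for any
  two diagrams of a virtual knot (\<open>alexander_vmove\<close>), so that the bound may be read off from a diagram in
  which the number of crossings of the kind in question is minimal.

  The step from the greatest common divisor f of the minors to the determinant uses only divisibility
  and widths. One of the minors is the determinant times \<open>(s - 1)\<^sup>2\<close>, which f must divide;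
  widths are additive in the integral domain of Laurent polynomials, and \<open>s - 1\<close> has width 0 in q and
  in \<open>\<theta>\<close>. If the determinant is 0, then all the minors vanish, hence so does f.

  For the invariance, the unknowns are indexed by the passages, that is by parameters of the curve:
  the unknown of a passage is the semi-arc that begins there, and it equals a combination
  \<open>a i * u (pred i) + b i * u (pred (mate i))\<close> of the semi-arc that runs into the passage and the
  semi-arc that runs into the other passage of the same crossing. Only the under strand of an even
  crossing has \<open>b i \<noteq> 0\<close>. Adding points of the curve with the trivial relation \<open>a = 1\<close>,
  \<open>b = 0\<close> does not change the determinant. In a Reidemeister move such points are placed as
  gates at the two ends of each arc of the disc, and the passages between the gates are eliminated by
  a Schur complement (\<open>tangle_replacement\<close>). The block of the eliminated unknowns has an invertible
  determinant: in the second and third moves the strands can be layered so that each of them depends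
  only on the strands above it, and in the first move the determinant is a monomial. What remains depends only on the linear map by which the arcs
  in the disc transmit the values at the entering gates to the leaving gates, and each move leaves this
  map unchanged: \<open>kink_relations\<close>, \<open>bigon_relations\<close>, \<open>triangle_relations\<close>.

  The geometry of the curves enters only through the order of the passages, the signs of the
  crossings, and the parities. A crossing is odd iff the numbers of classical passages that precede
  its two passages are congruent modulo 2. A move changes the number of classical passages on each arc
  of the disc by 0 or 2, so no parity changes outside the disc; inside, the parities are computed from
  the order on the arcs, and in a triangle of three classical crossings the number of odd ones is even.
\<close>

section \<open>Widths of Laurent polynomials\<close>

text \<open>
  Any linear order on the variables will do: it makes the exponent vectors a linearly ordered group,
  and hence the Laurent polynomials an integral domain.
\<close>

instantiation lvar :: linorder
begin

definition less_eq_lvar :: "lvar \<Rightarrow> lvar \<Rightarrow> bool" where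
  "less_eq_lvar x y \<longleftrightarrow> (case x of Var_s \<Rightarrow> True | Var_t \<Rightarrow> y \<noteq> Var_s
     | Var_q \<Rightarrow> y \<noteq> Var_s \<and> y \<noteq> Var_t | Var_theta \<Rightarrow> y = Var_theta)"

definition less_lvar :: "lvar \<Rightarrow> lvar \<Rightarrow> bool" where
  "less_lvar x y \<longleftrightarrow> x \<le> y \<and> \<not> y \<le> x"

instance
  by standard (auto simp: less_eq_lvar_def less_lvar_def split: lvar.splits)

end

definition exps_within :: "lvar \<Rightarrow> int \<Rightarrow> int \<Rightarrow> laurent \<Rightarrow> bool" where
  "exps_within x l h f \<longleftrightarrow> (\<forall>m\<in>Poly_Mapping.keys f. l \<le> Poly_Mapping.lookup m x \<and> Poly_Mapping.lookup m x \<le> h)"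

lemma exps_within_0 [simp]: "exps_within x l h 0"
  by (simp add: exps_within_def)

lemma exps_within_add:
  "exps_within x l h f \<Longrightarrow> exps_within x l h g \<Longrightarrow> exps_within x l h (f + g)"
  unfolding exps_within_def using Poly_Mapping.keys_add[of f g] by blast

lemma exps_within_uminus: "exps_within x l h f \<Longrightarrow> exps_within x l h (- f)"
  by (simp add: exps_within_def)

lemma exps_within_diff:
  "exps_within x l h f \<Longrightarrow> exps_within x l h g \<Longrightarrow> exps_within x l h (f - g)"
  using exps_within_add[of x l h f "- g"] exps_within_uminus[of x l h g] by simp

lemma exps_within_sum:
  "(\<And>i. i \<in> I \<Longrightarrow> exps_within x l h (f i)) \<Longrightarrow> exps_within x l h (sum f I)"
  by (induction I rule: infinite_finite_induct) (auto intro: exps_within_add)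

lemma exps_within_mult:
  assumes "exps_within x l h f" "exps_within x l' h' g"
  shows "exps_within x (l + l') (h + h') (f * g)"
  unfolding exps_within_def
proof
  fix m assume "m \<in> Poly_Mapping.keys (f * g)"
  then obtain a b where "m = a + b" "a \<in> Poly_Mapping.keys f" "b \<in> Poly_Mapping.keys g"
    using keys_mult[of f g] by blast
  then show "l + l' \<le> Poly_Mapping.lookup m x \<and> Poly_Mapping.lookup m x \<le> h + h'"
    using assms by (force simp: exps_within_def lookup_add)
qed

lemma exps_within_prod:
  "(\<And>i. i \<in> I \<Longrightarrow> exps_within x (l i) (h i) (f i)) \<Longrightarrow>
     exps_within x (sum l I) (sum h I) (prod f I)"
proof (induction I rule: infinite_finite_induct)
  case (insert i I)
  then show ?case by (auto intro!: exps_within_mult)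
qed (simp_all add: exps_within_def)

lemma exps_within_1 [simp]: "exps_within x l h 1 \<longleftrightarrow> l \<le> 0 \<and> 0 \<le> h"
  by (simp add: exps_within_def)

lemma keys_lpower [simp]: "Poly_Mapping.keys (lpower x k) = {Poly_Mapping.single x k}"
  by (simp add: lpower_def)

lemma lpower_nonzero [simp]: "lpower x k \<noteq> 0"
  using keys_lpower[of x k] by (metis Poly_Mapping.keys_zero insert_not_empty)

lemma exps_within_lpower [simp]:
  "exps_within x l h (lpower y k) \<longleftrightarrow> (if x = y then l \<le> k \<and> k \<le> h else l \<le> 0 \<and> 0 \<le> h)"
  by (auto simp: exps_within_def lookup_single when_def)

lemma width_le:
  assumes "exps_within x l h f" "l \<le> h"
  shows "width x f \<le> h - l"
proof (cases "f = 0")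
  case True
  then show ?thesis using assms(2) by (simp add: width_def)
next
  case False
  let ?E = "(\<lambda>m. Poly_Mapping.lookup m x) ` Poly_Mapping.keys f"
  have E: "finite ?E" "?E \<noteq> {}" using False by auto
  have "Max ?E \<le> h" "l \<le> Min ?E"
    using assms E by (auto simp: exps_within_def)
  then have "Max ?E - Min ?E \<le> h - l" by linarith
  then show ?thesis using False by (simp add: width_def Let_def)
qed

lemma width_nonneg: "0 \<le> width x f"
proof (cases "f = 0")
  case False
  let ?E = "(\<lambda>m. Poly_Mapping.lookup m x) ` Poly_Mapping.keys f"
  have "finite ?E" "?E \<noteq> {}" using False by auto
  then have "Min ?E \<le> Max ?E" using Max_in Min_le by blast
  then show ?thesis using False by (simp add: width_def Let_def)
qed (simp add: width_def)

text \<open>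
  For a grading \<open>\<phi>\<close> of the exponent vectors, a polynomial is the sum of its part of top degree and a
  part of smaller degree.
\<close>

lemma top_part:
  fixes f :: laurent and \<phi> :: "(lvar \<Rightarrow>\<^sub>0 int) \<Rightarrow> int"
  assumes "\<And>m. m \<in> Poly_Mapping.keys f \<Longrightarrow> \<phi> m \<le> d"
  obtains g h where "f = g + h" "\<And>m. m \<in> Poly_Mapping.keys g \<Longrightarrow> \<phi> m = d"
    "\<And>m. m \<in> Poly_Mapping.keys h \<Longrightarrow> \<phi> m < d"
    "(\<exists>m\<in>Poly_Mapping.keys f. \<phi> m = d) \<Longrightarrow> g \<noteq> 0"
proof -
  define part where "part A = (\<Sum>m\<in>A. Poly_Mapping.single m (Poly_Mapping.lookup f m))" for A
  have lookup_part: "Poly_Mapping.lookup (part A) k = (if k \<in> A then Poly_Mapping.lookup f k else 0)"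
    if "finite A" for A k
    using that by (simp add: part_def lookup_sum lookup_single when_def sum.delta)
  let ?A = "{m \<in> Poly_Mapping.keys f. \<phi> m = d}" and ?B = "{m \<in> Poly_Mapping.keys f. \<phi> m \<noteq> d}"
  show thesis
  proof
    show "f = part ?A + part ?B"
      by (rule poly_mapping_eqI) (auto simp: lookup_add lookup_part in_keys_iff)
    show "m \<in> Poly_Mapping.keys (part ?A) \<Longrightarrow> \<phi> m = d" for m
      by (auto simp: in_keys_iff lookup_part split: if_splits)
    show "\<phi> m < d" if "m \<in> Poly_Mapping.keys (part ?B)" for m
    proof -
      have "m \<in> ?B" using that by (auto simp: in_keys_iff lookup_part split: if_splits)
      then show ?thesis using assms[of m] by auto
    qed
    assume "\<exists>m\<in>Poly_Mapping.keys f. \<phi> m = d"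
    then obtain m where m: "m \<in> Poly_Mapping.keys f" "\<phi> m = d" by blast
    then have "Poly_Mapping.lookup (part ?A) m \<noteq> 0" by (simp add: lookup_part in_keys_iff)
    then show "part ?A \<noteq> 0" by auto
  qed
qed

text \<open>
  The product of the top-degree parts is nonzero in an integral domain, and the other products do not
  reach its degree. Applied to the exponent of a variable and to its negative, this makes the widths
  additive.
\<close>

lemma top_degree_mult:
  fixes f g :: laurent and \<phi> :: "(lvar \<Rightarrow>\<^sub>0 int) \<Rightarrow> int"
  assumes add: "\<And>a b. \<phi> (a + b) = \<phi> a + \<phi> b"
    and f: "\<And>m. m \<in> Poly_Mapping.keys f \<Longrightarrow> \<phi> m \<le> d" "\<exists>m\<in>Poly_Mapping.keys f. \<phi> m = d"
    and g: "\<And>m. m \<in> Poly_Mapping.keys g \<Longrightarrow> \<phi> m \<le> e" "\<exists>m\<in>Poly_Mapping.keys g. \<phi> m = e"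
  shows "\<exists>m\<in>Poly_Mapping.keys (f * g). \<phi> m = d + e"
proof -
  obtain f1 f2 where F: "f = f1 + f2" "\<And>m. m \<in> Poly_Mapping.keys f1 \<Longrightarrow> \<phi> m = d"
    "\<And>m. m \<in> Poly_Mapping.keys f2 \<Longrightarrow> \<phi> m < d" "f1 \<noteq> 0"
    using top_part[of f \<phi> d] f by metis
  obtain g1 g2 where G: "g = g1 + g2" "\<And>m. m \<in> Poly_Mapping.keys g1 \<Longrightarrow> \<phi> m = e"
    "\<And>m. m \<in> Poly_Mapping.keys g2 \<Longrightarrow> \<phi> m < e" "g1 \<noteq> 0"
    using top_part[of g \<phi> e] g by metis
  have keys: "\<exists>a\<in>Poly_Mapping.keys p. \<exists>b\<in>Poly_Mapping.keys q. m = a + b"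
    if "m \<in> Poly_Mapping.keys (p * q)" for m and p q :: laurent
    using that keys_mult[of p q] by blast
  have "f1 * g1 \<noteq> 0" using F(4) G(4) by simp
  then obtain m where m: "m \<in> Poly_Mapping.keys (f1 * g1)"
    by (metis ex_in_conv keys_eq_empty)
  have deg: "\<phi> m = d + e" using keys[OF m] F(2) G(2) add by auto
  have "m \<notin> Poly_Mapping.keys (f1 * g2)"
  proof
    assume "m \<in> Poly_Mapping.keys (f1 * g2)"
    from keys[OF this] show False using F(2) G(3) add deg by fastforce
  qed
  moreover have "m \<notin> Poly_Mapping.keys (f2 * g)"
  proof
    assume "m \<in> Poly_Mapping.keys (f2 * g)"
    from keys[OF this] show False using F(3) g(1) add deg by fastforce
  qed
  moreover have "f * g = f1 * g1 + f1 * g2 + f2 * g"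
    by (simp add: F(1) G(1) algebra_simps)
  ultimately have "Poly_Mapping.lookup (f * g) m = Poly_Mapping.lookup (f1 * g1) m"
    by (simp add: lookup_add in_keys_iff)
  then have "m \<in> Poly_Mapping.keys (f * g)" using m by (simp add: in_keys_iff)
  then show ?thesis using deg by blast
qed

lemma width_mult:
  assumes "f \<noteq> 0" "g \<noteq> 0"
  shows "width x (f * g) = width x f + width x g"
proof -
  define hi where "hi p = Max ((\<lambda>m. Poly_Mapping.lookup m x) ` Poly_Mapping.keys p)" for p :: laurent
  define lo where "lo p = Min ((\<lambda>m. Poly_Mapping.lookup m x) ` Poly_Mapping.keys p)" for p :: laurent
  have hi: "\<And>m. m \<in> Poly_Mapping.keys p \<Longrightarrow> Poly_Mapping.lookup m x \<le> hi p"
    "\<exists>m\<in>Poly_Mapping.keys p. Poly_Mapping.lookup m x = hi p" if "p \<noteq> 0" for p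
  proof -
    have "hi p \<in> (\<lambda>m. Poly_Mapping.lookup m x) ` Poly_Mapping.keys p"
      unfolding hi_def using that by (intro Max_in) auto
    then show "\<exists>m\<in>Poly_Mapping.keys p. Poly_Mapping.lookup m x = hi p" by force
  qed (simp add: hi_def)
  have lo: "\<And>m. m \<in> Poly_Mapping.keys p \<Longrightarrow> - Poly_Mapping.lookup m x \<le> - lo p"
    "\<exists>m\<in>Poly_Mapping.keys p. - Poly_Mapping.lookup m x = - lo p" if "p \<noteq> 0" for p
  proof -
    have "lo p \<in> (\<lambda>m. Poly_Mapping.lookup m x) ` Poly_Mapping.keys p"
      unfolding lo_def using that by (intro Min_in) auto
    then show "\<exists>m\<in>Poly_Mapping.keys p. - Poly_Mapping.lookup m x = - lo p" by force
  qed (simp add: lo_def)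
  have fg: "f * g \<noteq> 0" using assms by simp
  have "exps_within x (lo f + lo g) (hi f + hi g) (f * g)"
    using assms hi(1) lo(1) by (intro exps_within_mult) (auto simp: exps_within_def)
  moreover have "\<exists>m\<in>Poly_Mapping.keys (f * g). Poly_Mapping.lookup m x = hi f + hi g"
    by (rule top_degree_mult[OF _ hi(1)[OF assms(1)] hi(2)[OF assms(1)] hi(1)[OF assms(2)] hi(2)[OF assms(2)]])
      (simp_all add: lookup_add)
  moreover have "\<exists>m\<in>Poly_Mapping.keys (f * g). - Poly_Mapping.lookup m x = - lo f + - lo g"
    by (rule top_degree_mult[OF _ lo(1)[OF assms(1)] lo(2)[OF assms(1)] lo(1)[OF assms(2)] lo(2)[OF assms(2)]])
      (simp_all add: lookup_add)
  ultimately have "hi (f * g) = hi f + hi g" "lo (f * g) = lo f + lo g"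
    unfolding hi_def[of "f * g"] lo_def[of "f * g"]
    by (intro Max_eqI Min_eqI; force simp: exps_within_def image_iff)+
  then show ?thesis using assms fg by (simp add: width_def Let_def hi_def lo_def)
qed

lemma width_dvd_mono:
  assumes "f dvd g" "g \<noteq> 0"
  shows "width x f \<le> width x g"
proof -
  obtain h where "g = f * h" using assms(1) by blast
  then show ?thesis using width_mult[of f h x] width_nonneg[of x h] assms(2) by auto
qed

lemma width_cong_dvd:
  assumes "f dvd g" "g dvd f"
  shows "width x f = width x g"
proof (cases "f = 0 \<or> g = 0")
  case True
  then show ?thesis using assms by auto
next
  case False
  then show ?thesis using assms by (intro antisym width_dvd_mono) auto
qed

lemma lpower_mult: "lpower x j * lpower x k = lpower x (j + k)"
  by (simp add: lpower_def mult_single single_add)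

lemma lpower_0 [simp]: "lpower x 0 = 1"
  by (simp add: lpower_def)

section \<open>Determinants indexed by finite sets\<close>

definition list_det :: "'a list \<Rightarrow> ('a \<Rightarrow> 'a \<Rightarrow> 'r::comm_ring_1) \<Rightarrow> 'r" where
  "list_det xs F = det (mat (length xs) (length xs) (\<lambda>(i, j). F (xs ! i) (xs ! j)))"

text \<open>
  The rows and columns will be indexed by passages, which are real parameters. By \<open>list_det_permute\<close>
  the order in which they are enumerated is irrelevant, so only the index set is recorded.
\<close>

definition set_det :: "'a::linorder set \<Rightarrow> ('a \<Rightarrow> 'a \<Rightarrow> 'r::comm_ring_1) \<Rightarrow> 'r" where
  "set_det P F = list_det (sorted_list_of_set P) F"

text \<open>
  The same permutation acts on rows and on columns, so its sign occurs twice.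
\<close>

lemma list_det_permute:
  fixes F :: "'a \<Rightarrow> 'a \<Rightarrow> 'r::comm_ring_1"
  assumes "distinct xs" "distinct ys" "set xs = set ys"
  shows "list_det xs F = list_det ys F"
proof -
  have "mset xs = mset ys" using assms by (simp add: set_eq_iff_mset_eq_distinct)
  then obtain p where p: "p permutes {..<length ys}" "permute_list p ys = xs"
    by (rule mset_eq_permutation)
  let ?n = "length ys"
  have len: "length xs = ?n" using p(2) by auto
  have p0: "p permutes {0..<?n}" using p(1) by (simp add: atLeast0LessThan)
  have xs: "xs ! i = ys ! p i" if "i < ?n" for i
    using that p permute_list_nth[OF p(1), of i] by simp
  have p_lt: "p i < ?n" if "i < ?n" for i using p0 that by (simp add: permutes_in_image flip: atLeast0LessThan)
  define A where "A = mat ?n ?n (\<lambda>(i, j). F (ys ! i) (ys ! j))"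
  define B where "B = mat ?n ?n (\<lambda>(i, j). A $$ (p i, j))"
  have A: "A \<in> carrier_mat ?n ?n" and B: "B \<in> carrier_mat ?n ?n" by (simp_all add: A_def B_def)
  have "det B = signof p * det A" unfolding B_def by (rule det_permute_rows[OF A p0])
  have "mat ?n ?n (\<lambda>(i, j). F (xs ! i) (xs ! j)) = (mat ?n ?n (\<lambda>(i, j). B\<^sup>T $$ (p i, j)))\<^sup>T"
    by (rule eq_matI) (auto simp: B_def A_def xs p_lt)
  then have "list_det xs F = det (mat ?n ?n (\<lambda>(i, j). B\<^sup>T $$ (p i, j)))"
    unfolding list_det_def len by (simp add: det_transpose[of _ ?n])
  also have "\<dots> = signof p * det (B\<^sup>T)" using B p0 by (intro det_permute_rows) auto
  also have "det (B\<^sup>T) = det B" by (rule det_transpose[OF B])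
  also have "signof p * (det B) = det A"
    unfolding \<open>det B = signof p * det A\<close> by (simp add: sign_def)
  finally show ?thesis by (simp add: A_def list_det_def)
qed

lemma set_det_list:
  assumes "distinct xs"
  shows "set_det (set xs) F = list_det xs F"
  unfolding set_det_def by (rule list_det_permute) (use assms in auto)

lemma list_det_cong:
  "(\<And>i j. i \<in> set xs \<Longrightarrow> j \<in> set xs \<Longrightarrow> F i j = G i j) \<Longrightarrow> list_det xs F = list_det xs G"
  unfolding list_det_def by (intro arg_cong[of _ _ det] eq_matI) auto

lemma set_det_cong:
  "(\<And>i j. i \<in> P \<Longrightarrow> j \<in> P \<Longrightarrow> F i j = G i j) \<Longrightarrow> set_det P F = set_det P G"
  unfolding set_det_def
  by (cases "finite P") (auto intro: list_det_cong)

lemma set_det_image: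
  assumes "inj_on g P" "finite P"
  shows "set_det (g ` P) F = set_det P (\<lambda>i j. F (g i) (g j))"
proof -
  obtain xs where xs: "set xs = P" "distinct xs" using finite_distinct_list[OF assms(2)] by blast
  have "set_det (g ` P) F = list_det (map g xs) F"
    using xs assms set_det_list[of "map g xs" F] by (simp add: distinct_map)
  also have "\<dots> = list_det xs (\<lambda>i j. F (g i) (g j))"
    unfolding list_det_def length_map by (intro arg_cong[of _ _ det] eq_matI) auto
  finally show ?thesis using xs set_det_list[of xs "\<lambda>i j. F (g i) (g j)"] by simp
qed

text \<open>
  The Schur complement without inverses: if W expresses the unknowns in L by those in R, then adding
  the columns of L times W to the columns of R clears the block in the rows of L.
\<close>

lemma set_det_schur:
  fixes F :: "'a::linorder \<Rightarrow> 'a \<Rightarrow> 'r::idom"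
  assumes "finite L" "finite R" "L \<inter> R = {}"
    and W: "\<And>l j. l \<in> L \<Longrightarrow> j \<in> R \<Longrightarrow> F l j + (\<Sum>k\<in>L. F l k * W k j) = 0"
  shows "set_det (L \<union> R) F = set_det L F * set_det R (\<lambda>i j. F i j + (\<Sum>k\<in>L. F i k * W k j))"
proof -
  obtain ls where ls: "set ls = L" "distinct ls" using finite_distinct_list[OF assms(1)] by blast
  obtain rs where rs: "set rs = R" "distinct rs" using finite_distinct_list[OF assms(2)] by blast
  let ?l = "length ls" and ?r = "length rs"
  define A where "A = mat ?l ?l (\<lambda>(i, j). F (ls ! i) (ls ! j))"
  define B where "B = mat ?l ?r (\<lambda>(i, j). F (ls ! i) (rs ! j))"
  define C where "C = mat ?r ?l (\<lambda>(i, j). F (rs ! i) (ls ! j))"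
  define D where "D = mat ?r ?r (\<lambda>(i, j). F (rs ! i) (rs ! j))"
  define V where "V = mat ?l ?r (\<lambda>(i, j). W (ls ! i) (rs ! j))"
  define E where "E = mat ?r ?r (\<lambda>(i, j). F (rs ! i) (rs ! j) + (\<Sum>k\<in>L. F (rs ! i) k * W k (rs ! j)))"
  have car: "A \<in> carrier_mat ?l ?l" "B \<in> carrier_mat ?l ?r" "C \<in> carrier_mat ?r ?l" "D \<in> carrier_mat ?r ?r"
    "V \<in> carrier_mat ?l ?r" "E \<in> carrier_mat ?r ?r"
    by (simp_all add: A_def B_def C_def D_def V_def E_def)
  have sum_ls: "(\<Sum>m<?l. G (ls ! m)) = (\<Sum>k\<in>L. G k)" for G :: "'a \<Rightarrow> 'r"
    by (rule sum.reindex_bij_betw[OF bij_betw_nth[OF ls(2) refl ls(1)[symmetric]]])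
  have full: "list_det (ls @ rs) F = det (four_block_mat A B C D)"
    unfolding list_det_def
    by (intro arg_cong[of _ _ det] eq_matI)
      (auto simp: A_def B_def C_def D_def nth_append Let_def)
  have U: "det (four_block_mat (1\<^sub>m ?l) V (0\<^sub>m ?r ?l) (1\<^sub>m ?r)) = 1"
    by (subst det_four_block_mat_lower_left_zero) (use car in auto)
  have z: "A * V + B = 0\<^sub>m ?l ?r"
  proof (rule eq_matI)
    fix i j assume ij: "i < dim_row (0\<^sub>m ?l ?r :: 'r mat)" "j < dim_col (0\<^sub>m ?l ?r :: 'r mat)"
    then have "(A * V + B) $$ (i, j) = F (ls ! i) (rs ! j) + (\<Sum>m<?l. F (ls ! i) (ls ! m) * W (ls ! m) (rs ! j))"
      by (simp add: A_def B_def V_def scalar_prod_def atLeast0LessThan)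
    also have "\<dots> = 0"
      unfolding sum_ls[of "\<lambda>k. F (ls ! i) k * W k (rs ! j)"] by (rule W) (use ij ls(1) rs(1) in auto)
    finally show "(A * V + B) $$ (i, j) = 0\<^sub>m ?l ?r $$ (i, j)" using ij by simp
  qed (simp_all add: A_def B_def V_def)
  have e: "C * V + D = E"
  proof (rule eq_matI)
    fix i j assume ij: "i < dim_row E" "j < dim_col E"
    then have "(C * V + D) $$ (i, j) = F (rs ! i) (rs ! j) + (\<Sum>m<?l. F (rs ! i) (ls ! m) * W (ls ! m) (rs ! j))"
      by (simp add: C_def D_def V_def E_def scalar_prod_def atLeast0LessThan)
    also have "\<dots> = E $$ (i, j)"
      unfolding sum_ls[of "\<lambda>k. F (rs ! i) k * W k (rs ! j)"] using ij by (simp add: E_def)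
    finally show "(C * V + D) $$ (i, j) = E $$ (i, j)" .
  qed (simp_all add: C_def D_def V_def E_def)
  have "det (four_block_mat A B C D)
      = det (four_block_mat A B C D * four_block_mat (1\<^sub>m ?l) V (0\<^sub>m ?r ?l) (1\<^sub>m ?r))"
    by (subst det_mult[of _ "?l + ?r"]) (use car U in auto)
  also have "four_block_mat A B C D * four_block_mat (1\<^sub>m ?l) V (0\<^sub>m ?r ?l) (1\<^sub>m ?r)
      = four_block_mat A (0\<^sub>m ?l ?r) C E"
  proof -
    have "A * 1\<^sub>m ?l + B * 0\<^sub>m ?r ?l = A" "C * 1\<^sub>m ?l + D * 0\<^sub>m ?r ?l = C"
      "A * V + B * 1\<^sub>m ?r = 0\<^sub>m ?l ?r" "C * V + D * 1\<^sub>m ?r = E"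
      using car z e by simp_all
    then show ?thesis
      using mult_four_block_mat[OF car(1-4), of "1\<^sub>m ?l" ?l V ?r "0\<^sub>m ?r ?l" "1\<^sub>m ?r"] car by simp
  qed
  also have "det \<dots> = det A * det E"
    by (rule det_four_block_mat_upper_right_zero) (use car in auto)
  finally have "list_det (ls @ rs) F = det A * det E" using full by simp
  moreover have "set_det (L \<union> R) F = list_det (ls @ rs) F"
    using ls rs assms(3) set_det_list[of "ls @ rs" F] by simp
  moreover have "set_det L F = det A" using ls set_det_list[of ls F] by (simp add: list_det_def A_def)
  moreover have "set_det R (\<lambda>i j. F i j + (\<Sum>k\<in>L. F i k * W k j)) = det E"
    using rs set_det_list[of rs "\<lambda>i j. F i j + (\<Sum>k\<in>L. F i k * W k j)"] by (simp add: list_det_def E_def)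
  ultimately show ?thesis by simp
qed

text \<open>
  Unknowns whose block has an invertible determinant can be expressed by the others, by means of the
  adjugate matrix.
\<close>

lemma unit_set_det_solvable:
  fixes F :: "'a::linorder \<Rightarrow> 'a \<Rightarrow> 'r::idom"
  assumes "finite L" "set_det L F dvd 1"
  shows "\<exists>W. \<forall>l\<in>L. \<forall>j. G l j + (\<Sum>k\<in>L. F l k * W k j) = 0"
proof -
  obtain ls where ls: "set ls = L" "distinct ls" using finite_distinct_list[OF assms(1)] by blast
  let ?l = "length ls"
  define A where "A = mat ?l ?l (\<lambda>(i, j). F (ls ! i) (ls ! j))"
  have A: "A \<in> carrier_mat ?l ?l" by (simp add: A_def)
  have "det A = set_det L F" using ls set_det_list[of ls F] by (simp add: list_det_def A_def)
  then obtain u where u: "det A * u = 1" using assms(2) by (metis dvdE)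
  define X where "X = adj_mat A"
  have X: "X \<in> carrier_mat ?l ?l" "A * X = det A \<cdot>\<^sub>m 1\<^sub>m ?l" unfolding X_def using adj_mat[OF A] by auto
  have AX: "(\<Sum>m<?l. F (ls ! i) (ls ! m) * X $$ (m, k)) = (if i = k then det A else 0)" if "i < ?l" "k < ?l" for i k
  proof -
    have "(A * X) $$ (i, k) = (\<Sum>m<?l. F (ls ! i) (ls ! m) * X $$ (m, k))"
      using that X(1) by (auto simp: A_def scalar_prod_def atLeast0LessThan)
    then show ?thesis using that X(2) by (simp split: if_splits)
  qed
  have sum_ls: "(\<Sum>m<?l. H (ls ! m)) = (\<Sum>k\<in>L. H k)" for H :: "'a \<Rightarrow> 'r"
    by (rule sum.reindex_bij_betw[OF bij_betw_nth[OF ls(2) refl ls(1)[symmetric]]])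
  define pos where "pos k = (THE m. m < ?l \<and> ls ! m = k)" for k
  have pos: "pos (ls ! m) = m" if "m < ?l" for m
    unfolding pos_def using that ls(2) by (auto simp: nth_eq_iff_index_eq)
  define W where "W k j = - u * (\<Sum>n<?l. X $$ (pos k, n) * G (ls ! n) j)" for k j
  have "G l j + (\<Sum>k\<in>L. F l k * W k j) = 0" if l: "l \<in> L" for l j
  proof -
    obtain i where i: "i < ?l" "l = ls ! i" using l ls(1) by (metis in_set_conv_nth)
    have "(\<Sum>k\<in>L. F l k * W k j) = (\<Sum>m<?l. F l (ls ! m) * W (ls ! m) j)"
      by (rule sum_ls[of "\<lambda>k. F l k * W k j", symmetric])
    also have "\<dots> = (\<Sum>m<?l. \<Sum>n<?l. - u * (F (ls ! i) (ls ! m) * X $$ (m, n)) * G (ls ! n) j)"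
      unfolding i(2) by (intro sum.cong refl) (simp add: W_def pos sum_distrib_left mult_ac)
    also have "\<dots> = (\<Sum>n<?l. \<Sum>m<?l. - u * (F (ls ! i) (ls ! m) * X $$ (m, n)) * G (ls ! n) j)"
      by (rule sum.swap)
    also have "\<dots> = (\<Sum>n<?l. - u * (\<Sum>m<?l. F (ls ! i) (ls ! m) * X $$ (m, n)) * G (ls ! n) j)"
      by (simp add: sum_distrib_left sum_distrib_right mult_ac)
    also have "\<dots> = (\<Sum>n<?l. if i = n then - (det A * u) * G (ls ! n) j else 0)"
      by (intro sum.cong refl) (use AX i in auto)
    also have "\<dots> = - G l j" using i u by simp
    finally show ?thesis by simp
  qed
  then show ?thesis by blast
qed

lemma set_det_triangular:
  fixes F :: "'a::linorder \<Rightarrow> 'a \<Rightarrow> 'r::idom" and rank :: "'a \<Rightarrow> nat"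
  assumes "finite L"
    and "\<And>l k. l \<in> L \<Longrightarrow> k \<in> L \<Longrightarrow> l \<noteq> k \<Longrightarrow> rank l \<le> rank k \<Longrightarrow> F l k = 0"
  shows "set_det L F = (\<Prod>l\<in>L. F l l)"
proof -
  define ls where "ls = sort_key rank (sorted_list_of_set L)"
  have ls: "set ls = L" "distinct ls" "sorted (map rank ls)" using assms(1) by (simp_all add: ls_def)
  let ?l = "length ls"
  define A where "A = mat ?l ?l (\<lambda>(i, j). F (ls ! i) (ls ! j))"
  have A: "A \<in> carrier_mat ?l ?l" by (simp add: A_def)
  have "det A = prod_list (diag_mat A)"
  proof (rule det_lower_triangular[OF _ A])
    fix i j assume ij: "i < j" "j < ?l"
    have "rank (ls ! i) \<le> rank (ls ! j)" using ij ls(3) by (simp add: sorted_iff_nth_mono)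
    moreover have "ls ! i \<noteq> ls ! j" using ij ls(2) by (simp add: nth_eq_iff_index_eq)
    moreover have "ls ! i \<in> L" "ls ! j \<in> L" using ij ls(1) nth_mem[of _ ls] by simp_all
    ultimately have "F (ls ! i) (ls ! j) = 0" using assms(2) by blast
    then show "A $$ (i, j) = 0" using ij by (simp add: A_def)
  qed
  also have "\<dots> = (\<Prod>i<?l. A $$ (i, i))"
    using A by (simp add: prod_list_diag_prod atLeast0LessThan)
  also have "\<dots> = (\<Prod>i<?l. F (ls ! i) (ls ! i))" by (intro prod.cong) (auto simp: A_def)
  also have "\<dots> = (\<Prod>l\<in>set ls. F l l)"
    by (rule prod.reindex_bij_betw[OF bij_betw_nth[OF ls(2) refl refl], of "\<lambda>l. F l l"])
  finally show ?thesis using ls set_det_list[of ls F] by (simp add: list_det_def A_def)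
qed

section \<open>The Fox matrix and its minors\<close>

abbreviation gen_value :: "gen \<Rightarrow> laurent" where "gen_value g \<equiv> lpower (gen_var g) 1"

abbreviation fox_eval :: "gen \<Rightarrow> gword \<Rightarrow> laurent" where
  "fox_eval g w \<equiv> eval_group_ring (fox g w)"

lemma eval_word_Nil [simp]: "eval_word [] = 1"
  by (simp add: eval_word_def)

lemma eval_word_Cons [simp]:
  "eval_word ((h, e) # w) = lpower (gen_var h) (if e then 1 else - 1) * eval_word w"
  by (simp add: eval_word_def)

lemma eval_group_ring_Nil [simp]: "eval_group_ring [] = 0"
  by (simp add: eval_group_ring_def)

lemma eval_group_ring_Cons [simp]:
  "eval_group_ring ((c, w) # F) = of_int c * eval_word w + eval_group_ring F"
  by (simp add: eval_group_ring_def)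

lemma eval_group_ring_append [simp]:
  "eval_group_ring (F @ G) = eval_group_ring F + eval_group_ring G"
  by (simp add: eval_group_ring_def)

lemma eval_group_ring_shift [simp]:
  "eval_group_ring (map (\<lambda>(c, v). (c, (h, e) # v)) F)
     = lpower (gen_var h) (if e then 1 else - 1) * eval_group_ring F"
  by (induction F) (auto simp: algebra_simps)

text \<open>
  Fox's fundamental formula, in the commutative ring. For a relator the right-hand side is 0, so the
  values \<open>g - 1\<close> form a vector in the kernel of the Fox matrix.
\<close>

lemma fundamental_fox_identity:
  assumes "finite G" "fst ` set w \<subseteq> G"
  shows "(\<Sum>g\<in>G. fox_eval g w * (gen_value g - 1)) = eval_word w - 1"
  using assms(2)
proof (induction w)
  case (Cons a w)
  obtain h e where a: "a = (h, e)" by (cases a)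
  have h: "h \<in> G" using Cons.prems a by auto
  let ?p = "lpower (gen_var h) (if e then 1 else - 1)"
  let ?d = "if e then 1 else - ?p"
  have "fox_eval g (a # w) = (if g = h then ?d else 0) + ?p * fox_eval g w" for g
    using a by (cases e) auto
  then have "(\<Sum>g\<in>G. fox_eval g (a # w) * (gen_value g - 1))
      = (\<Sum>g\<in>G. (if g = h then ?d * (gen_value h - 1) else 0) + ?p * (fox_eval g w * (gen_value g - 1)))"
    by (intro sum.cong) (auto simp: algebra_simps)
  also have "\<dots> = ?d * (gen_value h - 1) + ?p * (eval_word w - 1)"
    using h assms(1) Cons by (simp add: sum.distrib sum_distrib_left[symmetric])
  also have "\<dots> = eval_word (a # w) - 1"
    using a by (cases e) (simp_all add: algebra_simps lpower_mult)
  finally show ?case .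
qed simp

lemma lpower_cancel:
  "lpower x 1 * lpower x (- 1) = 1"
  "lpower x 1 * (lpower x (- 1) * a) = a"
  "lpower x 1 * (b * lpower x (- 1)) = b"
  "lpower x 1 * (b * (lpower x (- 1) * a)) = b * a"
proof -
  show *: "lpower x 1 * lpower x (- 1) = 1" by (simp add: lpower_mult)
  have "lpower x 1 * (lpower x (- 1) * a) = (lpower x 1 * lpower x (- 1)) * a" for a
    by (simp add: mult.assoc)
  then show "lpower x 1 * (lpower x (- 1) * a) = a" for a by (simp add: *)
  then show "lpower x 1 * (b * lpower x (- 1)) = b" "lpower x 1 * (b * (lpower x (- 1) * a)) = b * a"
    by (metis mult.commute mult.left_commute)+
qed

text \<open>
  The relation at a passage expresses the semi-arc that begins there. \<open>own_coeff\<close> is the coefficient of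
  the semi-arc that the strand itself brings in, \<open>cross_coeff\<close> that of the semi-arc brought in by the
  other strand. The integer \<open>\<sigma>\<close> is 1 if the strand runs from bottom left to top right, and -1
  otherwise; so an even crossing has sign \<open>\<sigma>\<close> if the strand is over, and sign \<open>- \<sigma>\<close> if it is under.
\<close>

definition own_coeff :: "bool \<Rightarrow> bool \<Rightarrow> bool \<Rightarrow> int \<Rightarrow> laurent" where
  "own_coeff vi od ov \<sigma> =
     (if vi then lpower Var_q \<sigma> else if od then lpower Var_theta \<sigma>
      else if ov then lpower Var_s \<sigma> else lpower Var_t (- \<sigma>))"

definition cross_coeff :: "bool \<Rightarrow> bool \<Rightarrow> bool \<Rightarrow> int \<Rightarrow> laurent" where
  "cross_coeff vi od ov \<sigma> =
     (if vi \<or> od \<or> ov then 0 else 1 - lpower Var_t (- \<sigma>) * lpower Var_s (- \<sigma>))"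

definition arc_matrix :: "vdiagram \<Rightarrow> laurent mat" where
  "arc_matrix D = mat (length (passages D)) (length (passages D))
     (\<lambda>(i, j). fox_eval (Arc j) (crossing_relator D i))"

definition passage_sign :: "vdiagram \<Rightarrow> nat \<Rightarrow> int" where
  "passage_sign D i = (if left_to_right D i then 1 else - 1)"

lemma fox_crossing_relator:
  "fox_eval (Arc j) (crossing_relator D i)
     = (let t = passages D ! i; vi = curve D t \<in> virt D; od = odd_crossing D (curve D t); \<sigma> = passage_sign D i in
        (if j = i then own_coeff vi od (over D t) \<sigma> else 0)
      + (if j = mate D i then cross_coeff vi od (over D t) \<sigma> else 0)
      - (if j = Suc i mod length (passages D) then 1 else 0))"
  by (cases "left_to_right D i"; cases "over D (passages D ! i)")
     (auto simp: crossing_relator_def kind_at_def Let_def own_coeff_def cross_coeff_def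
      passage_sign_def algebra_simps lpower_cancel)

lemma eval_crossing_relator: "eval_word (crossing_relator D i) = 1"
  by (cases "kind_at D i")
     (auto simp: crossing_relator_def algebra_simps lpower_cancel)

lemma relators_nth:
  "i < length (passages D) \<Longrightarrow> relators D ! i = crossing_relator D i"
  "relators D ! length (passages D) = gcomm S Q"
  "relators D ! Suc (length (passages D)) = gcomm S Theta"
  "relators D ! Suc (Suc (length (passages D))) = gcomm Theta Q"
  by (simp_all add: relators_def nth_append)

lemma generators_nth:
  "j < length (passages D) \<Longrightarrow> generators D ! j = Arc j"
  "generators D ! length (passages D) = S"
  "generators D ! Suc (length (passages D)) = Q"
  "generators D ! Suc (Suc (length (passages D))) = Theta"
  by (simp_all add: generators_def nth_append)

lemma lpower_neq_1: "lpower x 1 \<noteq> 1"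
proof
  assume "lpower x 1 = 1"
  then have "Poly_Mapping.keys (lpower x 1) = Poly_Mapping.keys (1 :: laurent)" by simp
  then have "Poly_Mapping.single x (1::int) = 0" by simp
  then show False by (metis lookup_single_eq lookup_zero zero_neq_one)
qed

text \<open>
  The Fox matrix then has two linearly independent kernel vectors: a kernel vector of the arc matrix,
  extended by zeros, and the vector of the values \<open>g - 1\<close>, which has no zero entry. Some nontrivial
  combination of the two vanishes at the deleted column, and it remains in the kernel when that column
  and any row are removed.
\<close>

lemma arc_matrix_eq_0_imp_minor_eq_0:
  assumes mate: "\<And>i. i < length (passages D) \<Longrightarrow> mate D i < length (passages D)"
    and det0: "det (arc_matrix D) = 0"
    and r: "r < dim_row (fox_matrix D)" and c: "c < dim_col (fox_matrix D)"
  shows "det (mat_delete (fox_matrix D) r c) = 0"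
proof -
  define N where "N = length (passages D)"
  define M where "M = fox_matrix D"
  have M: "M \<in> carrier_mat (N + 3) (N + 3)"
    by (simp add: M_def fox_matrix_def Let_def N_def)
  have M_nth: "M $$ (i, j) = fox_eval (generators D ! j) (relators D ! i)" if "i < N + 3" "j < N + 3" for i j
    using that by (simp add: M_def fox_matrix_def Let_def N_def)
  have rc: "r < N + 3" "c < N + 3" using r c M unfolding M_def[symmetric] by auto
  have "arc_matrix D \<in> carrier_mat N N" by (simp add: arc_matrix_def N_def)
  from det_0_iff_vec_prod_zero[OF this] det0 obtain x where
    x: "x \<in> carrier_vec N" "x \<noteq> 0\<^sub>v N" "arc_matrix D *\<^sub>v x = 0\<^sub>v N" by auto
  then obtain j0 where j0: "j0 < N" "x $ j0 \<noteq> 0" by (metis eq_vecI carrier_vecD index_zero_vec)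
  define x' where "x' j = (if j < N then x $ j else 0)" for j
  define v where "v j = gen_value (generators D ! j) - 1" for j
  have v0: "v j \<noteq> 0" for j by (simp add: v_def lpower_neq_1)
  have sumN: "(\<Sum>j<N + 3. f j) = (\<Sum>j<N. f j) + f N + f (Suc N) + f (Suc (Suc N))"
    for f :: "nat \<Rightarrow> laurent" by (simp add: numeral_3_eq_3)
  have x'0: "(\<Sum>j<N + 3. M $$ (i, j) * x' j) = 0" if "i < N + 3" for i
  proof -
    have eq: "(\<Sum>j<N + 3. M $$ (i, j) * x' j) = (\<Sum>j<N. fox_eval (Arc j) (relators D ! i) * x $ j)"
    proof -
      have "(\<Sum>j<N + 3. M $$ (i, j) * x' j) = (\<Sum>j<N. M $$ (i, j) * x $ j)"
        by (simp only: sumN) (simp add: x'_def)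
      then show ?thesis using that by (simp add: M_nth generators_nth(1)[of _ D, folded N_def])
    qed
    show ?thesis
    proof (cases "i < N")
      case True
      have "0 = (arc_matrix D *\<^sub>v x) $ i" using x True by simp
      also have "\<dots> = (\<Sum>j<N. fox_eval (Arc j) (relators D ! i) * x $ j)"
        using True x(1) by (simp add: arc_matrix_def scalar_prod_def N_def relators_nth(1) atLeast0LessThan)
      finally show ?thesis using eq by simp
    next
      case False
      then have "i = N \<or> i = Suc N \<or> i = Suc (Suc N)" using that by linarith
      then have "fox_eval (Arc j) (relators D ! i) = 0" for j
        using relators_nth(2-4)[of D] by (auto simp: N_def gcomm_def)
      then show ?thesis using eq by simp
    qed
  qed
  have v_kernel: "(\<Sum>j<N + 3. M $$ (i, j) * v j) = 0" if "i < N + 3" for i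
  proof -
    have inj: "inj_on (\<lambda>j. generators D ! j) {..<N + 3}"
    proof -
      have "distinct (generators D)" "length (generators D) = N + 3"
        by (auto simp: generators_def N_def distinct_map inj_on_def)
      then show ?thesis by (auto simp: inj_on_def nth_eq_iff_index_eq)
    qed
    have img: "(\<lambda>j. generators D ! j) ` {..<N + 3} = set (generators D)"
      by (auto simp: set_conv_nth generators_def N_def)
    have gens: "set (generators D) = Arc ` {..<N} \<union> {S, Q, Theta}"
      by (auto simp: generators_def N_def)
    have letters: "fst ` set (relators D ! i) \<subseteq> set (generators D) \<and> eval_word (relators D ! i) = 1"
    proof (cases "i < N")
      case True
      then have "mate D i < N" using mate by (simp add: N_def)
      moreover have "Suc i mod N < N" using True by (intro mod_less_divisor) simp
      ultimately have "fst ` set (crossing_relator D i) \<subseteq> set (generators D)"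
        using True unfolding gens
        by (cases "kind_at D i") (auto simp: crossing_relator_def N_def[symmetric])
      then show ?thesis
        using True eval_crossing_relator by (simp add: relators_nth(1) N_def)
    next
      case False
      then have "i = N \<or> i = Suc N \<or> i = Suc (Suc N)" using that by linarith
      then show ?thesis
        using relators_nth(2-4)[of D] unfolding gens
        by (auto simp: N_def gcomm_def algebra_simps lpower_cancel)
    qed
    have "(\<Sum>j<N + 3. M $$ (i, j) * v j)
        = (\<Sum>j<N + 3. fox_eval (generators D ! j) (relators D ! i) * (gen_value (generators D ! j) - 1))"
      using that by (intro sum.cong) (auto simp: M_nth v_def)
    also have "\<dots> = (\<Sum>g\<in>set (generators D). fox_eval g (relators D ! i) * (gen_value g - 1))"
      unfolding img[symmetric] by (simp only: sum.reindex[OF inj] o_def)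
    also have "\<dots> = 0"
      using fundamental_fox_identity[of "set (generators D)" "relators D ! i"] letters by simp
    finally show ?thesis .
  qed
  \<comment> \<open>This combination vanishes at the deleted column c.\<close>
  define y where "y j = v c * x' j - x' c * v j" for j
  have y_kernel: "(\<Sum>j<N + 3. M $$ (i, j) * y j) = 0" if "i < N + 3" for i
  proof -
    have "(\<Sum>j<N + 3. M $$ (i, j) * y j)
        = v c * (\<Sum>j<N + 3. M $$ (i, j) * x' j) - x' c * (\<Sum>j<N + 3. M $$ (i, j) * v j)"
      by (simp add: y_def sum_distrib_left sum_subtractf[symmetric] algebra_simps)
    then show ?thesis using that x'0 v_kernel by simp
  qed
  have yc: "y c = 0" by (simp add: y_def mult.commute)
  obtain k where k: "k < N + 3" "y k \<noteq> 0"
  proof (cases "x' c = 0")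
    case True
    then have "y j0 \<noteq> 0" using j0 v0 by (simp add: y_def x'_def)
    then show thesis using that[of j0] j0(1) by simp
  next
    case False
    then have "y N \<noteq> 0" using v0 by (simp add: y_def x'_def)
    then show thesis using that[of N] by simp
  qed
  define skip where "skip j = (if j < c then j else Suc j)" for j
  have kc: "k \<noteq> c" using k yc by auto
  define w where "w = vec (N + 2) (\<lambda>j. y (skip j))"
  have skip_image: "skip ` {..<N + 2} = {..<N + 3} - {c}"
  proof
    show "skip ` {..<N + 2} \<subseteq> {..<N + 3} - {c}" by (auto simp: skip_def)
    show "{..<N + 3} - {c} \<subseteq> skip ` {..<N + 2}"
    proof
      fix j assume j: "j \<in> {..<N + 3} - {c}"
      then have "j = skip (if j < c then j else j - 1)" "(if j < c then j else j - 1) < N + 2"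
        using rc by (auto simp: skip_def)
      then show "j \<in> skip ` {..<N + 2}" by blast
    qed
  qed
  have skip_inj: "inj_on skip {..<N + 2}" by (auto simp: inj_on_def skip_def split: if_splits)
  have del: "mat_delete M r c \<in> carrier_mat (N + 2) (N + 2)" using mat_delete_carrier[OF M, of r c] by simp
  have "w \<noteq> 0\<^sub>v (N + 2)"
  proof -
    have "k \<in> skip ` {..<N + 2}" using skip_image k kc by auto
    then obtain j where "j < N + 2" "skip j = k" by auto
    then have "w $ j \<noteq> 0" "j < N + 2" using k by (auto simp: w_def)
    then show ?thesis by auto
  qed
  moreover have "mat_delete M r c *\<^sub>v w = 0\<^sub>v (N + 2)"
  proof (rule eq_vecI)
    fix i assume i: "i < dim_vec (0\<^sub>v (N + 2) :: laurent vec)"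
    let ?i = "if i < r then i else Suc i"
    have "(mat_delete M r c *\<^sub>v w) $ i = (\<Sum>j<N + 2. M $$ (?i, skip j) * y (skip j))"
      using i M del by (simp add: mat_delete_def scalar_prod_def w_def skip_def atLeast0LessThan)
    also have "\<dots> = (\<Sum>j\<in>{..<N + 3} - {c}. M $$ (?i, j) * y j)"
      unfolding skip_image[symmetric] by (simp only: sum.reindex[OF skip_inj] o_def)
    also have "\<dots> = (\<Sum>j<N + 3. M $$ (?i, j) * y j)"
      using yc rc by (simp add: sum.remove[of _ c])
    also have "\<dots> = 0" using i by (intro y_kernel) auto
    finally show "(mat_delete M r c *\<^sub>v w) $ i = 0\<^sub>v (N + 2) $ i" using i by simp
  qed (use del in auto)
  moreover have "w \<in> carrier_vec (N + 2)" by (simp add: w_def)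
  ultimately show ?thesis
    unfolding M_def[symmetric] using det_0_iff_vec_prod_zero[OF del] by blast
qed

text \<open>
  Without the last commutator row and the column of s, the Fox matrix is block triangular: the
  commutators of s with q and with \<open>\<theta>\<close> do not contain semi-arcs, and their derivatives with respect to q
  and \<open>\<theta>\<close> are \<open>s - 1\<close> on the diagonal.
\<close>

lemma arc_matrix_minor:
  "det (mat_delete (fox_matrix D) (length (passages D) + 2) (length (passages D)))
     = det (arc_matrix D) * (lpower Var_s 1 - 1)\<^sup>2"
proof -
  define N where "N = length (passages D)"
  define B where "B = mat N 2 (\<lambda>(i, j). fox_matrix D $$ (i, N + 1 + j))"
  have A: "arc_matrix D \<in> carrier_mat N N" by (simp add: arc_matrix_def N_def)
  have "mat_delete (fox_matrix D) (N + 2) N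
      = four_block_mat (arc_matrix D) B (0\<^sub>m 2 N) ((lpower Var_s 1 - 1) \<cdot>\<^sub>m 1\<^sub>m 2)"
  proof (rule eq_matI)
    show "dim_row (mat_delete (fox_matrix D) (N + 2) N)
        = dim_row (four_block_mat (arc_matrix D) B (0\<^sub>m 2 N) ((lpower Var_s 1 - 1) \<cdot>\<^sub>m 1\<^sub>m 2))"
      "dim_col (mat_delete (fox_matrix D) (N + 2) N)
        = dim_col (four_block_mat (arc_matrix D) B (0\<^sub>m 2 N) ((lpower Var_s 1 - 1) \<cdot>\<^sub>m 1\<^sub>m 2))"
      by (simp_all add: fox_matrix_def Let_def N_def arc_matrix_def)
    fix i j assume "i < dim_row (four_block_mat (arc_matrix D) B (0\<^sub>m 2 N) ((lpower Var_s 1 - 1) \<cdot>\<^sub>m 1\<^sub>m 2))"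
      "j < dim_col (four_block_mat (arc_matrix D) B (0\<^sub>m 2 N) ((lpower Var_s 1 - 1) \<cdot>\<^sub>m 1\<^sub>m 2))"
    then have ij: "i < N + 2" "j < N + 2" by (simp_all add: arc_matrix_def N_def)
    have gen: "relators D ! N = gcomm S Q" "relators D ! Suc N = gcomm S Theta"
      "generators D ! Suc N = Q" "generators D ! Suc (Suc N) = Theta"
      using relators_nth(2-4)[of D] generators_nth(2-4)[of D] by (simp_all add: N_def)
    consider "i < N" | "i = N" | "i = Suc N" using ij by linarith
    then show "mat_delete (fox_matrix D) (N + 2) N $$ (i, j)
        = four_block_mat (arc_matrix D) B (0\<^sub>m 2 N) ((lpower Var_s 1 - 1) \<cdot>\<^sub>m 1\<^sub>m 2) $$ (i, j)"
    proof cases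
      case 1
      then show ?thesis using ij
        by (auto simp: mat_delete_def fox_matrix_def Let_def arc_matrix_def B_def N_def[symmetric]
            relators_nth(1)[of _ D, folded N_def] generators_nth(1)[of _ D, folded N_def])
    next
      case 2
      consider "j < N" | "j = N" | "j = Suc N" using ij by linarith
      then show ?thesis using 2
        by cases (auto simp: mat_delete_def fox_matrix_def Let_def arc_matrix_def N_def[symmetric] gen gcomm_def
            generators_nth(1)[of _ D, folded N_def] algebra_simps lpower_cancel)
    next
      case 3
      consider "j < N" | "j = N" | "j = Suc N" using ij by linarith
      then show ?thesis using 3
        by cases (auto simp: mat_delete_def fox_matrix_def Let_def arc_matrix_def N_def[symmetric] gen gcomm_def
            generators_nth(1)[of _ D, folded N_def] algebra_simps lpower_cancel)
    qed
  qed
  then have "det (mat_delete (fox_matrix D) (N + 2) N)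
      = det (arc_matrix D) * det ((lpower Var_s 1 - 1) \<cdot>\<^sub>m (1\<^sub>m 2 :: laurent mat))"
    by (simp only:) (rule det_four_block_mat_lower_left_zero[of _ N _ 2], simp_all add: A B_def)
  then show ?thesis by (simp add: N_def)
qed

text \<open>
  It suffices that f divides one minor with the right width; all the minors matter only if the
  determinant is 0.
\<close>

lemma diagram_pva_width_le:
  assumes mate: "\<And>i. i < length (passages D) \<Longrightarrow> mate D i < length (passages D)"
    and pva: "diagram_pva D f" "crossing_params D \<noteq> {}" and x: "x = Var_q \<or> x = Var_theta"
  shows "width x f \<le> width x (det (arc_matrix D))"
proof -
  define ms where "ms = {det (mat_delete (fox_matrix D) i j) |i j.
                       i < dim_row (fox_matrix D) \<and> j < dim_col (fox_matrix D)}"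
  have gcd: "is_gcd f ms" using pva by (simp add: diagram_pva_def ms_def)
  show ?thesis
  proof (cases "det (arc_matrix D) = 0")
    case True
    then have "\<forall>m\<in>ms. 0 dvd m" using arc_matrix_eq_0_imp_minor_eq_0[OF mate] by (auto simp: ms_def)
    then have "0 dvd f" using gcd unfolding is_gcd_def by blast
    then show ?thesis using True by simp
  next
    case False
    let ?s = "lpower Var_s 1 - 1 :: laurent"
    have s0: "?s\<^sup>2 \<noteq> 0" using lpower_neq_1[of Var_s] by simp
    have "det (arc_matrix D) * ?s\<^sup>2 \<in> ms"
      unfolding arc_matrix_minor[symmetric] ms_def mem_Collect_eq
      by (rule exI[of _ "length (passages D) + 2"], rule exI[of _ "length (passages D)"])
        (simp add: fox_matrix_def Let_def)
    then have "f dvd det (arc_matrix D) * ?s\<^sup>2" using gcd by (simp add: is_gcd_def)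
    then have "width x f \<le> width x (det (arc_matrix D)) + width x (?s\<^sup>2)"
      using width_dvd_mono[of f "det (arc_matrix D) * ?s\<^sup>2" x] width_mult[OF False s0, of x] False s0 by simp
    moreover have "exps_within x (0 + 0) (0 + 0) (?s * ?s)"
      by (rule exps_within_mult; rule exps_within_diff) (use x in auto)
    then have "width x (?s\<^sup>2) \<le> 0"
      using width_le[of x 0 0 "?s\<^sup>2"] by (simp add: power2_eq_square)
    ultimately show ?thesis by linarith
  qed
qed

section \<open>Systems of relations on a cyclically ordered set\<close>

text \<open>
  The set P lies in one period of the curve, so the cyclic order of the circle is that of the reals
  except that the predecessor of the first point is the last one.
\<close>

definition cyc_pred :: "real set \<Rightarrow> real \<Rightarrow> real" where
  "cyc_pred P t = (if \<exists>x\<in>P. x < t then Max {x \<in> P. x < t} else Max P)"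

lemma cyc_pred_in: "finite P \<Longrightarrow> P \<noteq> {} \<Longrightarrow> cyc_pred P t \<in> P"
  using Max_in[of "{x \<in> P. x < t}"] Max_in[of P] by (auto simp: cyc_pred_def)

lemma cyc_pred_below:
  assumes "finite P" "p \<in> P" "p < t" "\<And>x. x \<in> P \<Longrightarrow> x < t \<Longrightarrow> x \<le> p"
  shows "cyc_pred P t = p"
  using assms by (auto simp: cyc_pred_def intro!: Max_eqI)

lemma cyc_pred_wrap:
  assumes "finite P" "p \<in> P" "\<And>x. x \<in> P \<Longrightarrow> t \<le> x" "\<And>x. x \<in> P \<Longrightarrow> x \<le> p"
  shows "cyc_pred P t = p"
  using assms by (force simp: cyc_pred_def intro!: Max_eqI)

lemma cyc_pred_cases:
  assumes "finite P" "P \<noteq> {}"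
  obtains (below) "cyc_pred P t < t" "\<And>x. x \<in> P \<Longrightarrow> x < t \<Longrightarrow> x \<le> cyc_pred P t"
  | (wrap) "\<And>x. x \<in> P \<Longrightarrow> t \<le> x" "\<And>x. x \<in> P \<Longrightarrow> x \<le> cyc_pred P t"
proof (cases "\<exists>x\<in>P. x < t")
  case True
  have "finite {x \<in> P. x < t}" "{x \<in> P. x < t} \<noteq> {}" using assms True by auto
  then have "cyc_pred P t \<in> {x \<in> P. x < t}" "\<forall>x\<in>{x \<in> P. x < t}. x \<le> cyc_pred P t"
    using Max_in Max_ge True by (simp_all add: cyc_pred_def) blast
  then show ?thesis using below by blast
next
  case False
  then show ?thesis using assms by (intro wrap) (auto simp: cyc_pred_def not_less)
qed

lemma cyc_pred_neq:
  assumes "finite P" "d \<in> P" "P \<noteq> {d}"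
  shows "cyc_pred P d \<noteq> d"
proof
  assume d: "cyc_pred P d = d"
  have ne: "P \<noteq> {}" using assms by auto
  show False
  proof (cases rule: cyc_pred_cases[OF assms(1) ne, of d])
    case 2
    then have "y = d" if "y \<in> P" for y using that d by (metis antisym)
    then show False using assms by blast
  qed (use d in auto)
qed

lemma cyc_pred_remove:
  assumes "finite P" "x \<noteq> d" "d \<in> P" "P \<noteq> {d}"
  shows "cyc_pred (P - {d}) x = (if cyc_pred P x = d then cyc_pred P d else cyc_pred P x)"
proof -
  have P: "P \<noteq> {}" "finite (P - {d})" "P - {d} \<noteq> {}" using assms by auto
  have inP: "cyc_pred P x \<in> P" "cyc_pred P d \<in> P" using cyc_pred_in assms(1) P(1) by auto
  have ned: "cyc_pred P d \<noteq> d" using cyc_pred_neq assms by blast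
  note cases = cyc_pred_cases[OF assms(1) P(1)]
  show ?thesis
  proof (cases "cyc_pred P x = d")
    case False
    then have in': "cyc_pred P x \<in> P - {d}" using inP by blast
    have "cyc_pred (P - {d}) x = cyc_pred P x"
    proof (cases rule: cases[of x])
      case 1
      then show ?thesis by (intro cyc_pred_below P(2) in') auto
    next
      case 2
      then show ?thesis by (intro cyc_pred_wrap P(2) in') auto
    qed
    then show ?thesis using False by simp
  next
    case True
    have in': "cyc_pred P d \<in> P - {d}" using inP ned by blast
    have "cyc_pred (P - {d}) x = cyc_pred P d"
    proof (cases rule: cases[of x])
      case 1
      then have dx: "d < x" "\<And>y. y \<in> P \<Longrightarrow> y < x \<Longrightarrow> y \<le> d" using True by auto
      show ?thesis
      proof (cases rule: cases[of d])
        case 1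
        then show ?thesis
          using dx by (intro cyc_pred_below P(2) in') (auto simp: less_le)
      next
        case 2
        have "x \<le> y" if "y \<in> P - {d}" for y
          using that dx(2)[of y] 2(1)[of y] by fastforce
        then show ?thesis using 2 by (intro cyc_pred_wrap P(2) in') auto
      qed
    next
      case 2
      then have dx: "\<And>y. y \<in> P \<Longrightarrow> x \<le> y" "\<And>y. y \<in> P \<Longrightarrow> y \<le> d" using True by auto
      show ?thesis
      proof (cases rule: cases[of d])
        case 1
        then show ?thesis using dx by (intro cyc_pred_wrap P(2) in') (auto simp: less_le)
      next
        case 2
        then have "cyc_pred P d = d" using dx inP by (metis antisym assms(3))
        then show ?thesis using ned by simp
      qed
    qed
    then show ?thesis using True by simp
  qed
qed

text \<open>
  Here L lies in gaps of A that are bounded by the pairs in G. Such points can only come between the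
  right end of a gap and its predecessor.
\<close>

lemma cyc_pred_outer:
  assumes "finite A" "finite L" "A \<noteq> {}" "t \<in> A"
    and L: "\<And>l. l \<in> L \<Longrightarrow> \<exists>(d, e)\<in>G. d < l \<and> l < e"
    and G: "\<And>d e. (d, e) \<in> G \<Longrightarrow> d \<in> A \<and> e \<in> A \<and> A \<inter> {d<..<e} = {} \<and> t \<noteq> e"
  shows "cyc_pred (A \<union> L) t = cyc_pred A t"
proof -
  have fin: "finite (A \<union> L)" using assms by auto
  have inA: "cyc_pred A t \<in> A \<union> L" using cyc_pred_in[OF assms(1,3)] by auto
  have cover: "\<exists>d e. d \<in> A \<and> e \<in> A \<and> d < l \<and> l < e \<and> (l < t \<longleftrightarrow> e < t)" if "l \<in> L" for l
  proof -
    obtain d e where de: "(d, e) \<in> G" "d < l" "l < e" using L[OF \<open>l \<in> L\<close>] by blast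
    have "t \<le> d \<or> e < t" using G[OF de(1)] assms(4) by (auto simp: disjoint_iff not_less)
    then show ?thesis using G[OF de(1)] de by fastforce
  qed
  show ?thesis
  proof (cases rule: cyc_pred_cases[OF assms(1,3), of t])
    case 1
    show ?thesis
    proof (rule cyc_pred_below[OF fin inA 1(1)])
      fix x assume "x \<in> A \<union> L" "x < t"
      then show "x \<le> cyc_pred A t" using 1(2) cover[of x] by fastforce
    qed
  next
    case 2
    show ?thesis
    proof (rule cyc_pred_wrap[OF fin inA])
      fix x assume x: "x \<in> A \<union> L"
      then show "t \<le> x" using 2(1) cover[of x] by fastforce
      show "x \<le> cyc_pred A t" using x 2(2) cover[of x] by fastforce
    qed
  qed
qed

text \<open>
  The unknown i is the semi-arc that begins at the passage i, so the one that ends there is the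
  unknown \<open>cyc_pred P i\<close>. The function m gives the other passage of the same crossing.
\<close>

definition relation_matrix ::
  "(real \<Rightarrow> 'r) \<Rightarrow> (real \<Rightarrow> 'r) \<Rightarrow> (real \<Rightarrow> real) \<Rightarrow> real set \<Rightarrow> real \<Rightarrow> real \<Rightarrow> 'r::comm_ring_1" where
  "relation_matrix a b m P i j =
     (if i = j then 1 else 0) - (if j = cyc_pred P i then a i else 0)
     - (if j = cyc_pred P (m i) then b i else 0)"

text \<open>
  Here U expresses all the unknowns by those in A, as a solution of the relations in L.
\<close>

lemma eliminate_passages:
  fixes a b :: "real \<Rightarrow> 'r::idom"
  assumes fin: "finite A" "finite L" and disj: "L \<inter> A = {}" and ne: "A \<noteq> {}"
    and unit: "set_det L (relation_matrix a b m (A \<union> L)) dvd 1"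
  obtains U where "\<And>i j. i \<in> A \<Longrightarrow> U i j = (if i = j then 1 else 0)"
    "\<And>l j. l \<in> L \<Longrightarrow> j \<in> A \<Longrightarrow>
       U l j = a l * U (cyc_pred (A \<union> L) l) j + b l * U (cyc_pred (A \<union> L) (m l)) j"
    "set_det (A \<union> L) (relation_matrix a b m (A \<union> L)) =
       set_det L (relation_matrix a b m (A \<union> L)) *
       set_det A (\<lambda>i j. (if i = j then 1 else 0) - a i * U (cyc_pred (A \<union> L) i) j
                        - b i * U (cyc_pred (A \<union> L) (m i)) j)"
proof -
  define P where "P = A \<union> L"
  let ?F = "relation_matrix a b m P"
  obtain W where W: "\<And>l j. l \<in> L \<Longrightarrow> ?F l j + (\<Sum>k\<in>L. ?F l k * W k j) = 0"
    using unit_set_det_solvable[OF fin(2) unit[folded P_def], of ?F] by blast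
  define U where "U i j = (if i \<in> A then if i = j then 1 else 0 else W i j)" for i j
  have pin: "cyc_pred P t \<in> P" for t using fin ne by (intro cyc_pred_in) (auto simp: P_def)
  have pick: "(if j = p then z else 0) + (\<Sum>k\<in>L. (if k = p then z else 0) * W k j) = z * U p j"
    if "j \<in> A" "p \<in> P" for j p z
  proof (cases "p \<in> A")
    case True
    then have "(\<Sum>k\<in>L. (if k = p then z else 0) * W k j) = 0"
      using disj by (intro sum.neutral) auto
    then show ?thesis using True by (auto simp: U_def)
  next
    case False
    then have "p \<in> L" "j \<noteq> p" using that by (auto simp: P_def)
    then show ?thesis using False fin(2) by (simp add: U_def if_distrib[of "\<lambda>x. x * _"] cong: if_cong)
  qed
  have key: "?F i j + (\<Sum>k\<in>L. ?F i k * W k j)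
     = U i j - a i * U (cyc_pred P i) j - b i * U (cyc_pred P (m i)) j" if "i \<in> P" "j \<in> A" for i j
  proof -
    have "?F i j + (\<Sum>k\<in>L. ?F i k * W k j)
      = ((if j = i then 1 else 0) + (\<Sum>k\<in>L. (if k = i then 1 else 0) * W k j))
      - ((if j = cyc_pred P i then a i else 0) + (\<Sum>k\<in>L. (if k = cyc_pred P i then a i else 0) * W k j))
      - ((if j = cyc_pred P (m i) then b i else 0) + (\<Sum>k\<in>L. (if k = cyc_pred P (m i) then b i else 0) * W k j))"
      unfolding relation_matrix_def
      by (simp add: sum_subtractf left_diff_distrib eq_commute[of i])
    then show ?thesis using pick[OF that(2) that(1), of 1] pick[OF that(2) pin] by simp
  qed
  have "set_det (L \<union> A) ?F = set_det L ?F * set_det A (\<lambda>i j. ?F i j + (\<Sum>k\<in>L. ?F i k * W k j))"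
    by (rule set_det_schur) (use fin disj W in auto)
  also have "set_det A (\<lambda>i j. ?F i j + (\<Sum>k\<in>L. ?F i k * W k j))
     = set_det A (\<lambda>i j. (if i = j then 1 else 0) - a i * U (cyc_pred P i) j - b i * U (cyc_pred P (m i)) j)"
  proof (rule set_det_cong)
    fix i j assume "i \<in> A" "j \<in> A"
    then show "?F i j + (\<Sum>k\<in>L. ?F i k * W k j)
      = (if i = j then 1 else 0) - a i * U (cyc_pred P i) j - b i * U (cyc_pred P (m i)) j"
      using key[of i j] by (simp add: P_def) (simp add: U_def)
  qed
  finally have det: "set_det P ?F = set_det L ?F * \<dots>" by (simp add: P_def Un_commute)
  show thesis
  proof (rule that[of U])
    show "\<And>i j. i \<in> A \<Longrightarrow> U i j = (if i = j then 1 else 0)" by (simp add: U_def)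
    show "U l j = a l * U (cyc_pred (A \<union> L) l) j + b l * U (cyc_pred (A \<union> L) (m l)) j"
      if "l \<in> L" "j \<in> A" for l j
    proof -
      have "U l j - a l * U (cyc_pred P l) j - b l * U (cyc_pred P (m l)) j = 0"
        unfolding key[of l j, symmetric, OF UnI2[OF that(1), of A, folded P_def] that(2)] by (rule W[OF that(1)])
      then show ?thesis by (simp add: P_def algebra_simps)
    qed
  qed (use det in \<open>simp add: P_def\<close>)
qed

text \<open>
  A pair \<open>(d, e)\<close> in G encloses a piece of strand between two trivial passages. After the elimination
  of the passages in L, the remaining relations depend on them only through the unknowns that arrive
  at the right ends e, as functions of the unknowns at the left ends d. If the tangles L and L' transmit
  the same function, then the two reduced matrices on A are equal.
\<close>

lemma tangle_replacement:
  fixes a b a' b' :: "real \<Rightarrow> 'r::idom"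
  assumes fin: "finite A" "finite L" "finite L'" and ne: "A \<noteq> {}"
    and G: "\<And>d e. (d, e) \<in> G \<Longrightarrow> d \<in> A \<and> e \<in> A \<and> A \<inter> {d<..<e} = {}"
    and L: "\<And>l. l \<in> L \<union> L' \<Longrightarrow> \<exists>(d, e)\<in>G. d < l \<and> l < e"
    and outer: "\<And>i. i \<in> A \<Longrightarrow> a i = a' i \<and> b i = b' i \<and> (b i \<noteq> 0 \<longrightarrow> m i = m' i \<and> m i \<in> A)"
    and units: "set_det L (relation_matrix a b m (A \<union> L)) dvd 1"
      "set_det L' (relation_matrix a' b' m' (A \<union> L')) dvd 1"
    and same: "\<And>V V' d e. \<lbrakk>\<And>i. i \<in> A \<Longrightarrow> V i = V' i;
      \<And>l. l \<in> L \<Longrightarrow> V l = a l * V (cyc_pred (A \<union> L) l) + b l * V (cyc_pred (A \<union> L) (m l));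
      \<And>l. l \<in> L' \<Longrightarrow> V' l = a' l * V' (cyc_pred (A \<union> L') l) + b' l * V' (cyc_pred (A \<union> L') (m' l));
      (d, e) \<in> G\<rbrakk> \<Longrightarrow> V (cyc_pred (A \<union> L) e) = V' (cyc_pred (A \<union> L') e)"
  shows "set_det (A \<union> L) (relation_matrix a b m (A \<union> L)) dvd
           set_det (A \<union> L') (relation_matrix a' b' m' (A \<union> L')) \<and>
         set_det (A \<union> L') (relation_matrix a' b' m' (A \<union> L')) dvd
           set_det (A \<union> L) (relation_matrix a b m (A \<union> L))"
proof -
  have disj: "L \<inter> A = {}" "L' \<inter> A = {}" using L G by (fastforce simp: disjoint_iff)+
  obtain U where U: "\<And>i j. i \<in> A \<Longrightarrow> U i j = (if i = j then 1 else 0)"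
    "\<And>l j. l \<in> L \<Longrightarrow> j \<in> A \<Longrightarrow>
       U l j = a l * U (cyc_pred (A \<union> L) l) j + b l * U (cyc_pred (A \<union> L) (m l)) j"
    "set_det (A \<union> L) (relation_matrix a b m (A \<union> L)) =
       set_det L (relation_matrix a b m (A \<union> L)) *
       set_det A (\<lambda>i j. (if i = j then 1 else 0) - a i * U (cyc_pred (A \<union> L) i) j
                        - b i * U (cyc_pred (A \<union> L) (m i)) j)"
    using eliminate_passages[OF fin(1,2) disj(1) ne units(1)] by blast
  obtain U' where U': "\<And>i j. i \<in> A \<Longrightarrow> U' i j = (if i = j then 1 else 0)"
    "\<And>l j. l \<in> L' \<Longrightarrow> j \<in> A \<Longrightarrow>
       U' l j = a' l * U' (cyc_pred (A \<union> L') l) j + b' l * U' (cyc_pred (A \<union> L') (m' l)) j"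
    "set_det (A \<union> L') (relation_matrix a' b' m' (A \<union> L')) =
       set_det L' (relation_matrix a' b' m' (A \<union> L')) *
       set_det A (\<lambda>i j. (if i = j then 1 else 0) - a' i * U' (cyc_pred (A \<union> L') i) j
                        - b' i * U' (cyc_pred (A \<union> L') (m' i)) j)"
    using eliminate_passages[OF fin(1,3) disj(2) ne units(2)] by blast
  have out: "U (cyc_pred (A \<union> L) t) j = U' (cyc_pred (A \<union> L') t) j" if t: "t \<in> A" and j: "j \<in> A" for t j
  proof (cases "\<exists>d. (d, t) \<in> G")
    case True
    then obtain d where "(d, t) \<in> G" by blast
    then show ?thesis
      using same[of "\<lambda>i. U i j" "\<lambda>i. U' i j" d t] U(1,2) U'(1,2) j by simp
  next
    case False
    then have "cyc_pred (A \<union> L) t = cyc_pred A t" "cyc_pred (A \<union> L') t = cyc_pred A t"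
      using L G t fin ne by (intro cyc_pred_outer[where G = G]; fastforce)+
    moreover have "cyc_pred A t \<in> A" using cyc_pred_in[OF fin(1) ne] .
    ultimately show ?thesis using U(1) U'(1) by simp
  qed
  have eq: "set_det A (\<lambda>i j. (if i = j then 1 else 0) - a i * U (cyc_pred (A \<union> L) i) j
                        - b i * U (cyc_pred (A \<union> L) (m i)) j)
      = set_det A (\<lambda>i j. (if i = j then 1 else 0) - a' i * U' (cyc_pred (A \<union> L') i) j
                        - b' i * U' (cyc_pred (A \<union> L') (m' i)) j)"
  proof (rule set_det_cong)
    fix i j assume ij: "i \<in> A" "j \<in> A"
    have "b i * U (cyc_pred (A \<union> L) (m i)) j = b' i * U' (cyc_pred (A \<union> L') (m' i)) j"
      using outer[OF ij(1)] out[of "m i" j] ij by (cases "b i = 0") auto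
    then show "(if i = j then 1 else 0) - a i * U (cyc_pred (A \<union> L) i) j - b i * U (cyc_pred (A \<union> L) (m i)) j
        = (if i = j then 1 else 0) - a' i * U' (cyc_pred (A \<union> L') i) j
            - b' i * U' (cyc_pred (A \<union> L') (m' i)) j"
      using outer[OF ij(1)] out[OF ij] by simp
  qed
  show ?thesis
    unfolding U(3) U'(3) eq
    by (intro conjI mult_dvd_mono dvd_refl dvd_trans[OF units(1) one_dvd] dvd_trans[OF units(2) one_dvd])
qed

text \<open>
  If each local relation refers only to local unknowns of smaller rank, the local block is
  unitriangular.
\<close>

lemma relation_matrix_triangular_unit:
  fixes a b :: "real \<Rightarrow> 'r::idom" and rank :: "real \<Rightarrow> nat"
  assumes "finite L"
    and "\<And>l. l \<in> L \<Longrightarrow> cyc_pred P l \<in> L \<Longrightarrow> rank (cyc_pred P l) < rank l"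
    and "\<And>l. l \<in> L \<Longrightarrow> b l \<noteq> 0 \<Longrightarrow> cyc_pred P (m l) \<in> L \<Longrightarrow> rank (cyc_pred P (m l)) < rank l"
  shows "set_det L (relation_matrix a b m P) dvd 1"
proof -
  have off: "relation_matrix a b m P l k = (if l = k then 1 else 0)"
    if "l \<in> L" "k \<in> L" "rank l \<le> rank k" for l k
  proof -
    have "k \<noteq> cyc_pred P l" using assms(2)[of l] that by auto
    moreover have "k = cyc_pred P (m l) \<Longrightarrow> b l = 0" using assms(3)[of l] that by fastforce
    ultimately show ?thesis by (auto simp: relation_matrix_def)
  qed
  have "set_det L (relation_matrix a b m P) = (\<Prod>l\<in>L. relation_matrix a b m P l l)"
    by (rule set_det_triangular[where rank = rank]) (use assms(1) off in auto)
  also have "\<dots> = 1" using off by (intro prod.neutral) auto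
  finally show ?thesis by simp
qed

text \<open>
  A trivial relation merely subdivides a semi-arc; its elimination identifies the two parts.
\<close>

lemma remove_trivial_passage:
  fixes a b :: "real \<Rightarrow> 'r::idom"
  assumes "finite P" "d \<in> P" "P \<noteq> {d}" "a d = 1" "b d = 0" and m: "\<And>i. i \<in> P \<Longrightarrow> b i \<noteq> 0 \<Longrightarrow> m i \<noteq> d"
  shows "set_det P (relation_matrix a b m P)
       = set_det (P - {d}) (relation_matrix a b m (P - {d}))"
proof -
  let ?F = "relation_matrix a b m P" and ?p = "cyc_pred P d"
  have p: "?p \<noteq> d"
    by (rule cyc_pred_neq[OF assms(1-3)])
  have row: "?F d j = (if j = d then 1 else 0) - (if j = ?p then 1 else 0)" for j
    using assms by (auto simp: relation_matrix_def)
  have "set_det ({d} \<union> (P - {d})) ?F = set_det {d} ?F *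
      set_det (P - {d}) (\<lambda>i j. ?F i j + (\<Sum>k\<in>{d}. ?F i k * (if j = ?p then 1 else 0)))"
    by (rule set_det_schur) (use assms(1) p in \<open>auto simp: row\<close>)
  also have "set_det {d} ?F = 1" using p by (simp add: set_det_def list_det_def row det_single)
  also have "set_det (P - {d}) (\<lambda>i j. ?F i j + (\<Sum>k\<in>{d}. ?F i k * (if j = ?p then 1 else 0)))
     = set_det (P - {d}) (relation_matrix a b m (P - {d}))"
  proof (rule set_det_cong)
    fix i j assume ij: "i \<in> P - {d}" "j \<in> P - {d}"
    have "cyc_pred (P - {d}) i = (if cyc_pred P i = d then ?p else cyc_pred P i)"
      "b i \<noteq> 0 \<Longrightarrow> cyc_pred (P - {d}) (m i) = (if cyc_pred P (m i) = d then ?p else cyc_pred P (m i))"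
      using ij m[of i] by (intro cyc_pred_remove assms; auto)+
    then show "?F i j + (\<Sum>k\<in>{d}. ?F i k * (if j = ?p then 1 else 0)) = relation_matrix a b m (P - {d}) i j"
      using ij p by (cases "b i = 0") (auto simp: relation_matrix_def)
  qed
  finally show ?thesis using assms(2) by (simp add: insert_absorb)
qed

lemma relation_matrix_relabel:
  fixes a b a' b' :: "real \<Rightarrow> 'r::idom"
  assumes "finite P" "inj_on g P"
    and "\<And>i. i \<in> P \<Longrightarrow> a' (g i) = a i \<and> b' (g i) = b i"
    and "\<And>i. i \<in> P \<Longrightarrow> b i \<noteq> 0 \<Longrightarrow> m i \<in> P \<and> m' (g i) = g (m i)"
    and pred: "\<And>i. i \<in> P \<Longrightarrow> cyc_pred (g ` P) (g i) = g (cyc_pred P i)"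
  shows "set_det (g ` P) (relation_matrix a' b' m' (g ` P)) = set_det P (relation_matrix a b m P)"
  unfolding set_det_image[OF assms(2,1)]
proof (rule set_det_cong)
  fix i j assume ij: "i \<in> P" "j \<in> P"
  have inj: "g x = g y \<longleftrightarrow> x = y" if "x \<in> P" "y \<in> P" for x y using that assms(2) by (auto dest: inj_onD)
  have inP: "cyc_pred P t \<in> P" for t using ij assms(1) by (intro cyc_pred_in) auto
  have "g i = g j \<longleftrightarrow> i = j" "g j = cyc_pred (g ` P) (g i) \<longleftrightarrow> j = cyc_pred P i"
    using ij inP inj pred by simp_all
  moreover have "g j = cyc_pred (g ` P) (m' (g i)) \<longleftrightarrow> j = cyc_pred P (m i)" if "b i \<noteq> 0"
    using assms(4)[OF ij(1) that] ij inP inj pred by simp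
  ultimately show "relation_matrix a' b' m' (g ` P) (g i) (g j) = relation_matrix a b m P i j"
    using assms(3)[OF ij(1)] by (cases "b i = 0") (simp_all add: relation_matrix_def)
qed

section \<open>Passages of a diagram\<close>

definition crosses :: "vdiagram \<Rightarrow> real \<Rightarrow> bool" where
  "crosses D t \<longleftrightarrow> (\<exists>t'. meets D t t')"

definition partner :: "vdiagram \<Rightarrow> real \<Rightarrow> real \<Rightarrow> real" where
  "partner D c t = (THE t'. t' \<in> {c..<c + 1} \<and> meets D t t')"

definition strand_sign :: "vdiagram \<Rightarrow> real \<Rightarrow> int" where
  "strand_sign D t = (if turn D t (partner D 0 t) > 0 then 1 else - 1)"

text \<open>
  Points of the curve that are not double points get the trivial relation, with coefficients 1 and 0,
  so that they may be added to the set of passages.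
\<close>

definition own :: "vdiagram \<Rightarrow> real \<Rightarrow> laurent" where
  "own D t = (if crosses D t
     then own_coeff (curve D t \<in> virt D) (odd_crossing D (curve D t)) (over D t) (strand_sign D t) else 1)"

definition cross :: "vdiagram \<Rightarrow> real \<Rightarrow> laurent" where
  "cross D t = (if crosses D t
     then cross_coeff (curve D t \<in> virt D) (odd_crossing D (curve D t)) (over D t) (strand_sign D t) else 0)"

definition window :: "vdiagram \<Rightarrow> real \<Rightarrow> real set" where
  "window D c = {t \<in> {c..<c + 1}. crosses D t}"

definition knot_det :: "vdiagram \<Rightarrow> real \<Rightarrow> real set \<Rightarrow> laurent" where
  "knot_det D c P = set_det P (relation_matrix (own D) (cross D) (partner D c) P)"

text \<open>
  Moves the period that begins at 0 to the one that begins at c, by translations by integers.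
\<close>

definition into_window :: "real \<Rightarrow> real \<Rightarrow> real" where
  "into_window c t = (if t + of_int \<lfloor>c\<rfloor> < c then t + of_int \<lfloor>c\<rfloor> + 1 else t + of_int \<lfloor>c\<rfloor>)"

text \<open>
  Up to a unit this is the determinant of the matrix of Fox derivatives with respect to the semi-arcs
  (\<open>arc_matrix_alexander\<close>). The value 0 for a diagram without crossings is also what any nonempty set of
  trivial passages gives (\<open>knot_det_no_crossings\<close>), so that one
  argument covers the moves to and from such a diagram.
\<close>

definition alexander :: "vdiagram \<Rightarrow> laurent" where
  "alexander D = (if crossing_params D = {} then 0 else knot_det D 0 (crossing_params D))"

lemma window_0: "window D 0 = crossing_params D"
  by (auto simp: window_def crossing_params_def crosses_def)

lemma turn_antisym: "turn D t' t = - turn D t t'"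
  by (simp add: turn_def)

lemma meets_sym: "meets D t t' \<Longrightarrow> meets D t' t"
  unfolding meets_def by (metis Ints_minus minus_diff_eq)

lemma meets_curve: "meets D t t' \<Longrightarrow> curve D t' = curve D t"
  by (simp add: meets_def)

lemma meets_crosses: "meets D t t' \<Longrightarrow> crosses D t"
  by (auto simp: crosses_def)

lemma periodic_int:
  fixes f :: "real \<Rightarrow> 'a"
  assumes "\<And>t. f (t + 1) = f t"
  shows "f (t + of_int n) = f t"
proof -
  have nat: "f (t + of_nat k) = f t" for t and k :: nat
  proof (induction k)
    case (Suc k)
    have "f (t + of_nat (Suc k)) = f ((t + of_nat k) + 1)" by (simp add: algebra_simps)
    then show ?case using assms Suc by simp
  qed simp
  show ?thesis
  proof (cases "n \<ge> 0")
    case True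
    then show ?thesis using nat[of t "nat n"] by simp
  next
    case False
    then show ?thesis using nat[of "t + of_int n" "nat (- n)"] by simp
  qed
qed

lemma cyc_pred_rotate:
  assumes "finite P" "P \<subseteq> {0..<1}" "i \<in> P"
  shows "cyc_pred (into_window c ` P) (into_window c i) = into_window c (cyc_pred P i)"
proof -
  define g where "g = into_window c"
  note g_eq = this
  define n where "n = (of_int \<lfloor>c\<rfloor> :: real)"
  have g_def: "g t = (if t + n < c then t + n + 1 else t + n)" for t
    by (simp add: g_def into_window_def n_def)
  have P: "P \<noteq> {}" "cyc_pred P i \<in> P" using assms(1,3) cyc_pred_in by auto
  have b: "0 \<le> x \<and> x < 1" if "x \<in> P" for x using assms(2) that by auto
  have gP: "finite (g ` P)" "g (cyc_pred P i) \<in> g ` P" using assms(1) P by auto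
  let ?p = "cyc_pred P i"
  have "cyc_pred (g ` P) (g i) = g ?p"
  proof (cases rule: cyc_pred_cases[OF assms(1) P(1), of i])
    case 1
    show ?thesis
    proof (cases "?p + n < c \<longleftrightarrow> i + n < c")
      case True
      show ?thesis
      proof (rule cyc_pred_below[OF gP])
        show "g ?p < g i" using 1(1) True by (auto simp: g_def)
        fix y assume "y \<in> g ` P" "y < g i"
        then obtain x where x: "x \<in> P" "y = g x" by auto
        show "y \<le> g ?p" using x \<open>y < g i\<close> 1(1) 1(2)[OF x(1)] True b[OF x(1)] b[OF P(2)] b[OF assms(3)]
          by (cases "x < i") (auto simp: g_def split: if_splits)
      qed
    next
      case False
      then have F: "?p + n < c" "\<not> i + n < c" using 1(1) by auto
      show ?thesis
      proof (rule cyc_pred_wrap[OF gP])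
        fix y assume "y \<in> g ` P"
        then obtain x where x: "x \<in> P" "y = g x" by auto
        show "g i \<le> y" using x F 1(1) 1(2)[OF x(1)] b[OF x(1)] b[OF P(2)] b[OF assms(3)]
          by (cases "x < i") (auto simp: g_def split: if_splits)
        show "y \<le> g ?p" using x F 1(1) 1(2)[OF x(1)] b[OF x(1)] b[OF P(2)] b[OF assms(3)]
          by (cases "x < i") (auto simp: g_def split: if_splits)
      qed
    qed
  next
    case 2
    show ?thesis
    proof (cases "?p + n < c \<longleftrightarrow> i + n < c")
      case True
      show ?thesis
      proof (rule cyc_pred_wrap[OF gP])
        fix y assume "y \<in> g ` P"
        then obtain x where x: "x \<in> P" "y = g x" by auto
        show "g i \<le> y" "y \<le> g ?p" using x True 2(1)[OF x(1)] 2(2)[OF x(1)] 2(1)[OF P(2)]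
          by (auto simp: g_def split: if_splits)
      qed
    next
      case False
      then have F: "\<not> ?p + n < c" "i + n < c" using 2(1)[OF P(2)] by auto
      show ?thesis
      proof (rule cyc_pred_below[OF gP])
        show "g ?p < g i" using F b[OF P(2)] b[OF assms(3)] by (auto simp: g_def)
        fix y assume "y \<in> g ` P" "y < g i"
        then obtain x where x: "x \<in> P" "y = g x" by auto
        show "y \<le> g ?p" using x \<open>y < g i\<close> F 2(1)[OF x(1)] 2(2)[OF x(1)]
          by (auto simp: g_def split: if_splits)
      qed
    qed
  qed
  then show ?thesis by (simp add: g_eq)
qed

context
  fixes D :: vdiagram
  assumes vk: "vknot_diagram D"
begin

lemma curve_int [simp]: "curve D (t + of_int n) = curve D t"
  using vk by (intro periodic_int) (simp add: vknot_diagram_def)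

lemma over_int [simp]: "over D (t + of_int n) = over D t"
  using vk by (intro periodic_int) (simp add: vknot_diagram_def)

lemma curve_has_velocity: "(curve D has_vector_derivative velocity D t) (at t)"
proof -
  have "curve D differentiable at t"
    using vk by (auto simp: vknot_diagram_def C1_differentiable_on_eq)
  then show ?thesis by (simp add: velocity_def vector_derivative_works)
qed

lemma velocity_int [simp]: "velocity D (t + of_int n) = velocity D t"
proof -
  have "((\<lambda>x. x + of_int n) has_vector_derivative 1) (at t)"
    by (auto intro!: derivative_eq_intros)
  from vector_diff_chain_at[OF this curve_has_velocity]
  have "(curve D has_vector_derivative velocity D (t + of_int n)) (at t)"
    by (simp add: o_def)
  then show ?thesis using curve_has_velocity vector_derivative_unique_at by blast
qed

lemma turn_int [simp]:
  "turn D (t + of_int n) t' = turn D t t'" "turn D t (t' + of_int n) = turn D t t'"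
  by (simp_all add: turn_def)

lemma meets_int [simp]:
  "meets D (t + of_int n) t' \<longleftrightarrow> meets D t t'" "meets D t (t' + of_int n) \<longleftrightarrow> meets D t t'"
proof -
  have shift: "x + of_int k \<in> \<int> \<longleftrightarrow> x \<in> \<int>" for x :: real and k :: int
    using Ints_add[of x "of_int k"] Ints_diff[of "x + of_int k" "of_int k"] by auto
  have "t + of_int n - t' \<in> \<int> \<longleftrightarrow> t - t' \<in> \<int>" "t - (t' + of_int n) \<in> \<int> \<longleftrightarrow> t - t' \<in> \<int>"
    using shift[of "t - t'" n] shift[of "t - t'" "- n"] by (simp_all add: algebra_simps)
  then show "meets D (t + of_int n) t' \<longleftrightarrow> meets D t t'" "meets D t (t' + of_int n) \<longleftrightarrow> meets D t t'"
    by (simp_all add: meets_def)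
qed

lemma meets_unique: "meets D t t' \<Longrightarrow> meets D t t'' \<Longrightarrow> t' - t'' \<in> \<int>"
  using vk unfolding vknot_diagram_def by blast

lemma meets_turn: "meets D t t' \<Longrightarrow> turn D t t' \<noteq> 0"
  using vk unfolding vknot_diagram_def by blast

lemma meets_over: "meets D t t' \<Longrightarrow> curve D t \<notin> virt D \<Longrightarrow> over D t' = (\<not> over D t)"
  using vk unfolding vknot_diagram_def by blast

lemma crosses_int [simp]: "crosses D (t + of_int n) \<longleftrightarrow> crosses D t"
  by (simp add: crosses_def)

lemma partner_eq:
  assumes "meets D t t'" "t' \<in> {c..<c + 1}"
  shows "partner D c t = t'"
  unfolding partner_def
proof (rule the_equality)
  fix u assume u: "u \<in> {c..<c + 1} \<and> meets D t u"
  then have "u - t' \<in> \<int>" using meets_unique assms(1) by blast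
  then obtain n :: int where n: "u - t' = of_int n" by (auto elim: Ints_cases)
  have "\<bar>u - t'\<bar> < 1" using u assms(2) by auto
  then have "n = 0" using n by linarith
  then show "u = t'" using n by simp
qed (use assms in auto)

lemma partner:
  assumes "crosses D t"
  shows "partner D c t \<in> {c..<c + 1}" "meets D t (partner D c t)"
proof -
  obtain t' where t': "meets D t t'" using assms by (auto simp: crosses_def)
  define u where "u = t' + of_int \<lceil>c - t'\<rceil>"
  have "u \<in> {c..<c + 1}" "meets D t u"
    using t' unfolding u_def by (auto simp: algebra_simps) linarith+
  then show "partner D c t \<in> {c..<c + 1}" "meets D t (partner D c t)" using partner_eq by auto
qed

lemma strand_sign_eq:
  assumes "meets D t t'"
  shows "strand_sign D t = (if turn D t t' > 0 then 1 else - 1)"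
proof -
  have "meets D t (partner D 0 t)" using partner(2) meets_crosses assms by blast
  then have "partner D 0 t - t' \<in> \<int>" using meets_unique assms by blast
  then obtain n :: int where n: "partner D 0 t = t' + of_int n" by (auto elim!: Ints_cases simp: algebra_simps)
  have "turn D t (partner D 0 t) = turn D t t'" unfolding n by simp
  then show ?thesis by (simp add: strand_sign_def)
qed

lemma strand_sign_partner: "meets D t t' \<Longrightarrow> strand_sign D t' = - strand_sign D t"
  using strand_sign_eq[of t t'] strand_sign_eq[of t' t] meets_sym[of D t t'] meets_turn[of t t'] turn_antisym[of D t' t]
  by auto

lemma partner_int [simp]: "partner D c (t + of_int n) = partner D c t"
  by (simp add: partner_def)

lemma strand_sign_int [simp]: "strand_sign D (t + of_int n) = strand_sign D t"
  by (simp add: strand_sign_def)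

lemma own_int [simp]: "own D (t + of_int n) = own D t"
  by (simp add: own_def)

lemma cross_int [simp]: "cross D (t + of_int n) = cross D t"
  by (simp add: cross_def)

lemma finite_crossing_params: "finite (crossing_params D)"
  using vk by (simp add: vknot_diagram_def)

lemma finite_crosses: "finite {t. crosses D t \<and> x \<le> t \<and> t < y}"
proof -
  have "{t. crosses D t \<and> x \<le> t \<and> t < y}
      \<subseteq> (\<Union>n\<in>{\<lfloor>x\<rfloor>..\<lfloor>y\<rfloor>}. (\<lambda>t. t + of_int n) ` crossing_params D)"
  proof
    fix t assume "t \<in> {t. crosses D t \<and> x \<le> t \<and> t < y}"
    then have t: "crosses D t" "x \<le> t" "t < y" by auto
    have "crosses D (t + of_int (- \<lfloor>t\<rfloor>))" using t(1) by (simp only: crosses_int)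
    then have "crosses D (t - of_int \<lfloor>t\<rfloor>)" by simp
    moreover have "0 \<le> t - of_int \<lfloor>t\<rfloor>" "t - of_int \<lfloor>t\<rfloor> < 1" by linarith+
    ultimately have "t - of_int \<lfloor>t\<rfloor> \<in> crossing_params D"
      unfolding window_0[symmetric] window_def by simp
    moreover have "\<lfloor>t\<rfloor> \<in> {\<lfloor>x\<rfloor>..\<lfloor>y\<rfloor>}" using t by (auto intro: floor_mono)
    ultimately show "t \<in> (\<Union>n\<in>{\<lfloor>x\<rfloor>..\<lfloor>y\<rfloor>}. (\<lambda>t. t + of_int n) ` crossing_params D)"
      by (intro UN_I[of "\<lfloor>t\<rfloor>"] image_eqI[of _ _ "t - of_int \<lfloor>t\<rfloor>"]) auto
  qed
  then show ?thesis by (rule finite_subset) (use finite_crossing_params in auto)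
qed

lemma finite_window: "finite (window D c)"
  using finite_crosses[of c "c + 1"] by (rule rev_finite_subset) (auto simp: window_def)

lemma partner_window: "t \<in> window D c \<Longrightarrow> partner D c t \<in> window D c"
  using partner[of t c] meets_crosses[OF meets_sym[OF partner(2)]] by (simp add: window_def)

lemma knot_det_extra:
  assumes "finite P" "window D c \<subseteq> R" "R \<subseteq> P" "R \<noteq> {}" "P \<subseteq> {c..<c + 1}"
  shows "knot_det D c P = knot_det D c R"
proof -
  have fR: "finite R" using assms finite_subset by blast
  have "knot_det D c (R \<union> E) = knot_det D c R" if "finite E" "E \<subseteq> P - R" for E
    using that
  proof (induction E)
    case (insert d E)
    have d: "d \<in> {c..<c + 1}" "d \<notin> window D c" "d \<notin> R \<union> E" using insert assms by auto
    then have nc: "\<not> crosses D d" by (auto simp: window_def)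
    have "knot_det D c (insert d (R \<union> E)) = knot_det D c (insert d (R \<union> E) - {d})"
      unfolding knot_det_def
    proof (rule remove_trivial_passage)
      show "own D d = 1" "cross D d = 0" using nc by (simp_all add: own_def cross_def)
      show "insert d (R \<union> E) \<noteq> {d}" using assms(4) d(3) by blast
      show "partner D c i \<noteq> d" if "cross D i \<noteq> 0" for i
      proof -
        have "crosses D i" using that by (auto simp: cross_def split: if_splits)
        then have "crosses D (partner D c i)" using partner(2) meets_sym meets_crosses by blast
        then show ?thesis using nc by auto
      qed
    qed (use insert fR in auto)
    also have "insert d (R \<union> E) - {d} = R \<union> E" using d(3) by auto
    finally show ?case using insert by simp
  qed simp
  from this[of "P - R"] show ?thesis using assms by (simp add: Un_absorb1)
qed

lemma knot_det_no_crossings: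
  assumes "finite P" "window D c = {}" "P \<noteq> {}" "P \<subseteq> {c..<c + 1}"
  shows "knot_det D c P = 0"
proof -
  obtain d where d: "d \<in> P" using assms(3) by blast
  have "knot_det D c P = knot_det D c {d}" using assms d by (intro knot_det_extra) auto
  also have "\<dots> = 0"
  proof -
    have "\<not> crosses D d" using d assms by (auto simp: window_def)
    moreover have "cyc_pred {d} t = d" for t using cyc_pred_in[of "{d}" t] by simp
    ultimately show ?thesis
      by (simp add: knot_det_def set_det_def list_det_def relation_matrix_def own_def cross_def det_single)
  qed
  finally show ?thesis .
qed

lemma window_shift:
  shows "into_window c ` crossing_params D = window D c" "inj_on (into_window c) {0..<1}"
    "\<And>t. \<exists>k::int. into_window c t = t + of_int k" "\<And>t. t \<in> {0..<1} \<Longrightarrow> into_window c t \<in> {c..<c + 1}"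
proof -
  let ?g = "into_window c"
  define n where "n = (of_int \<lfloor>c\<rfloor> :: real)"
  have g_def: "?g t = (if t + n < c then t + n + 1 else t + n)" for t
    by (simp add: into_window_def n_def)
  have n: "n \<le> c" "c < n + 1" unfolding n_def by linarith+
  show int: "\<exists>k::int. ?g t = t + of_int k" for t
    by (cases "t + n < c") (auto simp: g_def n_def intro: exI[of _ "\<lfloor>c\<rfloor> + 1"] exI[of _ "\<lfloor>c\<rfloor>"])
  show "inj_on ?g {0..<1}" by (auto simp: inj_on_def g_def split: if_splits)
  show rng: "?g t \<in> {c..<c + 1}" if "t \<in> {0..<1}" for t using that n by (auto simp: g_def)
  have "crosses D (?g t) \<longleftrightarrow> crosses D t" for t using int[of t] by auto
  then show "?g ` crossing_params D = window D c"
  proof (intro equalityI subsetI)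
    assume cr: "\<And>t. crosses D (?g t) = crosses D t"
    show "x \<in> window D c" if "x \<in> ?g ` crossing_params D" for x
      using that rng cr unfolding window_0[symmetric] by (auto simp: window_def)
    show "x \<in> ?g ` crossing_params D" if "x \<in> window D c" for x
    proof (rule image_eqI)
      let ?t = "if x < n + 1 then x - n else x - n - 1"
      have x: "c \<le> x" "x < c + 1" "crosses D x" using that by (auto simp: window_def)
      show e: "x = ?g ?t" using x n by (auto simp: g_def)
      have "crosses D ?t" using cr[of ?t] e x by simp
      then show "?t \<in> crossing_params D" using x n unfolding window_0[symmetric] by (auto simp: window_def)
    qed
  qed
qed

lemma knot_det_window: "knot_det D c (window D c) = knot_det D 0 (crossing_params D)"
proof -
  define g where "g = into_window c"
  note g = window_shift[where c = c, folded g_def]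
  have sub: "crossing_params D \<subseteq> {0..<1}" by (auto simp: crossing_params_def)
  show ?thesis
    unfolding knot_det_def g(1)[symmetric]
  proof (rule relation_matrix_relabel)
    show "inj_on g (crossing_params D)" using g(2) sub inj_on_subset by blast
    show "own D (g i) = own D i \<and> cross D (g i) = cross D i" for i using g(3)[of i] by auto
    fix i assume i: "i \<in> crossing_params D"
    show "cyc_pred (g ` crossing_params D) (g i) = g (cyc_pred (crossing_params D) i)"
      unfolding g_def by (rule cyc_pred_rotate) (use finite_crossing_params sub i in auto)
    have inw: "partner D 0 i \<in> crossing_params D" using partner_window i window_0 by metis
    have "meets D i (partner D 0 i)" using i partner(2) window_0[of D] by (auto simp: window_def)
    then have "meets D (g i) (g (partner D 0 i))" using g(3)[of i] g(3)[of "partner D 0 i"] by auto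
    then have "partner D c (g i) = g (partner D 0 i)" using partner_eq g(4) inw sub by blast
    then show "partner D 0 i \<in> crossing_params D \<and> partner D c (g i) = g (partner D 0 i)" using inw by simp
  qed (rule finite_crossing_params)
qed

text \<open>
  This is the freedom that the moves use: the period may begin anywhere, and passages may be added.
\<close>

lemma knot_det_eq_alexander:
  assumes "finite P" "window D c \<subseteq> P" "P \<noteq> {}" "P \<subseteq> {c..<c + 1}"
  shows "knot_det D c P = alexander D"
proof (cases "window D c = {}")
  case True
  then have "crossing_params D = {}" using window_shift(1)[where c = c] by auto
  then show ?thesis using knot_det_no_crossings[OF assms(1) True assms(3,4)] by (simp add: alexander_def)
next
  case False
  then have "crossing_params D \<noteq> {}" using window_shift(1)[where c = c] by auto
  then show ?thesis
    using knot_det_extra[OF assms(1) order_refl assms(2) False assms(4)] knot_det_window by (simp add: alexander_def)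
qed

end

section \<open>Width bounds for a single diagram\<close>

lemma exps_within_signof [simp]: "l \<le> 0 \<Longrightarrow> 0 \<le> h \<Longrightarrow> exps_within x l h (signof p)"
  by (auto simp: sign_def exps_within_uminus)

text \<open>
  Each term of the Leibniz expansion has exactly one factor from each row.
\<close>

lemma exps_within_set_det:
  fixes P :: "real set"
  assumes "finite P" "\<And>i j. i \<in> P \<Longrightarrow> j \<in> P \<Longrightarrow> exps_within x (l i) (h i) (F i j)"
  shows "exps_within x (\<Sum>i\<in>P. l i) (\<Sum>i\<in>P. h i) (set_det P F)"
proof -
  let ?xs = "sorted_list_of_set P" let ?n = "length ?xs"
  have xs: "set ?xs = P" "distinct ?xs" using assms(1) by simp_all
  have sums: "(\<Sum>i\<in>P. f i) = (\<Sum>i = 0..<?n. f (?xs ! i))" for f :: "real \<Rightarrow> int"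
    using sum.reindex_bij_betw[OF bij_betw_nth[OF xs(2) refl xs(1)[symmetric]], of f]
    by (simp add: atLeast0LessThan)
  show ?thesis
    unfolding set_det_def list_det_def sums
  proof (subst det_def'[of _ ?n], simp, rule exps_within_sum)
    fix p assume "p \<in> {p. p permutes {0..<?n}}"
    then have p: "i < ?n \<Longrightarrow> p i < ?n" for i using permutes_in_image[of p "{0..<?n}" i] by auto
    let ?A = "mat ?n ?n (\<lambda>(i, j). F (?xs ! i) (?xs ! j))"
    have "exps_within x (\<Sum>i = 0..<?n. l (?xs ! i)) (\<Sum>i = 0..<?n. h (?xs ! i)) (\<Prod>i = 0..<?n. ?A $$ (i, p i))"
    proof (rule exps_within_prod)
      fix i assume "i \<in> {0..<?n}"
      then have "i < ?n" by simp
      moreover from this have "?xs ! i \<in> P" "?xs ! p i \<in> P" using p nth_mem[of _ ?xs] xs(1) by metis+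
      ultimately show "exps_within x (l (?xs ! i)) (h (?xs ! i)) (?A $$ (i, p i))"
        using assms(2) p by simp
    qed
    from exps_within_mult[OF exps_within_signof[of 0 0 x p] this]
    show "exps_within x (\<Sum>i = 0..<?n. l (?xs ! i)) (\<Sum>i = 0..<?n. h (?xs ! i))
       (signof p * (\<Prod>i = 0..<?n. ?A $$ (i, p i)))" by simp
  qed
qed

lemma card_eq_twice_card_image:
  assumes "finite A" "\<And>y. y \<in> f ` A \<Longrightarrow> card {x \<in> A. f x = y} = 2"
  shows "card A = 2 * card (f ` A)"
proof -
  have "card A = (\<Sum>y\<in>f ` A. \<Sum>x\<in>{x \<in> A. f x = y}. 1)"
    using sum.image_gen[OF assms(1), of "\<lambda>_. 1::nat" f] by simp
  also have "\<dots> = (\<Sum>y\<in>f ` A. 2)" using assms(2) by (intro sum.cong) auto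
  finally show ?thesis by simp
qed

definition classical :: "vdiagram \<Rightarrow> real \<Rightarrow> bool" where
  "classical D t \<longleftrightarrow> crosses D t \<and> curve D t \<notin> virt D"

definition classical_count :: "vdiagram \<Rightarrow> real \<Rightarrow> real \<Rightarrow> nat" where
  "classical_count D c x = card {u. classical D u \<and> c \<le> u \<and> u < x}"

lemma classical_params_eq: "classical_params D = {u. classical D u \<and> 0 \<le> u \<and> u < 1}"
  by (auto simp: classical_params_def classical_def crossing_params_def crosses_def)

context
  fixes D :: vdiagram
  assumes vk: "vknot_diagram D"
begin

lemmas [simp] = curve_int[OF vk] over_int[OF vk] meets_int[OF vk] crosses_int[OF vk]

lemma passages_facts:
  "set (passages D) = crossing_params D" "distinct (passages D)" "sorted (passages D)"
  using finite_crossing_params[OF vk] by (simp_all add: passages_def)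

lemma same_window_meets:
  "t \<in> {c..<c + 1} \<Longrightarrow> t' \<in> {c..<c + 1} \<Longrightarrow> t \<noteq> t' \<Longrightarrow> curve D t = curve D t' \<Longrightarrow> meets D t t'"
  unfolding meets_def
proof
  assume t: "t \<in> {c..<c + 1}" "t' \<in> {c..<c + 1}" "t \<noteq> t'"
  show "t - t' \<notin> \<int>"
  proof
    assume "t - t' \<in> \<int>"
    then obtain n :: int where n: "t - t' = of_int n" by (auto elim: Ints_cases)
    have "\<bar>t - t'\<bar> < 1" using t by auto
    then have "n = 0" using n by linarith
    then show False using n t by simp
  qed
qed

lemma mate_facts:
  assumes "i < length (passages D)"
  shows "mate D i < length (passages D)" "passages D ! mate D i = partner D 0 (passages D ! i)"
proof -
  let ?xs = "passages D"
  have in_w: "?xs ! j \<in> window D 0" if "j < length ?xs" for j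
    using passages_facts(1) nth_mem[OF that] window_0[of D] by simp
  have cr: "crosses D (?xs ! i)" using in_w[OF assms] by (simp add: window_def)
  note pr = partner[OF vk cr, of 0]
  obtain k where k: "k < length ?xs" "?xs ! k = partner D 0 (?xs ! i)"
    using partner_window[OF vk in_w[OF assms]] passages_facts(1) window_0[of D] by (metis in_set_conv_nth)
  have "mate D i = k"
    unfolding mate_def
  proof (rule the_equality)
    have "?xs ! k \<noteq> ?xs ! i" using pr(2) by (auto simp: k meets_def)
    then show "k < length ?xs \<and> k \<noteq> i \<and> curve D (?xs ! k) = curve D (?xs ! i)"
      using k pr(2) by (auto simp: meets_def)
    fix j assume j: "j < length ?xs \<and> j \<noteq> i \<and> curve D (?xs ! j) = curve D (?xs ! i)"
    have "meets D (?xs ! i) (?xs ! j)"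
      using j in_w[of j] in_w[OF assms] passages_facts(2) assms
      by (intro same_window_meets[of _ 0]) (auto simp: window_def nth_eq_iff_index_eq)
    then have "partner D 0 (?xs ! i) = ?xs ! j"
      using in_w[of j] j by (intro partner_eq[OF vk]) (auto simp: window_def)
    then show "j = k" using k j passages_facts(2) by (simp add: nth_eq_iff_index_eq)
  qed
  then show "mate D i < length ?xs" "?xs ! mate D i = partner D 0 (?xs ! i)" using k by simp_all
qed

lemma cyc_pred_passages:
  assumes "i < length (passages D)"
  shows "cyc_pred (crossing_params D) (passages D ! i)
    = passages D ! (if i = 0 then length (passages D) - 1 else i - 1)"
proof -
  let ?xs = "passages D" and ?P = "crossing_params D"
  have strict: "?xs ! j < ?xs ! k" if "j < k" "k < length ?xs" for j k
    using sorted_nth_mono[OF passages_facts(3), of j k] that passages_facts(2)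
    by (metis leD le_less less_imp_le nth_eq_iff_index_eq order.strict_trans)
  have P: "finite ?P" "?P = set ?xs" using finite_crossing_params[OF vk] passages_facts(1) by simp_all
  have mono: "j \<le> k \<Longrightarrow> k < length ?xs \<Longrightarrow> ?xs ! j \<le> ?xs ! k" for j k
    using sorted_nth_mono[OF passages_facts(3)] by blast
  show ?thesis
  proof (cases "i = 0")
    case True
    have "cyc_pred ?P (?xs ! i) = ?xs ! (length ?xs - 1)"
    proof (rule cyc_pred_wrap[OF P(1)])
      show "?xs ! (length ?xs - 1) \<in> ?P" using assms P(2) by auto
      fix x assume "x \<in> ?P"
      then obtain k where k: "k < length ?xs" "x = ?xs ! k" using P(2) by (auto simp: in_set_conv_nth)
      show "?xs ! i \<le> x" "x \<le> ?xs ! (length ?xs - 1)" using k True by (auto intro!: mono)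
    qed
    then show ?thesis using True by simp
  next
    case False
    have "cyc_pred ?P (?xs ! i) = ?xs ! (i - 1)"
    proof (rule cyc_pred_below[OF P(1)])
      show "?xs ! (i - 1) \<in> ?P" "?xs ! (i - 1) < ?xs ! i" using assms P(2) False strict by auto
      fix x assume x: "x \<in> ?P" "x < ?xs ! i"
      then obtain k where k: "k < length ?xs" "x = ?xs ! k" using P(2) by (auto simp: in_set_conv_nth)
      then have "k < i" using x(2) mono[of i k] by (meson leD leI)
      then show "x \<le> ?xs ! (i - 1)" using k assms by (auto intro!: mono)
    qed
    then show ?thesis using False by simp
  qed
qed

text \<open>
  The semi-arc that begins at a passage is the one that ends at the next passage. So the two matrices
  differ by a cyclic permutation of the columns and by the sign of all entries.
\<close>

lemma arc_matrix_alexander: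
  assumes ne: "crossing_params D \<noteq> {}"
  shows "det (arc_matrix D) dvd alexander D" "alexander D dvd det (arc_matrix D)"
proof -
  let ?xs = "passages D" and ?P = "crossing_params D"
  define N where "N = length ?xs"
  define A where "A = arc_matrix D"
  define F where "F = relation_matrix (own D) (cross D) (partner D 0) ?P"
  have N: "N > 0" using ne passages_facts(1) by (auto simp: N_def)
  have A: "A \<in> carrier_mat N N" by (simp add: A_def arc_matrix_def N_def)
  define p where "p j = (if j < N then Suc j mod N else j)" for j
  have p: "p permutes {0..<N}"
  proof (rule bij_imp_permutes)
    have "inj_on p {0..<N}" using N by (auto simp: inj_on_def p_def mod_Suc split: if_splits)
    moreover have "p ` {0..<N} \<subseteq> {0..<N}" using N by (auto simp: p_def)
    ultimately show "bij_betw p {0..<N} {0..<N}"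
      by (simp add: bij_betw_def endo_inj_surj)
  qed (simp add: p_def)
  have idx: "?xs ! j = cyc_pred ?P (?xs ! i) \<longleftrightarrow> p j = i" if "i < N" "j < N" for i j
    using that N passages_facts(2) cyc_pred_passages[of i]
    by (auto simp: N_def[symmetric] p_def mod_Suc nth_eq_iff_index_eq)
  have entry: "A $$ (i, p j) = - F (?xs ! i) (?xs ! j)" if ij: "i < N" "j < N" for i j
  proof -
    note m = mate_facts[of i, folded N_def, OF ij(1)]
    have inw: "?xs ! i \<in> window D 0" using ij nth_mem[of i ?xs] passages_facts(1) window_0[of D] by (simp add: N_def)
    then have cr: "crosses D (?xs ! i)" by (simp add: window_def)
    have "passage_sign D i = strand_sign D (?xs ! i)"
      using strand_sign_eq[OF vk partner(2)[OF vk cr, of 0]] m(2)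
      by (simp add: passage_sign_def left_to_right_def)
    moreover have "p j < N" using permutes_in_image[OF p, of j] ij by simp
    moreover have "p j = Suc i mod N \<longleftrightarrow> i = j" 
      using inj_eq[OF permutes_inj[OF p], of j i] ij(1) by (auto simp: p_def[of i])
    moreover have "?xs ! i = ?xs ! j \<longleftrightarrow> i = j"
      using ij passages_facts(2) by (simp add: N_def nth_eq_iff_index_eq)
    moreover have "?xs ! j = cyc_pred ?P (?xs ! i) \<longleftrightarrow> p j = i"
      "?xs ! j = cyc_pred ?P (partner D 0 (?xs ! i)) \<longleftrightarrow> p j = mate D i"
      using idx[OF ij] idx[OF m(1) ij(2)] m(2) by simp_all
    moreover have "A $$ (i, p j) = fox_eval (Arc (p j)) (crossing_relator D i)"
      using ij \<open>p j < N\<close> by (simp add: A_def arc_matrix_def N_def)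
    ultimately show ?thesis
      using cr by (auto simp: fox_crossing_relator Let_def F_def relation_matrix_def own_def cross_def N_def[symmetric])
  qed
  have "alexander D = list_det ?xs F"
    using ne by (simp add: alexander_def knot_det_def F_def set_det_def passages_def)
  also have "mat N N (\<lambda>(i, j). F (?xs ! i) (?xs ! j)) = (- 1) \<cdot>\<^sub>m (mat N N (\<lambda>(i, j). A\<^sup>T $$ (p i, j)))\<^sup>T"
    by (rule eq_matI) (use A p permutes_in_image[OF p] entry in auto)
  then have "list_det ?xs F = (- 1) ^ N * det (mat N N (\<lambda>(i, j). A\<^sup>T $$ (p i, j)))"
    by (simp add: list_det_def N_def[symmetric] det_transpose[of _ N])
  also have "\<dots> = (- 1) ^ N * (signof p * det A)"
    using A p by (subst det_permute_rows[of _ N]) (auto simp: det_transpose)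
  finally have eq: "alexander D = ((- 1) ^ N * signof p) * det A" by (simp add: mult_ac)
  have "((- 1) ^ N * signof p) * ((- 1) ^ N * signof p) = (1 :: laurent)"
    by (simp add: sign_def power_mult_distrib[symmetric] mult_ac flip: power_add)
  then have "det A = ((- 1) ^ N * signof p) * alexander D" by (simp add: eq mult.assoc[symmetric])
  then show "det (arc_matrix D) dvd alexander D" "alexander D dvd det (arc_matrix D)"
    using eq unfolding A_def by (metis dvd_triv_right)+
qed

lemma diagram_pva_width_le_alexander:
  assumes "diagram_pva D f" "x = Var_q \<or> x = Var_theta"
  shows "width x f \<le> width x (alexander D)"
proof (cases "crossing_params D = {}")
  case True
  then show ?thesis using assms by (simp add: diagram_pva_def alexander_def)
next
  case False
  have "width x f \<le> width x (det (arc_matrix D))"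
    by (rule diagram_pva_width_le) (use mate_facts assms False in auto)
  also have "\<dots> = width x (alexander D)"
    by (rule width_cong_dvd) (use arc_matrix_alexander False in auto)
  finally show ?thesis .
qed

text \<open>
  Every double point has exactly two parameters in a period.
\<close>

lemma card_partner_closed:
  assumes "X \<subseteq> window D c" "\<And>t. t \<in> X \<Longrightarrow> partner D c t \<in> X"
  shows "card X = 2 * card (curve D ` X)"
proof (rule card_eq_twice_card_image)
  show "finite X" using assms(1) finite_window[OF vk] finite_subset by blast
  fix y assume "y \<in> curve D ` X"
  then obtain t where t: "t \<in> X" "y = curve D t" by blast
  then have w: "t \<in> {c..<c + 1}" "crosses D t" using assms(1) by (auto simp: window_def)
  note p = partner[OF vk w(2), of c]
  have "{x \<in> X. curve D x = y} = {t, partner D c t}"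
  proof
    show "{t, partner D c t} \<subseteq> {x \<in> X. curve D x = y}"
      using t assms(2) p(2) by (auto simp: meets_def)
    show "{x \<in> X. curve D x = y} \<subseteq> {t, partner D c t}"
    proof
      fix u assume u: "u \<in> {x \<in> X. curve D x = y}"
      then have "u \<in> {c..<c + 1}" using assms(1) by (auto simp: window_def)
      then have "u = t \<or> meets D t u" using same_window_meets[of t c u] w u t by auto
      then show "u \<in> {t, partner D c t}" using partner_eq[OF vk] \<open>u \<in> {c..<c + 1}\<close> by blast
    qed
  qed
  moreover have "t \<noteq> partner D c t" using p(2) by (auto simp: meets_def)
  ultimately show "card {x \<in> X. curve D x = y} = 2" by simp
qed

lemma virtual_passages: "card {t \<in> crossing_params D. curve D t \<in> virt D} = 2 * num_virtual D"
proof -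
  have eq: "curve D (partner D 0 t) = curve D t" if "t \<in> window D 0" for t
    using that partner(2)[OF vk, of t 0] by (simp add: window_def meets_def)
  have "card {t \<in> window D 0. curve D t \<in> virt D} = 2 * card (curve D ` {t \<in> window D 0. curve D t \<in> virt D})"
    by (rule card_partner_closed[of _ 0]) (use partner_window[OF vk] eq in auto)
  also have "curve D ` {t \<in> window D 0. curve D t \<in> virt D} = crossings D \<inter> virt D"
    by (auto simp: crossings_def window_0)
  finally show ?thesis by (simp add: num_virtual_def window_0)
qed

lemma odd_passages: "card {t \<in> crossing_params D. odd_crossing D (curve D t)} = 2 * num_odd D"
proof -
  have eq: "curve D (partner D 0 t) = curve D t" if "t \<in> window D 0" for t
    using that partner(2)[OF vk, of t 0] by (simp add: window_def meets_def)
  have "card {t \<in> window D 0. odd_crossing D (curve D t)}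
      = 2 * card (curve D ` {t \<in> window D 0. odd_crossing D (curve D t)})"
    by (rule card_partner_closed[of _ 0]) (use partner_window[OF vk] eq in auto)
  also have "curve D ` {t \<in> window D 0. odd_crossing D (curve D t)} = {p \<in> crossings D. odd_crossing D p}"
    by (auto simp: crossings_def window_0)
  finally show ?thesis by (simp add: num_odd_def window_0)
qed

text \<open>
  Only the rows of passages in X contain x, and there all its exponents lie in one of the intervals
  from 0 to 1 or from -1 to 0.
\<close>

lemma width_alexander_le_card:
  assumes "\<And>t. t \<in> crossing_params D - X \<Longrightarrow> exps_within x 0 0 (own D t) \<and> exps_within x 0 0 (cross D t)"
    and "\<And>t. t \<in> X \<Longrightarrow> cross D t = 0 \<and> (exps_within x 0 1 (own D t) \<or> exps_within x (- 1) 0 (own D t))"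
    and "X \<subseteq> crossing_params D"
  shows "width x (alexander D) \<le> int (card X)"
proof (cases "crossing_params D = {}")
  case True
  then show ?thesis by (simp add: alexander_def width_def)
next
  case False
  let ?P = "crossing_params D"
  define h where "h t = (if t \<in> X \<and> exps_within x 0 1 (own D t) then 1 else 0 :: int)" for t
  define l where "l t = h t - (if t \<in> X then 1 else 0 :: int)" for t
  have fin: "finite ?P" by (rule finite_crossing_params[OF vk])
  have "exps_within x (\<Sum>i\<in>?P. l i) (\<Sum>i\<in>?P. h i)
      (set_det ?P (relation_matrix (own D) (cross D) (partner D 0) ?P))"
  proof (rule exps_within_set_det[OF fin])
    fix i j assume i: "i \<in> ?P" "j \<in> ?P"
    have "l i \<le> 0" "0 \<le> h i" by (auto simp: l_def h_def)
    moreover have "exps_within x (l i) (h i) (own D i)" "exps_within x (l i) (h i) (cross D i)"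
      using assms(1)[of i] assms(2)[of i] i by (cases "i \<in> X"; auto simp: l_def h_def)+
    ultimately show "exps_within x (l i) (h i) (relation_matrix (own D) (cross D) (partner D 0) ?P i j)"
      unfolding relation_matrix_def by (intro exps_within_diff) auto
  qed
  moreover have "(\<Sum>i\<in>?P. l i) \<le> (\<Sum>i\<in>?P. h i)"
    by (rule sum_mono) (simp add: l_def)
  ultimately have "width x (alexander D) \<le> (\<Sum>i\<in>?P. h i) - (\<Sum>i\<in>?P. l i)"
    using False by (simp add: alexander_def knot_det_def width_le)
  also have "\<dots> = (\<Sum>i\<in>?P. if i \<in> X then 1 else 0)"
    by (simp add: sum_subtractf[symmetric] l_def)
  also have "\<dots> = int (card X)"
    using assms(3) fin by (simp add: sum.If_cases Int_absorb1)
  finally show ?thesis .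
qed

lemma odd_crossing_not_virtual:
  "odd_crossing D p \<Longrightarrow> p \<notin> virt D"
  by (auto simp: odd_crossing_def classical_params_def)

lemma width_q_alexander: "width Var_q (alexander D) \<le> 2 * int (num_virtual D)"
proof -
  have "width Var_q (alexander D) \<le> int (card {t \<in> crossing_params D. curve D t \<in> virt D})"
    by (rule width_alexander_le_card)
      (auto simp: own_def cross_def own_coeff_def cross_coeff_def strand_sign_def
        intro!: exps_within_diff exps_within_mult[of _ 0 0 _ 0 0, simplified])
  then show ?thesis using virtual_passages by simp
qed

lemma width_theta_alexander: "width Var_theta (alexander D) \<le> 2 * int (num_odd D)"
proof -
  have "width Var_theta (alexander D) \<le> int (card {t \<in> crossing_params D. odd_crossing D (curve D t)})"
    by (rule width_alexander_le_card)
      (auto simp: own_def cross_def own_coeff_def cross_coeff_def strand_sign_def odd_crossing_not_virtual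
        intro!: exps_within_diff exps_within_mult[of _ 0 0 _ 0 0, simplified])
  then show ?thesis using odd_passages by simp
qed

end

section \<open>Parity\<close>

context
  fixes D :: vdiagram
  assumes vk: "vknot_diagram D"
begin

lemmas [simp] = curve_int[OF vk] over_int[OF vk] meets_int[OF vk] crosses_int[OF vk]

lemma classical_int [simp]: "classical D (t + of_int n) \<longleftrightarrow> classical D t"
  by (simp add: classical_def)

lemma finite_classical: "finite {u. classical D u \<and> c \<le> u \<and> u < x}"
  by (rule finite_subset[OF _ finite_crosses[OF vk, of c x]]) (auto simp: classical_def)

lemma classical_count_add:
  assumes "c \<le> x" "x \<le> y"
  shows "classical_count D c y = classical_count D c x + classical_count D x y"
  unfolding classical_count_def
  by (subst card_Un_disjoint[symmetric])
    (use assms finite_classical in \<open>auto intro!: arg_cong[of _ _ card]\<close>)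

lemma classical_count_int:
  "classical_count D (c + of_int n) (x + of_int n) = classical_count D c x"
proof -
  have "{u. classical D u \<and> c + of_int n \<le> u \<and> u < x + of_int n}
      = (\<lambda>u. u + of_int n) ` {u. classical D u \<and> c \<le> u \<and> u < x}" (is "?A = ?f ` ?B")
  proof (intro equalityI subsetI)
    fix u assume u: "u \<in> ?A"
    have "classical D (u + of_int (- n))" using u by (simp only: classical_int) simp
    then show "u \<in> ?f ` ?B" using u by (intro image_eqI[of _ _ "u - of_int n"]) auto
  qed auto
  then show ?thesis unfolding classical_count_def by (simp add: card_image)
qed

lemma even_classical_count_period: "even (classical_count D c (c + 1))"
proof -
  let ?X = "{u. classical D u \<and> c \<le> u \<and> u < c + 1}"
  have "card ?X = 2 * card (curve D ` ?X)"
  proof (rule card_partner_closed[OF vk])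
    show "?X \<subseteq> window D c" by (auto simp: window_def classical_def)
    fix t assume "t \<in> ?X"
    then have t: "crosses D t" "curve D t \<notin> virt D" by (auto simp: classical_def)
    note p = partner[OF vk t(1), of c]
    have "crosses D (partner D c t)" "curve D (partner D c t) = curve D t"
      using meets_sym[OF p(2)] meets_crosses p(2) by (auto simp: meets_def)
    then show "partner D c t \<in> ?X" using p(1) t by (simp add: classical_def)
  qed
  then show ?thesis by (simp add: classical_count_def)
qed

lemma odd_crossing_base_0:
  assumes t: "meets D t t'" "t \<in> {0..<1}" "t' \<in> {0..<1}" "curve D t \<notin> virt D"
  shows "odd_crossing D (curve D t) \<longleftrightarrow> even (classical_count D 0 t + classical_count D 0 t')"
proof -
  have main: "odd_crossing D (curve D t) \<longleftrightarrow> even (classical_count D 0 t + classical_count D 0 t')"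
    if t: "meets D t t'" "0 \<le> t" "t < t'" "t' < 1" "curve D t \<notin> virt D" for t t'
  proof -
    have cl: "classical D t" "classical D t'"
      
      using t(5) meets_crosses[OF t(1)] meets_crosses[OF meets_sym[OF t(1)]] meets_curve[OF t(1)]
      by (simp_all add: classical_def)
    have par: "t \<in> classical_params D" "t' \<in> classical_params D"
      using cl t by (auto simp: classical_params_eq)
    have only: "s = t \<and> s' = t'"
      if s: "s \<in> classical_params D" "s' \<in> classical_params D" "s < s'" "curve D s = curve D t" "curve D s' = curve D t" for s s'
    proof -
      have w: "s \<in> {0..<0+1}" "s' \<in> {0..<0+1}" "t \<in> {0..<0+1}" "t' \<in> {0..<0+1}" using s t by (auto simp: classical_params_eq)
      have "s = t \<or> s = t'" "s' = t \<or> s' = t'"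
        using same_window_meets[OF vk, of t 0 s] same_window_meets[OF vk, of t 0 s'] partner_eq[OF vk, of t s 0] partner_eq[OF vk, of t s' 0]
          partner_eq[OF vk t(1) w(4)] w s by metis+
      then show ?thesis using s(3) t(3) by auto
    qed
    have "odd_crossing D (curve D t) \<longleftrightarrow> odd (card {u \<in> classical_params D. t < u \<and> u < t'})"
    proof
      assume "odd_crossing D (curve D t)"
      then show "odd (card {u \<in> classical_params D. t < u \<and> u < t'})"
        unfolding odd_crossing_def using only by blast
    next
      assume "odd (card {u \<in> classical_params D. t < u \<and> u < t'})"
      then show "odd_crossing D (curve D t)"
        unfolding odd_crossing_def using par t meets_curve[OF t(1)] by auto
    qed
    moreover have "classical_count D 0 t' = classical_count D 0 t + (1 + card {u \<in> classical_params D. t < u \<and> u < t'})"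
    proof -
      have "{u. classical D u \<and> t \<le> u \<and> u < t'} = insert t {u \<in> classical_params D. t < u \<and> u < t'}"
        using cl t by (auto simp: classical_params_eq)
      moreover have "finite {u \<in> classical_params D. t < u \<and> u < t'}"
        by (rule finite_subset[OF _ finite_classical[of t t']]) (auto simp: classical_params_eq)
      ultimately have "classical_count D t t' = 1 + card {u \<in> classical_params D. t < u \<and> u < t'}"
        by (simp add: classical_count_def)
      then show ?thesis using classical_count_add[of 0 t t'] t by simp
    qed
    ultimately show ?thesis by (simp add: even_add) blast
  qed
  have "t \<noteq> t'" using t(1) by (auto simp: meets_def)
  then consider "t < t'" | "t' < t" by linarith
  then show ?thesis
  proof cases
    case 1
    then show ?thesis using main[OF t(1)] t by simp
  next
    case 2
    then show ?thesis using main[OF meets_sym[OF t(1)]] t meets_curve[OF t(1)] by (simp add: add.commute)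
  qed
qed

text \<open>
  From the earlier passage of a crossing to the later one, the count grows by 1 for the earlier passage
  itself and by the number of passages in between. A change of the base point adds a constant to the
  counts, modulo the number of classical passages in a period, which is even.
\<close>

lemma odd_crossing_iff:
  assumes t: "meets D t t'" "t \<in> {c..<c + 1}" "t' \<in> {c..<c + 1}" "curve D t \<notin> virt D"
  shows "odd_crossing D (curve D t) \<longleftrightarrow> even (classical_count D c t + classical_count D c t')"
proof -
  define n where "n = (of_int \<lfloor>c\<rfloor> :: real)"
  have n: "n \<le> c" "c < n + 1" unfolding n_def by linarith+
  define rebased where "rebased t = (if t < n + 1 then t - n else t - n - 1)" for t
  have rebased_int: "\<exists>k::int. rebased s = s + of_int k" for s
    by (cases "s < n + 1") (auto simp: rebased_def n_def intro: exI[of _ "- \<lfloor>c\<rfloor>"] exI[of _ "- \<lfloor>c\<rfloor> - 1"])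
  have unit: "rebased s \<in> {0..<1}" if "s \<in> {c..<c + 1}" for s using that n by (auto simp: rebased_def)
  have rebase: "even (classical_count D c s + classical_count D 0 (rebased s)) \<longleftrightarrow> even (classical_count D n c)"
    if s: "s \<in> {c..<c + 1}" for s
  proof (cases "s < n + 1")
    case True
    have "classical_count D 0 (rebased s) = classical_count D n s"
      using classical_count_int[of 0 "\<lfloor>c\<rfloor>" "rebased s"] True by (simp add: rebased_def n_def)
    also have "\<dots> = classical_count D n c + classical_count D c s"
      using s n by (intro classical_count_add) auto
    finally show ?thesis by (simp add: even_add) blast
  next
    case False
    have "classical_count D 0 (rebased s) = classical_count D (n + 1) s"
      using classical_count_int[of 0 "\<lfloor>c\<rfloor> + 1" "rebased s"] False by (simp add: rebased_def n_def add_ac)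
    moreover have "classical_count D c s = classical_count D c (n + 1) + classical_count D (n + 1) s"
      using s n False by (intro classical_count_add) auto
    moreover have "classical_count D n (n + 1) = classical_count D n c + classical_count D c (n + 1)"
      using n by (intro classical_count_add) auto
    ultimately show ?thesis using even_classical_count_period[of n] by (simp add: even_add) blast
  qed
  obtain k k' :: int where k: "rebased t = t + of_int k" "rebased t' = t' + of_int k'"
    using rebased_int[of t] rebased_int[of t'] by blast
  then have "meets D (rebased t) (rebased t')" "curve D (rebased t) = curve D t" using t by simp_all
  then have "odd_crossing D (curve D t)
      \<longleftrightarrow> even (classical_count D 0 (rebased t) + classical_count D 0 (rebased t'))"
    using odd_crossing_base_0[of "rebased t" "rebased t'"] unit t by simp
  then show ?thesis using rebase[OF t(2)] rebase[OF t(3)] by simp argo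
qed

end

section \<open>Planar isotopy\<close>

lemma Ints_diffE:
  fixes x y :: real
  assumes "x - y \<in> \<int>"
  obtains n :: int where "x = y + of_int n"
  using assms by (metis Ints_cases add.commute diff_add_cancel)

lemma coefficients_cong:
  assumes "crosses D t \<longleftrightarrow> crosses D' t'"
    and "crosses D t \<Longrightarrow> curve D t \<in> virt D \<longleftrightarrow> curve D' t' \<in> virt D'"
    and "crosses D t \<Longrightarrow> strand_sign D t = strand_sign D' t'"
    and "classical D t \<Longrightarrow> over D t = over D' t' \<and>
           (odd_crossing D (curve D t) \<longleftrightarrow> odd_crossing D' (curve D' t'))"
  shows "own D t = own D' t' \<and> cross D t = cross D' t'"
  using assms by (auto simp: own_def cross_def own_coeff_def cross_coeff_def classical_def)

lemma cyc_pred_strict_mono: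
  assumes "finite P" "P \<noteq> {}" "strict_mono g"
  shows "cyc_pred (g ` P) (g i) = g (cyc_pred P i)"
proof (cases rule: cyc_pred_cases[OF assms(1,2), of i])
  case 1
  then show ?thesis
    using assms cyc_pred_in[OF assms(1,2)]
    by (intro cyc_pred_below) (auto simp: strict_mono_less strict_mono_less_eq)
next
  case 2
  then show ?thesis
    using assms cyc_pred_in[OF assms(1,2)]
    by (intro cyc_pred_wrap) (auto simp: strict_mono_less strict_mono_less_eq)
qed

lemma circle_diffeo_facts:
  assumes "circle_diffeo \<phi>"
  shows "strict_mono \<phi>" "\<And>t n. \<phi> (t + of_int n) = \<phi> t + of_int n"
    "\<And>t. (\<phi> has_vector_derivative vector_derivative \<phi> (at t)) (at t)"
    "\<And>y x. \<phi> 0 \<le> y \<Longrightarrow> y < \<phi> x \<Longrightarrow> x \<le> 1 \<Longrightarrow> \<exists>t. 0 \<le> t \<and> t < x \<and> \<phi> t = y"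
proof -
  show der: "(\<phi> has_vector_derivative vector_derivative \<phi> (at t)) (at t)" for t
    using assms by (auto simp: circle_diffeo_def C1_differentiable_on_eq vector_derivative_works[symmetric])
  have rder: "(\<phi> has_real_derivative vector_derivative \<phi> (at t)) (at t)" for t
    using der by (simp add: has_real_derivative_iff_has_vector_derivative)
  have pos: "vector_derivative \<phi> (at t) > 0" for t using assms by (simp add: circle_diffeo_def)
  show mono: "strict_mono \<phi>"
  proof (rule strict_monoI)
    fix x y :: real assume "x < y"
    then show "\<phi> x < \<phi> y" by (rule DERIV_pos_imp_increasing) (use rder pos in blast)
  qed
  show "\<phi> (t + of_int n) = \<phi> t + of_int n" for t n
  proof -
    have "\<phi> (t + of_int n) - (t + of_int n) = \<phi> t - t"
      using assms by (intro periodic_int[of "\<lambda>t. \<phi> t - t"]) (simp add: circle_diffeo_def)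
    then show ?thesis by simp
  qed
  have cont: "continuous_on S \<phi>" for S
    using rder by (meson DERIV_isCont continuous_at_imp_continuous_on)
  show "\<exists>t. 0 \<le> t \<and> t < x \<and> \<phi> t = y" if y: "\<phi> 0 \<le> y" "y < \<phi> x" for y x
  proof -
    have "0 < x" using y mono by (meson leI le_less_trans not_less strict_mono_less_eq)
    then obtain t where "0 \<le> t" "t \<le> x" "\<phi> t = y" using IVT'[of \<phi> 0 y x] y cont by auto
    then show ?thesis using y by (intro exI[of _ t]) (auto simp: le_less)
  qed
qed

text \<open>
  A linear map of the plane multiplies oriented areas by its determinant.
\<close>

lemma Im_cnj_linear_image:
  fixes f :: "complex \<Rightarrow> complex"
  assumes "linear f"
  shows "Im (cnj (f v) * f w) = Im (cnj (f 1) * f \<i>) * Im (cnj v * w)"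
proof -
  have f: "f z = Re z *\<^sub>R f 1 + Im z *\<^sub>R f \<i>" for z
  proof -
    have "z = Re z *\<^sub>R 1 + Im z *\<^sub>R \<i>" by (simp add: complex_eq_iff)
    then have "f z = f (Re z *\<^sub>R 1 + Im z *\<^sub>R \<i>)" by simp
    then show ?thesis using assms by (simp add: linear_add linear_scale)
  qed
  show ?thesis unfolding f[of v] f[of w] by (simp add: algebra_simps)
qed

text \<open>
  The reparametrization carries the passages of one diagram to those of the other in their cyclic
  order. The signs agree because the diffeomorphism preserves the orientation of the plane, the parities
  because the counts of classical passages are carried along.
\<close>

lemma alexander_planar_isotopy:
  assumes vk: "vknot_diagram D" and vk': "vknot_diagram D'" and iso: "planar_isotopy D D'"
  shows "alexander D' = alexander D"
proof -
  obtain h \<phi> where h: "plane_diffeo h" and \<phi>: "circle_diffeo \<phi>"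
    and curve': "\<forall>t. curve D' t = h (curve D (\<phi> t))"
    and dec': "\<forall>t t'. meets D' t t' \<longrightarrow> (curve D' t \<in> virt D' \<longleftrightarrow> curve D (\<phi> t) \<in> virt D) \<and>
           (curve D' t \<notin> virt D' \<longrightarrow> over D' t = over D (\<phi> t))"
    using iso unfolding planar_isotopy_def by (elim exE conjE) (rule that)
  note curve = curve'[rule_format] and dec = dec'[rule_format]
  note \<phi>f = circle_diffeo_facts[OF \<phi>]
  have inj: "\<phi> x = \<phi> y \<longleftrightarrow> x = y" for x y using \<phi>f(1) by (simp add: strict_mono_eq)
  have "t - t' \<in> \<int> \<longleftrightarrow> \<phi> t - \<phi> t' \<in> \<int>" for t t'
  proof
    assume "t - t' \<in> \<int>"
    then obtain n where "t = t' + of_int n" by (rule Ints_diffE)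
    then show "\<phi> t - \<phi> t' \<in> \<int>" using \<phi>f(2) by simp
  next
    assume "\<phi> t - \<phi> t' \<in> \<int>"
    then obtain n where "\<phi> t = \<phi> t' + of_int n" by (rule Ints_diffE)
    then have "t = t' + of_int n" using inj \<phi>f(2)[of t' n] by metis
    then show "t - t' \<in> \<int>" by simp
  qed
  moreover have "h x = h y \<longleftrightarrow> x = y" for x y
    using h by (auto simp: plane_diffeo_def dest: bij_is_inj injD)
  ultimately have meets: "meets D' t t' \<longleftrightarrow> meets D (\<phi> t) (\<phi> t')" for t t'
    by (simp add: meets_def curve)
  obtain h' where h': "\<And>z. (h has_derivative h' z) (at z)" "\<And>z. Im (cnj (h' z 1) * h' z \<i>) > 0"
    using h unfolding plane_diffeo_def by blast
  define v where "v t = vector_derivative \<phi> (at t)" for t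
  have v: "v t > 0" for t using \<phi> by (simp add: v_def circle_diffeo_def)
  have velocity: "velocity D' t = h' (curve D (\<phi> t)) (v t *\<^sub>R velocity D (\<phi> t))" for t
  proof -
    have "((curve D \<circ> \<phi>) has_vector_derivative v t *\<^sub>R velocity D (\<phi> t)) (at t)"
      unfolding v_def by (rule vector_diff_chain_at[OF \<phi>f(3) curve_has_velocity[OF vk]])
    then have "((h \<circ> (curve D \<circ> \<phi>)) has_derivative
        (h' (curve D (\<phi> t)) \<circ> (\<lambda>x. x *\<^sub>R (v t *\<^sub>R velocity D (\<phi> t))))) (at t)"
      unfolding has_vector_derivative_def by (rule diff_chain_at) (simp add: h'(1))
    moreover have "h \<circ> (curve D \<circ> \<phi>) = curve D'" by (auto simp: curve)
    moreover have "linear (h' z)" for z using h'(1) has_derivative_linear by blast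
    ultimately have "(curve D' has_vector_derivative h' (curve D (\<phi> t)) (v t *\<^sub>R velocity D (\<phi> t))) (at t)"
      by (simp add: has_vector_derivative_def o_def linear_scale)
    then show ?thesis using curve_has_velocity[OF vk'] vector_derivative_unique_at by blast
  qed
  have turn: "turn D' t t' > 0 \<longleftrightarrow> turn D (\<phi> t) (\<phi> t') > 0" if m: "meets D' t t'" for t t'
  proof -
    let ?z = "curve D (\<phi> t)"
    have z: "curve D (\<phi> t') = ?z" using m meets by (simp add: meets_def)
    have lin: "linear (h' ?z)" using h'(1) has_derivative_linear by blast
    have "turn D' t t' = (Im (cnj (h' ?z 1) * h' ?z \<i>) * (v t * v t')) * turn D (\<phi> t) (\<phi> t')"
      using Im_cnj_linear_image[OF lin, of "v t *\<^sub>R velocity D (\<phi> t)" "v t' *\<^sub>R velocity D (\<phi> t')"]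
      by (simp add: turn_def velocity z algebra_simps)
    moreover have "Im (cnj (h' ?z 1) * h' ?z \<i>) * (v t * v t') > 0"
      using h'(2) v by (intro mult_pos_pos) auto
    ultimately show ?thesis by (metis mult_pos_pos zero_less_mult_pos)
  qed
  have onto: "\<exists>t. \<phi> t = s \<and> 0 \<le> t \<and> t < x" if "\<phi> 0 \<le> s" "s < \<phi> x" "x \<le> 1" for s x
    using \<phi>f(4)[OF that] by blast
  have \<phi>1: "\<phi> 1 = \<phi> 0 + 1" using \<phi>f(2)[of 0 1] by simp
  have crosses: "crosses D' t \<longleftrightarrow> crosses D (\<phi> t)" for t
  proof
    assume c: "crosses D (\<phi> t)"
    note p = partner[OF vk c, of "\<phi> 0"]
    then obtain t' where "\<phi> t' = partner D (\<phi> 0) (\<phi> t)" using onto[of _ 1] \<phi>1 by force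
    then show "crosses D' t" using p(2) meets[of t t'] by (auto simp: crosses_def)
  qed (auto simp: crosses_def meets)
  have virt: "curve D' t \<in> virt D' \<longleftrightarrow> curve D (\<phi> t) \<in> virt D" if "crosses D' t" for t
    using that dec by (auto simp: crosses_def)
  have classical: "classical D' t \<longleftrightarrow> classical D (\<phi> t)" for t
    using crosses virt by (auto simp: classical_def)
  have count: "classical_count D' 0 x = classical_count D (\<phi> 0) (\<phi> x)" if "x \<le> 1" for x
  proof -
    have "{u. classical D u \<and> \<phi> 0 \<le> u \<and> u < \<phi> x} = \<phi> ` {u. classical D' u \<and> 0 \<le> u \<and> u < x}"
      using onto[of _ x] \<phi>f(1) that by (auto simp: classical strict_mono_less strict_mono_less_eq)
    then show ?thesis by (simp add: classical_count_def card_image inj_on_def inj)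
  qed
  have win: "\<phi> t \<in> {\<phi> 0..<\<phi> 0 + 1} \<longleftrightarrow> t \<in> {0..<1}" for t
    using \<phi>f(1) \<phi>1[symmetric] by (simp add: strict_mono_less strict_mono_less_eq)
  have par: "partner D (\<phi> 0) (\<phi> t) = \<phi> (partner D' 0 t)" if "crosses D' t" for t
    using partner[OF vk' that, of 0] meets win by (intro partner_eq[OF vk]) auto
  have coeff: "own D (\<phi> t) = own D' t \<and> cross D (\<phi> t) = cross D' t" if t: "t \<in> {0..<1}" for t
  proof -
    have "own D' t = own D (\<phi> t) \<and> cross D' t = cross D (\<phi> t)"
    proof (rule coefficients_cong)
      show "crosses D' t \<longleftrightarrow> crosses D (\<phi> t)" by (rule crosses)
      assume c: "crosses D' t"
      note p = partner[OF vk' c, of 0]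
      show "curve D' t \<in> virt D' \<longleftrightarrow> curve D (\<phi> t) \<in> virt D" using virt c by blast
      show "strand_sign D' t = strand_sign D (\<phi> t)"
        using strand_sign_eq[OF vk' p(2)] strand_sign_eq[OF vk, of "\<phi> t"] p(2) meets turn by simp
    next
      assume c: "classical D' t"
      then have cr: "crosses D' t" "curve D' t \<notin> virt D'" "curve D (\<phi> t) \<notin> virt D"
        using classical by (auto simp: classical_def)
      note p = partner[OF vk' cr(1), of 0]
      have "odd_crossing D' (curve D' t) \<longleftrightarrow> even (classical_count D' 0 t + classical_count D' 0 (partner D' 0 t))"
        using odd_crossing_iff[OF vk' p(2), of 0] p t cr by simp
      also have "\<dots> \<longleftrightarrow> odd_crossing D (curve D (\<phi> t))"
        using odd_crossing_iff[OF vk, of "\<phi> t" "\<phi> (partner D' 0 t)" "\<phi> 0"] p meets win t cr count by simp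
      finally show "over D' t = over D (\<phi> t) \<and> (odd_crossing D' (curve D' t) \<longleftrightarrow> odd_crossing D (curve D (\<phi> t)))"
        using dec[OF p(2)] cr by blast
    qed
    then show ?thesis by simp
  qed
  have sub: "crossing_params D' \<subseteq> {0..<1}" by (auto simp: crossing_params_def)
  have img: "\<phi> ` crossing_params D' = window D (\<phi> 0)"
    unfolding window_0[symmetric] window_def
    using onto[of _ 1] \<phi>1 win crosses by (auto simp: image_iff)
  have "knot_det D (\<phi> 0) (\<phi> ` crossing_params D') = knot_det D' 0 (crossing_params D')"
    unfolding knot_det_def
  proof (rule relation_matrix_relabel)
    show "finite (crossing_params D')" by (rule finite_crossing_params[OF vk'])
    show "inj_on \<phi> (crossing_params D')" by (simp add: inj_on_def inj)
    fix i assume i: "i \<in> crossing_params D'"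
    then show "own D (\<phi> i) = own D' i \<and> cross D (\<phi> i) = cross D' i" using coeff sub by blast
    have "crosses D' i" using i window_0[of D'] by (auto simp: window_def)
    then show "partner D' 0 i \<in> crossing_params D' \<and> partner D (\<phi> 0) (\<phi> i) = \<phi> (partner D' 0 i)"
      using par partner_window[OF vk', of i 0] i window_0 by auto
    show "cyc_pred (\<phi> ` crossing_params D') (\<phi> i) = \<phi> (cyc_pred (crossing_params D') i)"
      by (rule cyc_pred_strict_mono) (use finite_crossing_params[OF vk'] i \<phi>f(1) in auto)
  qed
  moreover have "crossing_params D' = {} \<longleftrightarrow> crossing_params D = {}"
    using img window_shift(1)[OF vk, of "\<phi> 0"] by auto
  ultimately show ?thesis
    unfolding img knot_det_window[OF vk] by (simp add: alexander_def)
qed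

section \<open>Diagrams that agree outside a disc\<close>

definition inside :: "(real \<times> real) set \<Rightarrow> real set" where
  "inside J = (\<Union>(a, b)\<in>J. circle_arc a b)"

definition arcs_in :: "real \<Rightarrow> (real \<times> real) set \<Rightarrow> bool" where
  "arcs_in c J \<longleftrightarrow> finite J \<and> J \<noteq> {} \<and> (\<forall>(a, b)\<in>J. c \<le> a \<and> a < b \<and> b < c + 1) \<and>
     (\<forall>(a, b)\<in>J. \<forall>(a', b')\<in>J. (a, b) = (a', b') \<or> b < a' \<or> b' < a)"

text \<open>
  The part of the description of a move that concerns the outside of the disc, in a form that is
  symmetric in the two diagrams. The set J consists of the arcs of the disc, all within the period that
  begins at c.
\<close>

definition agree_off :: "real \<Rightarrow> (real \<times> real) set \<Rightarrow> vdiagram \<Rightarrow> vdiagram \<Rightarrow> bool" where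
  "agree_off c J D D' \<longleftrightarrow> vknot_diagram D \<and> vknot_diagram D' \<and> arcs_in c J \<and>
     (\<forall>t\<in>inside J. \<forall>t'. t' \<notin> inside J \<longrightarrow> curve D t \<noteq> curve D t' \<and> curve D' t \<noteq> curve D' t') \<and>
     (\<forall>t. t \<notin> inside J \<longrightarrow> curve D' t = curve D t \<and> over D' t = over D t \<and>
        (curve D t \<in> virt D' \<longleftrightarrow> curve D t \<in> virt D))"

lemma agree_offD:
  assumes "agree_off c J D D'"
  shows "vknot_diagram D" "vknot_diagram D'" "arcs_in c J"
    "\<And>t t'. t \<in> inside J \<Longrightarrow> t' \<notin> inside J \<Longrightarrow> curve D t \<noteq> curve D t'"
    "\<And>t t'. t \<in> inside J \<Longrightarrow> t' \<notin> inside J \<Longrightarrow> curve D' t \<noteq> curve D' t'"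
    "\<And>t. t \<notin> inside J \<Longrightarrow> curve D' t = curve D t"
    "\<And>t. t \<notin> inside J \<Longrightarrow> over D' t = over D t"
    "\<And>t. t \<notin> inside J \<Longrightarrow> curve D t \<in> virt D' \<longleftrightarrow> curve D t \<in> virt D"
proof -
  note ag = assms[unfolded agree_off_def]
  have sep: "\<forall>t\<in>inside J. \<forall>t'. t' \<notin> inside J \<longrightarrow> curve D t \<noteq> curve D t' \<and> curve D' t \<noteq> curve D' t'"
    using ag by (elim conjE)
  have same: "\<forall>t. t \<notin> inside J \<longrightarrow> curve D' t = curve D t \<and> over D' t = over D t \<and>
        (curve D t \<in> virt D' \<longleftrightarrow> curve D t \<in> virt D)"
    using ag by (elim conjE)
  show "vknot_diagram D" "vknot_diagram D'" "arcs_in c J"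
    using ag by - (elim conjE, assumption)+
  show "curve D t \<noteq> curve D t'" "curve D' t \<noteq> curve D' t'" if "t \<in> inside J" "t' \<notin> inside J" for t t'
    using sep[rule_format, OF that] by - (elim conjE, assumption)+
  show "curve D' t = curve D t" "over D' t = over D t" "curve D t \<in> virt D' \<longleftrightarrow> curve D t \<in> virt D"
    if "t \<notin> inside J" for t
    using same[rule_format, OF that] by - (elim conjE, assumption)+
qed

lemma agree_off_sym:
  assumes "agree_off c J D D'"
  shows "agree_off c J D' D"
  unfolding agree_off_def
proof (intro conjI ballI allI impI)
  note ag = agree_offD[OF assms]
  show "vknot_diagram D'" "vknot_diagram D" "arcs_in c J" by (fact ag)+
  show "curve D' t \<noteq> curve D' t'" "curve D t \<noteq> curve D t'" if "t \<in> inside J" "t' \<notin> inside J" for t t'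
    using ag(4,5)[OF that] by blast+
  show "curve D t = curve D' t" "over D t = over D' t" "curve D' t \<in> virt D \<longleftrightarrow> curve D' t \<in> virt D'"
    if "t \<notin> inside J" for t
    using ag(6-8)[OF that] by simp_all
qed

lemma circle_arc_int [simp]: "t + of_int n \<in> circle_arc a b \<longleftrightarrow> t \<in> circle_arc a b"
proof
  assume "t + of_int n \<in> circle_arc a b"
  then obtain k :: int where "a < t + of_int n + of_int k" "t + of_int n + of_int k < b"
    by (auto simp: circle_arc_def)
  then show "t \<in> circle_arc a b" unfolding circle_arc_def by (auto intro!: exI[of _ "n + k"] simp: add_ac)
next
  assume "t \<in> circle_arc a b"
  then obtain k :: int where "a < t + of_int k" "t + of_int k < b" by (auto simp: circle_arc_def)
  then show "t + of_int n \<in> circle_arc a b"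
    unfolding circle_arc_def by (auto intro!: exI[of _ "k - n"])
qed

lemma circle_arc_window:
  assumes "c \<le> a" "b < c + 1" "t \<in> {c..<c + 1}"
  shows "t \<in> circle_arc a b \<longleftrightarrow> a < t \<and> t < b"
proof
  assume "t \<in> circle_arc a b"
  then obtain n :: int where n: "a < t + of_int n" "t + of_int n < b" by (auto simp: circle_arc_def)
  then have "\<bar>real_of_int n\<bar> < 1" using assms by auto
  then have "n = 0" by linarith
  then show "a < t \<and> t < b" using n by simp
qed (auto simp: circle_arc_def intro: exI[of _ 0])

lemma inside_iff: "t \<in> inside J \<longleftrightarrow> (\<exists>p\<in>J. t \<in> circle_arc (fst p) (snd p))"
  by (auto simp: inside_def split_beta)

lemma arcs_inD:
  assumes "arcs_in c J"
  shows "finite J" "J \<noteq> {}" "\<And>p. p \<in> J \<Longrightarrow> c \<le> fst p \<and> fst p < snd p \<and> snd p < c + 1"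
    "\<And>p q. p \<in> J \<Longrightarrow> q \<in> J \<Longrightarrow> p = q \<or> snd p < fst q \<or> snd q < fst p"
  using assms unfolding arcs_in_def by (simp_all add: split_beta prod_eq_iff)

lemma inside_window:
  assumes "arcs_in c J" "t \<in> {c..<c + 1}"
  shows "t \<in> inside J \<longleftrightarrow> (\<exists>p\<in>J. fst p < t \<and> t < snd p)"
  unfolding inside_iff
  by (intro bex_cong refl circle_arc_window[OF _ _ assms(2)]) (use arcs_inD(3)[OF assms(1)] in auto)

lemma inside_int [simp]: "t + of_int n \<in> inside J \<longleftrightarrow> t \<in> inside J"
  by (simp add: inside_iff)

lemma eventually_not_in_arc:
  fixes t :: real
  assumes "t \<le> a \<or> b \<le> t" "a < b"
  shows "t \<noteq> a \<Longrightarrow> eventually (\<lambda>x. x \<notin> {a<..<b}) (at_right t)"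
    and "t \<noteq> b \<Longrightarrow> eventually (\<lambda>x. x \<notin> {a<..<b}) (at_left t)"
proof -
  assume "t \<noteq> a"
  then have "t < a \<or> b \<le> t" using assms by auto
  then show "eventually (\<lambda>x. x \<notin> {a<..<b}) (at_right t)"
  proof
    assume "t < a"
    then show ?thesis unfolding eventually_at_right_field by (auto intro!: exI[of _ a])
  next
    assume "b \<le> t"
    then show ?thesis unfolding eventually_at_right_field by (auto intro!: exI[of _ "t + 1"])
  qed
next
  assume "t \<noteq> b"
  then have "t \<le> a \<or> b < t" using assms by auto
  then show "eventually (\<lambda>x. x \<notin> {a<..<b}) (at_left t)"
  proof
    assume "b < t"
    then show ?thesis unfolding eventually_at_left_field by (auto intro!: exI[of _ b])
  next
    assume "t \<le> a"
    then show ?thesis unfolding eventually_at_left_field by (auto intro!: exI[of _ "t - 1"])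
  qed
qed

text \<open>
  An end point of an arc may itself be a crossing, on the boundary of the disc. There the two curves
  agree on one side only, because no arc begins where another one ends; this is enough to compare
  the velocities.
\<close>

lemma one_sided_agreement:
  assumes J: "arcs_in c J" and t: "t \<in> {c..<c + 1}" "t \<notin> inside J"
  shows "eventually (\<lambda>x. x \<notin> inside J) (at_right t) \<or> eventually (\<lambda>x. x \<notin> inside J) (at_left t)"
proof -
  \<comment> \<open>Near a point of the period that begins at c, only arcs from this period and the two adjacent ones occur.\<close>
  define K where "K = (\<Union>(a, b)\<in>J. {(a, b), (a + 1, b + 1), (a - 1, b - 1)})"
  have fin: "finite K" using J by (auto simp: K_def arcs_in_def)
  have near: "x \<notin> inside J" if x: "c - 1 < x" "x < c + 2" "\<forall>p\<in>K. x \<notin> {fst p<..<snd p}" for x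
  proof
    assume "x \<in> inside J"
    then obtain a b n where ab: "(a, b) \<in> J" "a < x + of_int n" "x + of_int n < b"
      by (auto simp: inside_iff circle_arc_def)
    have "c \<le> a" "b < c + 1" using arcs_inD(3)[OF J ab(1)] by simp_all
    then have "real_of_int n < 2" "real_of_int n > - 2" using ab x by linarith+
    then have "n = 0 \<or> n = 1 \<or> n = - 1" by linarith
    then show False using ab x(3) by (auto simp: K_def)
  qed
  have out: "t \<le> a \<or> b \<le> t" "a < b" if K_mem: "(a, b) \<in> K" for a b
  proof -
    obtain p where p: "p \<in> J" "(a, b) = p \<or> (a, b) = (fst p + 1, snd p + 1) \<or> (a, b) = (fst p - 1, snd p - 1)"
      using K_mem by (auto simp: K_def)
    moreover have "\<not> (fst p < t \<and> t < snd p)" using inside_window[OF J t(1)] t(2) p(1) by blast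
    ultimately show "t \<le> a \<or> b \<le> t" "a < b" using arcs_inD(3)[OF J p(1)] t(1) by auto
  qed
  have range: "eventually (\<lambda>x. c - 1 < x) (at t within X)" "eventually (\<lambda>x. x < c + 2) (at t within X)" for X
    using order_tendstoD[OF tendsto_ident_at[of t X]] t(1) by auto
  show ?thesis
  proof (cases "\<exists>b. (t, b) \<in> K")
    case False
    then have "\<forall>p\<in>K. eventually (\<lambda>x. x \<notin> {fst p<..<snd p}) (at_right t)"
      using out by (intro ballI eventually_not_in_arc) force+
    then have "eventually (\<lambda>x. \<forall>p\<in>K. x \<notin> {fst p<..<snd p}) (at_right t)"
      using fin by (simp only: eventually_ball_finite)
    then have "eventually (\<lambda>x. x \<notin> inside J) (at_right t)"
      using range[of "{t<..}"] by eventually_elim (rule near)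
    then show ?thesis by simp
  next
    case True
    then obtain b where b: "(t, b) \<in> K" by blast
    have "snd p \<noteq> t" if p: "p \<in> K" for p
    proof
      assume e: "snd p = t"
      have "\<exists>p0\<in>J. t = fst p0 \<or> t = fst p0 + 1 \<or> t = fst p0 - 1" using b by (force simp: K_def)
      then obtain a0 b0 where 1: "(a0, b0) \<in> J" "t = a0 \<or> t = a0 + 1 \<or> t = a0 - 1" by auto
      have "\<exists>p1\<in>J. t = snd p1 \<or> t = snd p1 + 1 \<or> t = snd p1 - 1" using p e by (force simp: K_def)
      then obtain a1 b1 where 2: "(a1, b1) \<in> J" "t = b1 \<or> t = b1 + 1 \<or> t = b1 - 1" by auto
      have "c \<le> a0" "a0 < c + 1" "c < b1" "b1 < c + 1" "a0 < b0" "a1 < b1"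
        "(a0 = a1 \<and> b0 = b1) \<or> b0 < a1 \<or> b1 < a0"
        using arcs_inD(3)[OF J 1(1)] arcs_inD(3)[OF J 2(1)] arcs_inD(4)[OF J 1(1) 2(1)] by auto
      then show False using 1(2) 2(2) t(1) unfolding atLeastLessThan_iff by (elim disjE conjE; linarith)
    qed
    then have "\<forall>p\<in>K. eventually (\<lambda>x. x \<notin> {fst p<..<snd p}) (at_left t)"
      using out by (intro ballI eventually_not_in_arc) force+
    then have "eventually (\<lambda>x. \<forall>p\<in>K. x \<notin> {fst p<..<snd p}) (at_left t)"
      using fin by (simp only: eventually_ball_finite)
    then have "eventually (\<lambda>x. x \<notin> inside J) (at_left t)"
      using range[of "{..<t}"] by eventually_elim (rule near)
    then show ?thesis by simp
  qed
qed

lemma one_sided_derivative_cong: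
  fixes f g :: "real \<Rightarrow> complex"
  assumes "(f has_vector_derivative f') (at t)" "(g has_vector_derivative g') (at t)" "f t = g t"
    and "eventually (\<lambda>x. f x = g x) (at t within X)" "at t within X \<noteq> bot"
  shows "f' = g'"
proof -
  have eq: "at t within insert t X = at t within X"
    unfolding at_within_def by (rule arg_cong[of _ _ "\<lambda>Y. inf (nhds t) (principal Y)"]) auto
  have f: "(f has_derivative (\<lambda>x. x *\<^sub>R f')) (at t within insert t X)"
    using has_vector_derivative_at_within[OF assms(1)] by (simp only: has_vector_derivative_def)
  have ev: "eventually (\<lambda>x. f x = g x) (at t within insert t X)" unfolding eq by (rule assms(4))
  have "(g has_derivative (\<lambda>x. x *\<^sub>R f')) (at t within insert t X)"
    by (rule has_derivative_transform_eventually[OF f ev assms(3)]) simp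
  then have "(g has_vector_derivative f') (at t within X)"
    unfolding eq by (simp only: has_vector_derivative_def)
  then show ?thesis
    by (rule vector_derivative_unique_within[OF assms(5) _ has_vector_derivative_at_within[OF assms(2)]])
qed

section \<open>Replacing the content of the disc\<close>

lemma shift_into_period:
  fixes c t :: real
  obtains n :: int where "t + of_int n \<in> {c..<c + 1}"
proof
  show "t + of_int \<lceil>c - t\<rceil> \<in> {c..<c + 1}"
    using le_of_int_ceiling[of "c - t"] of_int_ceiling_le_add_one[of "c - t"]
    by (simp add: algebra_simps) linarith
qed

context
  fixes c :: real and J :: "(real \<times> real) set" and D D' :: vdiagram
  assumes ag: "agree_off c J D D'"
begin

lemma agree_velocity:
  assumes "t \<notin> inside J"
  shows "velocity D t = velocity D' t"
proof -
  note agD = agree_offD[OF ag]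
  obtain n where n: "t + of_int n \<in> {c..<c + 1}" by (rule shift_into_period)
  let ?t = "t + of_int n"
  have out: "?t \<notin> inside J" using assms by simp
  have der: "(curve D has_vector_derivative velocity D ?t) (at ?t)"
    "(curve D' has_vector_derivative velocity D' ?t) (at ?t)"
    using curve_has_velocity[OF agD(1)] curve_has_velocity[OF agD(2)] by blast+
  have pt: "curve D ?t = curve D' ?t" using agD(6)[OF out] by simp
  have ev: "eventually (\<lambda>x. curve D x = curve D' x) F" if "eventually (\<lambda>x. x \<notin> inside J) F" for F
    using that by eventually_elim (rule agD(6)[symmetric])
  have "velocity D ?t = velocity D' ?t"
    using one_sided_agreement[OF agD(3) n out]
  proof
    assume "eventually (\<lambda>x. x \<notin> inside J) (at_right ?t)"
    from one_sided_derivative_cong[OF der pt ev[OF this]] show ?thesis by simp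
  next
    assume "eventually (\<lambda>x. x \<notin> inside J) (at_left ?t)"
    from one_sided_derivative_cong[OF der pt ev[OF this]] show ?thesis by simp
  qed
  then show ?thesis by (simp add: velocity_int[OF agD(1)] velocity_int[OF agD(2)])
qed

lemma outer_meets_outer:
  assumes "t \<notin> inside J" "meets D t t'"
  shows "t' \<notin> inside J"
  using agree_offD(4)[OF ag, of t' t] assms by (auto simp: meets_def)

lemma agree_meets:
  assumes "t \<notin> inside J"
  shows "meets D t t' \<longleftrightarrow> meets D' t t'"
proof (cases "t' \<in> inside J")
  case True
  then have "curve D t' \<noteq> curve D t" "curve D' t' \<noteq> curve D' t"
    using agree_offD(4,5)[OF ag _ assms] by simp_all
  then show ?thesis by (auto simp: meets_def)
next
  case False
  then show ?thesis using agree_offD(6)[OF ag] assms by (simp add: meets_def)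
qed

lemma agree_crosses: "t \<notin> inside J \<Longrightarrow> crosses D t \<longleftrightarrow> crosses D' t"
  using agree_meets by (simp add: crosses_def)

lemma agree_virt: "t \<notin> inside J \<Longrightarrow> curve D t \<in> virt D \<longleftrightarrow> curve D' t \<in> virt D'"
  using agree_offD(6,8)[OF ag] by simp

lemma agree_classical: "t \<notin> inside J \<Longrightarrow> classical D t \<longleftrightarrow> classical D' t"
  using agree_crosses agree_virt by (simp add: classical_def)

lemma agree_partner:
  assumes "t \<notin> inside J" "crosses D t"
  shows "partner D c t = partner D' c t" "partner D c t \<notin> inside J"
proof -
  note p = partner[OF agree_offD(1)[OF ag] assms(2), of c]
  have "meets D' t (partner D c t)" using agree_meets[OF assms(1)] p(2) by simp
  then show "partner D c t = partner D' c t" using partner_eq[OF agree_offD(2)[OF ag] _ p(1)] by simp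
  show "partner D c t \<notin> inside J" by (rule outer_meets_outer[OF assms(1) p(2)])
qed

lemma agree_strand_sign:
  assumes "t \<notin> inside J" "crosses D t"
  shows "strand_sign D t = strand_sign D' t"
proof -
  note p = partner[OF agree_offD(1)[OF ag] assms(2), of c]
  have m': "meets D' t (partner D c t)" using agree_meets[OF assms(1)] p(2) by simp
  have "turn D t (partner D c t) = turn D' t (partner D c t)"
    using agree_velocity assms(1) agree_partner(2)[OF assms] by (simp add: turn_def)
  then show ?thesis
    using strand_sign_eq[OF agree_offD(1)[OF ag] p(2)] strand_sign_eq[OF agree_offD(2)[OF ag] m'] by simp
qed

lemma classical_count_split:
  assumes vk: "vknot_diagram X" and t: "t \<in> {c..<c + 1}" "t \<notin> inside J"
  shows "classical_count X c t = card {u. classical X u \<and> u \<notin> inside J \<and> c \<le> u \<and> u < t}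
     + (\<Sum>p\<in>{p \<in> J. fst p < t}. card {u. classical X u \<and> fst p < u \<and> u < snd p})"
proof -
  note J = arcs_inD[OF agree_offD(3)[OF ag]]
  let ?K = "{p \<in> J. fst p < t}"
  let ?A = "\<lambda>p. {u. classical X u \<and> fst p < u \<and> u < snd p}"
  have after: "snd p \<le> t" if "p \<in> ?K" for p
    using inside_window[OF agree_offD(3)[OF ag] t(1)] t(2) that by (auto simp: not_less)
  have fin: "finite (?A p)" for p
    by (rule finite_subset[OF _ finite_classical[OF vk, of "fst p" "snd p"]]) auto
  have "{u. classical X u \<and> c \<le> u \<and> u < t}
      = {u. classical X u \<and> u \<notin> inside J \<and> c \<le> u \<and> u < t} \<union> (\<Union>p\<in>?K. ?A p)" (is "?L = ?R \<union> ?U")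
  proof (intro equalityI subsetI)
    fix u assume u: "u \<in> ?L"
    show "u \<in> ?R \<union> ?U"
    proof (cases "u \<in> inside J")
      case True
      then obtain p where "p \<in> J" "fst p < u" "u < snd p"
        using u t(1) inside_window[OF agree_offD(3)[OF ag], of u] by auto
      then have "p \<in> ?K" "u \<in> ?A p" using u by simp_all
      then show ?thesis by blast
    qed (use u in auto)
  next
    fix u assume u: "u \<in> ?R \<union> ?U"
    then show "u \<in> ?L"
    proof
      assume "u \<in> ?U"
      then obtain p where p: "p \<in> ?K" "classical X u" "fst p < u" "u < snd p" by auto
      then show ?thesis using after[OF p(1)] J(3)[of p] by auto
    qed auto
  qed
  then have "classical_count X c t = card (?R \<union> ?U)" by (simp add: classical_count_def)
  also have "\<dots> = card ?R + card ?U"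
  proof (rule card_Un_disjoint)
    show "finite ?R" by (rule finite_subset[OF _ finite_classical[OF vk, of c t]]) auto
    show "finite ?U" using J(1) fin by simp
    show "?R \<inter> ?U = {}"
    proof -
      have "u \<in> inside J" if u: "u \<in> ?U" for u
      proof -
        obtain p where p: "p \<in> J" "fst p < u" "u < snd p" using u by auto
        then have "u \<in> {c..<c + 1}" using J(3)[OF p(1)] by auto
        then show ?thesis using p inside_window[OF agree_offD(3)[OF ag]] by blast
      qed
      then show ?thesis by blast
    qed
  qed
  also have "card ?U = (\<Sum>p\<in>?K. card (?A p))"
  proof (rule card_UN_disjoint)
    show "\<forall>p\<in>?K. \<forall>q\<in>?K. p \<noteq> q \<longrightarrow> ?A p \<inter> ?A q = {}"
    proof (intro ballI impI)
      fix p q assume "p \<in> ?K" "q \<in> ?K" "p \<noteq> q"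
      then have "snd p < fst q \<or> snd q < fst p" using J(4)[of p q] by blast
      then show "?A p \<inter> ?A q = {}" by auto
    qed
  qed (use J(1) fin in auto)
  finally show ?thesis .
qed

text \<open>
  If the numbers of classical passages on each arc of the disc differ by even numbers, so do the counts
  outside, and the parities of the crossings outside are the same.
\<close>

lemma agree_classical_count:
  assumes even_arcs: "\<And>p. p \<in> J \<Longrightarrow> even (card {u. classical D u \<and> fst p < u \<and> u < snd p}
       + card {u. classical D' u \<and> fst p < u \<and> u < snd p})"
    and t: "t \<in> {c..<c + 1}" "t \<notin> inside J"
  shows "even (classical_count D c t + classical_count D' c t)"
proof -
  have "{u. classical D u \<and> u \<notin> inside J \<and> c \<le> u \<and> u < t}
      = {u. classical D' u \<and> u \<notin> inside J \<and> c \<le> u \<and> u < t}" (is "?R = ?R'")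
    using agree_classical by auto
  moreover have "even (\<Sum>p\<in>{p \<in> J. fst p < t}. card {u. classical D u \<and> fst p < u \<and> u < snd p}
       + card {u. classical D' u \<and> fst p < u \<and> u < snd p})"
    by (rule dvd_sum) (use even_arcs in simp)
  ultimately show ?thesis
    unfolding classical_count_split[OF agree_offD(1)[OF ag] t] classical_count_split[OF agree_offD(2)[OF ag] t]
    by (simp add: sum.distrib)
qed

lemma agree_coefficients:
  assumes even_arcs: "\<And>p. p \<in> J \<Longrightarrow> even (card {u. classical D u \<and> fst p < u \<and> u < snd p}
       + card {u. classical D' u \<and> fst p < u \<and> u < snd p})"
    and t: "t \<in> {c..<c + 1}" "t \<notin> inside J"
  shows "own D t = own D' t \<and> cross D t = cross D' t"
proof (rule coefficients_cong)
  show "crosses D t \<longleftrightarrow> crosses D' t" by (rule agree_crosses[OF t(2)])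
  show "curve D t \<in> virt D \<longleftrightarrow> curve D' t \<in> virt D'" by (rule agree_virt[OF t(2)])
  show "crosses D t \<Longrightarrow> strand_sign D t = strand_sign D' t" by (rule agree_strand_sign[OF t(2)])
  assume cl: "classical D t"
  then have cr: "crosses D t" "curve D t \<notin> virt D" by (simp_all add: classical_def)
  have v': "curve D' t \<notin> virt D'" using agree_virt[OF t(2)] cr by simp
  note p = partner[OF agree_offD(1)[OF ag] cr(1), of c]
  have m': "meets D' t (partner D c t)" using agree_meets[OF t(2)] p(2) by simp
  have "odd_crossing D (curve D t) \<longleftrightarrow> even (classical_count D c t + classical_count D c (partner D c t))"
    by (rule odd_crossing_iff[OF agree_offD(1)[OF ag] p(2) t(1) p(1) cr(2)])
  moreover have "odd_crossing D' (curve D' t) \<longleftrightarrow> even (classical_count D' c t + classical_count D' c (partner D c t))"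
    by (rule odd_crossing_iff[OF agree_offD(2)[OF ag] m' t(1) p(1) v'])
  moreover have "even (classical_count D c t + classical_count D' c t)"
    by (rule agree_classical_count[OF even_arcs t])
  moreover have "even (classical_count D c (partner D c t) + classical_count D' c (partner D c t))"
    by (rule agree_classical_count[OF even_arcs p(1) agree_partner(2)[OF t(2) cr(1)]])
  ultimately have "odd_crossing D (curve D t) \<longleftrightarrow> odd_crossing D' (curve D' t)" by (simp add: even_add)
  then show "over D t = over D' t \<and> (odd_crossing D (curve D t) \<longleftrightarrow> odd_crossing D' (curve D' t))"
    using agree_offD(7)[OF ag t(2)] by simp
qed

end

text \<open>
  Each arc j of the disc has two gates, d j before all its crossings and e j after them. Within an arc,
  the predecessors in P are the obvious ones, whatever else P contains.
\<close>

definition gated ::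
  "(real \<times> real) set \<Rightarrow> real set \<Rightarrow> (real \<times> real \<Rightarrow> real) \<Rightarrow> (real \<times> real \<Rightarrow> real) \<Rightarrow> real set \<Rightarrow> bool" where
  "gated J L d e P \<longleftrightarrow>
     (\<forall>j\<in>J. d j \<notin> L \<and> e j \<notin> L \<and>
       (\<forall>t p. p \<in> insert (d j) L \<longrightarrow> t \<in> insert (e j) L \<longrightarrow> fst j < p \<longrightarrow> p < t \<longrightarrow> t < snd j \<longrightarrow>
          (\<forall>l\<in>L. l \<le> p \<or> t \<le> l) \<longrightarrow> cyc_pred P t = p) \<and>
       fst j < d j \<and> d j < e j \<and> e j < snd j \<and> (\<forall>l\<in>L. fst j < l \<longrightarrow> l < snd j \<longrightarrow> d j < l \<and> l < e j))"

lemma gates_exist: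
  fixes a b :: real
  assumes "finite X" "a < b" "\<And>x. x \<in> X \<Longrightarrow> a < x \<and> x < b"
  shows "\<exists>d e. a < d \<and> d < e \<and> e < b \<and> (\<forall>x\<in>X. d < x \<and> x < e)"
proof -
  define Y where "Y = insert ((a + b) / 2) X"
  have Y: "finite Y" "Y \<noteq> {}" "\<And>x. x \<in> Y \<Longrightarrow> a < x \<and> x < b" using assms by (auto simp: Y_def)
  have m: "a < Min Y" "Max Y < b" "Min Y \<le> Max Y" using Y Min_in[of Y] Max_in[of Y] by auto
  have "\<forall>x\<in>X. (a + Min Y) / 2 < x \<and> x < (b + Max Y) / 2"
  proof
    fix x assume "x \<in> X"
    then have "Min Y \<le> x" "x \<le> Max Y" using Y(1) by (auto simp: Y_def)
    then show "(a + Min Y) / 2 < x \<and> x < (b + Max Y) / 2" using m by auto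
  qed
  moreover have "a < (a + Min Y) / 2" "(a + Min Y) / 2 < (b + Max Y) / 2" "(b + Max Y) / 2 < b" using m by auto
  ultimately show ?thesis by blast
qed

text \<open>
  This reduces a move to computations inside the disc: the crossings outside have the same relations in
  both diagrams, by \<open>agree_coefficients\<close>, so it remains to compare what the arcs transmit from their
  gates d to their gates e.
\<close>

lemma disc_move:
  assumes ag: "agree_off c J D D'"
    and even_arcs: "\<And>p. p \<in> J \<Longrightarrow> even (card {u. classical D u \<and> fst p < u \<and> u < snd p}
       + card {u. classical D' u \<and> fst p < u \<and> u < snd p})"
    and L: "L = window D c \<inter> inside J" and L': "L' = window D' c \<inter> inside J"
    and unit: "\<And>P d e. gated J L d e P \<Longrightarrow> set_det L (relation_matrix (own D) (cross D) (partner D c) P) dvd 1"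
    and unit': "\<And>P d e. gated J L' d e P \<Longrightarrow> set_det L' (relation_matrix (own D') (cross D') (partner D' c) P) dvd 1"
    and same: "\<And>P P' d e V V' j. \<lbrakk>gated J L d e P; gated J L' d e P'; \<And>j. j \<in> J \<Longrightarrow> V (d j) = V' (d j);
      \<And>l. l \<in> L \<Longrightarrow> V l = own D l * V (cyc_pred P l) + cross D l * V (cyc_pred P (partner D c l));
      \<And>l. l \<in> L' \<Longrightarrow> V' l = own D' l * V' (cyc_pred P' l) + cross D' l * V' (cyc_pred P' (partner D' c l));
      j \<in> J\<rbrakk> \<Longrightarrow> V (cyc_pred P (e j)) = V' (cyc_pred P' (e j))"
  shows "alexander D dvd alexander D' \<and> alexander D' dvd alexander D"
proof -
  note agD = agree_offD[OF ag]
  note J = arcs_inD[OF agD(3)]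
  note in_w = inside_window[OF agD(3)]
  have finL: "finite L" "finite L'"
    using finite_window[OF agD(1)] finite_window[OF agD(2)] by (simp_all add: L L')
  have "\<exists>g. fst j < fst g \<and> fst g < snd g \<and> snd g < snd j \<and>
      (\<forall>x\<in>{x \<in> L \<union> L'. fst j < x \<and> x < snd j}. fst g < x \<and> x < snd g)" if j: "j \<in> J" for j
  proof -
    have "\<exists>d e. fst j < d \<and> d < e \<and> e < snd j \<and> (\<forall>x\<in>{x \<in> L \<union> L'. fst j < x \<and> x < snd j}. d < x \<and> x < e)"
      by (rule gates_exist) (use J(3)[OF j] finL in simp_all)
    then obtain d e where "fst j < d" "d < e" "e < snd j"
      "\<forall>x\<in>{x \<in> L \<union> L'. fst j < x \<and> x < snd j}. d < x \<and> x < e" by (elim exE conjE) (rule that)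
    then show ?thesis by (intro exI[of _ "(d, e)"]) (simp only: fst_conv snd_conv simp_thms)
  qed
  then have "\<forall>j\<in>J. \<exists>g. fst j < fst g \<and> fst g < snd g \<and> snd g < snd j \<and>
      (\<forall>x\<in>{x \<in> L \<union> L'. fst j < x \<and> x < snd j}. fst g < x \<and> x < snd g)" by blast
  from bchoice[OF this] obtain g where g: "\<And>j. j \<in> J \<Longrightarrow> fst j < fst (g j) \<and> fst (g j) < snd (g j) \<and> snd (g j) < snd j \<and>
      (\<forall>x\<in>{x \<in> L \<union> L'. fst j < x \<and> x < snd j}. fst (g j) < x \<and> x < snd (g j))"
    by blast
  define d where "d j = fst (g j)" for j
  define e where "e j = snd (g j)" for j
  have de: "fst j < d j" "d j < e j" "e j < snd j" if "j \<in> J" for j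
    using g[OF that] by (simp_all add: d_def e_def)
  have dl: "d j < l \<and> l < e j" if "j \<in> J" "l \<in> L \<union> L'" "fst j < l" "l < snd j" for j l
    using g[OF that(1)] that by (simp add: d_def e_def)
  have dw: "d j \<in> {c..<c + 1}" "e j \<in> {c..<c + 1}" if "j \<in> J" for j
    using de[OF that] J(3)[OF that] by auto
  have d_in: "d j \<in> inside J" "e j \<in> inside J" if "j \<in> J" for j
  proof -
    show "d j \<in> inside J" unfolding in_w[OF dw(1)[OF that]] using de[OF that] that by (intro bexI[of _ j]) auto
    show "e j \<in> inside J" unfolding in_w[OF dw(2)[OF that]] using de[OF that] that by (intro bexI[of _ j]) auto
  qed
  have dL: "d j \<notin> L \<union> L'" "e j \<notin> L \<union> L'" if "j \<in> J" for j
    using dl[OF that, of "d j"] dl[OF that, of "e j"] de[OF that] by auto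
  define X where "X = window D c - inside J"
  have X': "X = window D' c - inside J" using agree_crosses[OF ag] by (auto simp: X_def window_def)
  define A where "A = X \<union> d ` J \<union> e ` J"
  have finA: "finite A" using finite_window[OF agD(1)] J(1) by (simp add: A_def X_def)
  have neA: "A \<noteq> {}" using J(2) by (auto simp: A_def)
  have Aw: "A \<subseteq> {c..<c + 1}" using dw by (auto simp: A_def X_def window_def)
  define G where "G = (\<lambda>j. (d j, e j)) ` J"
  have outX: "\<not> (fst j < x \<and> x < snd j)" if "x \<in> X" "j \<in> J" for x j
    using in_w[of x] that by (auto simp: X_def window_def)
  have A_arc: "x = d j \<or> x = e j" if x: "x \<in> A" "j \<in> J" "fst j < x" "x < snd j" for x j
  proof -
    have "x \<notin> X" using outX x by blast
    then obtain k where k: "k \<in> J" "x = d k \<or> x = e k" using x(1) unfolding A_def by blast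
    have "fst k < x" "x < snd k" using k(2) de[OF k(1)] by auto
    then have "k = j" using J(4)[OF k(1) x(2)] x by auto
    then show ?thesis using k(2) by simp
  qed
  have gat: "gated J M d e (A \<union> M)" if M: "M = L \<or> M = L'" for M
    unfolding gated_def
  proof (intro ballI conjI allI impI)
    fix j assume j: "j \<in> J"
    show "d j \<notin> M" "e j \<notin> M" using dL[OF j] M by auto
    show "fst j < d j" "d j < e j" "e j < snd j" using de[OF j] by auto
    show "d j < l" "l < e j" if "l \<in> M" "fst j < l" "l < snd j" for l
      using dl[OF j, of l] that M by auto
    fix t p assume p: "p \<in> insert (d j) M" and t: "t \<in> insert (e j) M"
      and pt: "fst j < p" "p < t" "t < snd j" and gap: "\<forall>l\<in>M. l \<le> p \<or> t \<le> l"
    have dp: "d j \<le> p" using p dl[OF j, of p] pt M by auto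
    have te: "t \<le> e j" using t dl[OF j, of t] pt M by auto
    show "cyc_pred (A \<union> M) t = p"
    proof (rule cyc_pred_below)
      show "finite (A \<union> M)" using finA finL M by auto
      show "p \<in> A \<union> M" using p j by (auto simp: A_def)
      fix x assume x: "x \<in> A \<union> M" "x < t"
      show "x \<le> p"
      proof (cases "x \<in> M")
        case True
        then show ?thesis using gap x by auto
      next
        case False
        then have xA: "x \<in> A" using x by simp
        show ?thesis
        proof (rule ccontr)
          assume "\<not> x \<le> p"
          then have "fst j < x" "x < snd j" using pt x by auto
          then have "x = d j \<or> x = e j" by (rule A_arc[OF xA j])
          then show False using dp te x \<open>\<not> x \<le> p\<close> by auto
        qed
      qed
    qed (rule pt)
  qed
  have not_cr: "\<not> crosses Y (d j)" "\<not> crosses Y (e j)" if "j \<in> J" "Y = D \<or> Y = D'" for Y j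
  proof -
    have "d j \<notin> window Y c" "e j \<notin> window Y c" using dL[OF that(1)] d_in[OF that(1)] that(2) L L' by auto
    then show "\<not> crosses Y (d j)" "\<not> crosses Y (e j)" using dw[OF that(1)] by (simp_all add: window_def)
  qed
  have cover: "\<exists>(d', e')\<in>G. d' < l \<and> l < e'" if l: "l \<in> L \<union> L'" for l
  proof -
    have "l \<in> {c..<c + 1}" "l \<in> inside J" using l by (auto simp: L L' window_def)
    then obtain j where j: "j \<in> J" "fst j < l" "l < snd j" using in_w by blast
    then have "(d j, e j) \<in> G" "d j < l" "l < e j" using dl[OF j(1) l] by (auto simp: G_def)
    then show ?thesis by blast
  qed
  have Gprop: "d' \<in> A \<and> e' \<in> A \<and> A \<inter> {d'<..<e'} = {}" if G: "(d', e') \<in> G" for d' e'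
  proof -
    obtain j where j: "j \<in> J" "d' = d j" "e' = e j" using G unfolding G_def by blast
    have "x \<notin> {d'<..<e'}" if "x \<in> A" for x
      using A_arc[OF that j(1)] de[OF j(1)] j by auto
    then show ?thesis using j by (auto simp: A_def)
  qed
  have outer: "own D i = own D' i \<and> cross D i = cross D' i \<and>
      (cross D i \<noteq> 0 \<longrightarrow> partner D c i = partner D' c i \<and> partner D c i \<in> A)" if i: "i \<in> A" for i
  proof (cases "i \<in> X")
    case True
    then have iX: "i \<in> {c..<c + 1}" "i \<notin> inside J" "crosses D i" "i \<in> window D c" by (auto simp: X_def window_def)
    have "partner D c i \<in> X"
      using agree_partner(2)[OF ag iX(2,3)] partner_window[OF agD(1) iX(4)] by (simp add: X_def)
    then show ?thesis
      using agree_coefficients[OF ag even_arcs iX(1,2)] agree_partner(1)[OF ag iX(2,3)] by (simp add: A_def)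
  next
    case False
    then obtain j where "j \<in> J" "i = d j \<or> i = e j" using i unfolding A_def by blast
    then show ?thesis using not_cr[of j D] not_cr[of j D'] by (auto simp: own_def cross_def)
  qed
  have "set_det (A \<union> L) (relation_matrix (own D) (cross D) (partner D c) (A \<union> L)) dvd
           set_det (A \<union> L') (relation_matrix (own D') (cross D') (partner D' c) (A \<union> L')) \<and>
         set_det (A \<union> L') (relation_matrix (own D') (cross D') (partner D' c) (A \<union> L')) dvd
           set_det (A \<union> L) (relation_matrix (own D) (cross D) (partner D c) (A \<union> L))"
  proof (rule tangle_replacement[where G = G])
    fix V V' d' e'
    assume V: "\<And>i. i \<in> A \<Longrightarrow> V i = V' i"
      "\<And>l. l \<in> L \<Longrightarrow> V l = own D l * V (cyc_pred (A \<union> L) l) + cross D l * V (cyc_pred (A \<union> L) (partner D c l))"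
      "\<And>l. l \<in> L' \<Longrightarrow> V' l = own D' l * V' (cyc_pred (A \<union> L') l) + cross D' l * V' (cyc_pred (A \<union> L') (partner D' c l))"
      "(d', e') \<in> G"
    obtain j where j: "j \<in> J" "e' = e j" using V(4) unfolding G_def by blast
    have "V (d k) = V' (d k)" if "k \<in> J" for k using V(1) that by (simp add: A_def)
    from same[OF gat gat this V(2,3) j(1)] show "V (cyc_pred (A \<union> L) e') = V' (cyc_pred (A \<union> L') e')"
      by (simp add: j(2))
  next
    show "set_det L (relation_matrix (own D) (cross D) (partner D c) (A \<union> L)) dvd 1"
      by (rule unit[OF gat]) simp
    show "set_det L' (relation_matrix (own D') (cross D') (partner D' c) (A \<union> L')) dvd 1"
      by (rule unit'[OF gat]) simp
  qed (fact finA finL neA | rule Gprop cover outer; assumption)+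
  moreover have "knot_det D c (A \<union> L) = alexander D"
    by (rule knot_det_eq_alexander[OF agD(1)]) (use finA finL neA Aw in \<open>auto simp: A_def X_def L window_def\<close>)
  moreover have "knot_det D' c (A \<union> L') = alexander D'"
    by (rule knot_det_eq_alexander[OF agD(2)]) (use finA finL neA Aw X' in \<open>auto simp: A_def L' window_def\<close>)
  ultimately show ?thesis by (simp add: knot_det_def)
qed

section \<open>Transmission through local tangles\<close>

lemma lpower_inverse: "lpower x k * lpower x (- k) = 1" "lpower x (- k) * lpower x k = 1"
  by (simp_all add: lpower_mult)

lemma bigon_even_aux:
  fixes s s' t t' x y U1 U2 W1 W2 :: "'a::comm_ring_1"
  assumes ss: "s * s' = 1" and tt: "t * t' = 1"
    and U: "U1 = s * (if p then x else U2)" "U2 = s' * (if p then U1 else x)"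
    and W: "W1 = t * (if r then y else W2) + (1 - t * s) * (if p then x else U2)"
      "W2 = t' * (if r then W1 else y) + (1 - t' * s') * (if p then U1 else x)"
  shows "(if p then U2 else U1) = x \<and> (if r then W2 else W1) = y"
proof -
  have cs: "s * (s' * z) = z" and ct: "t * (t' * z) = z" for z
    by (simp_all add: mult.assoc[symmetric] ss tt)
  show ?thesis
  proof (cases p)
    case True
    then have u: "U1 = s * x" "U2 = s' * U1" using U by auto
    show ?thesis
    proof (cases r)
      case r: True
      have "U2 = x" by (simp add: u algebra_simps ss cs)
      moreover have w: "W1 = t * y + (1 - t * s) * x" "W2 = t' * W1 + (1 - t' * s') * U1" using W True r by auto
      have "W2 = y" by (simp add: w u algebra_simps ss tt cs ct)
      ultimately show ?thesis using True r by simp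
    next
      case r: False
      have "U2 = x" by (simp add: u algebra_simps ss cs)
      moreover have w: "W1 = t * W2 + (1 - t * s) * x" "W2 = t' * y + (1 - t' * s') * U1" using W True r by auto
      have "W1 = y" by (simp add: w u algebra_simps ss tt cs ct)
      ultimately show ?thesis using True r by simp
    qed
  next
    case False
    then have u: "U1 = s * U2" "U2 = s' * x" using U by auto
    show ?thesis
    proof (cases r)
      case r: True
      have "U1 = x" by (simp add: u algebra_simps ss cs)
      moreover have w: "W1 = t * y + (1 - t * s) * U2" "W2 = t' * W1 + (1 - t' * s') * x" using W False r by auto
      have "W2 = y" by (simp add: w u algebra_simps ss tt cs ct)
      ultimately show ?thesis using False r by simp
    next
      case r: False
      have "U1 = x" by (simp add: u algebra_simps ss cs)
      moreover have w: "W1 = t * W2 + (1 - t * s) * U2" "W2 = t' * y + (1 - t' * s') * x" using W False r by auto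
      have "W1 = y" by (simp add: w u algebra_simps ss tt cs ct)
      ultimately show ?thesis using False r by simp
    qed
  qed
qed

lemma bigon_scaling_aux:
  fixes a a' x U1 U2 :: "'a::comm_ring_1"
  assumes "a * a' = 1" "U1 = a * (if p then x else U2)" "U2 = a' * (if p then U1 else x)"
  shows "(if p then U2 else U1) = x"
proof (cases p)
  case True
  then have "U2 = (a * a') * x" using assms(2,3) by (simp add: mult_ac)
  then have "U2 = x" using assms(1) by simp
  then show ?thesis using True by simp
next
  case False
  then have "U1 = (a * a') * x" using assms(2,3) by (simp add: mult_ac)
  then have "U1 = x" using assms(1) by simp
  then show ?thesis using False by simp
qed

text \<open>
  The two strands of a bigon transmit x and y unchanged. The unknowns U1 and W1 belong to one crossing,
  where \<open>\<sigma>\<close> tells how the second strand crosses the first, and U2 and W2 to the other, where it crosses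
  in the opposite direction; p and r say that the crossing of U1 and W1 comes first on the respective
  strand.
\<close>

lemma bigon_relations:
  fixes x y U1 U2 W1 W2 :: laurent
  assumes "U1 = own_coeff vi od ov \<sigma> * (if p then x else U2) + cross_coeff vi od ov \<sigma> * (if r then y else W2)"
    and "U2 = own_coeff vi od ov (- \<sigma>) * (if p then U1 else x) + cross_coeff vi od ov (- \<sigma>) * (if r then W1 else y)"
    and "W1 = own_coeff vi od (\<not> ov) (- \<sigma>) * (if r then y else W2) + cross_coeff vi od (\<not> ov) (- \<sigma>) * (if p then x else U2)"
    and "W2 = own_coeff vi od (\<not> ov) \<sigma> * (if r then W1 else y) + cross_coeff vi od (\<not> ov) \<sigma> * (if p then U1 else x)"
  shows "(if p then U2 else U1) = x \<and> (if r then W2 else W1) = y"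
proof -
  consider "vi \<or> od" | "\<not> vi" "\<not> od" "ov" | "\<not> vi" "\<not> od" "\<not> ov" by blast
  then show ?thesis
  proof cases
    case 1
    define h where "h k = (if vi then lpower Var_q k else lpower Var_theta k)" for k
    have h: "own_coeff vi od b k = h k" "cross_coeff vi od b k = 0" for b k
      using 1 by (auto simp: h_def own_coeff_def cross_coeff_def)
    have hh: "h \<sigma> * h (- \<sigma>) = 1" "h (- \<sigma>) * h \<sigma> = 1" by (simp_all add: h_def lpower_inverse)
    show ?thesis
      using bigon_scaling_aux[OF hh(1), of U1 p x U2] bigon_scaling_aux[OF hh(2), of W1 r y W2] assms
      unfolding h by simp
  next
    case 2
    show ?thesis
      by (rule bigon_even_aux[of "lpower Var_s \<sigma>" "lpower Var_s (- \<sigma>)" "lpower Var_t \<sigma>" "lpower Var_t (- \<sigma>)"])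
        (use assms 2 in \<open>simp_all add: own_coeff_def cross_coeff_def lpower_inverse\<close>)
  next
    case 3
    have "(if r then W2 else W1) = y \<and> (if p then U2 else U1) = x"
      by (rule bigon_even_aux[of "lpower Var_s (- \<sigma>)" "lpower Var_s \<sigma>" "lpower Var_t (- \<sigma>)" "lpower Var_t \<sigma>"])
        (use assms 3 in \<open>simp_all add: own_coeff_def cross_coeff_def lpower_inverse\<close>)
    then show ?thesis by simp
  qed
qed

text \<open>
  The strands are layered: a relation involves another strand only if that strand has a smaller
  level.
\<close>

lemma gated_unit:
  fixes a b :: "real \<Rightarrow> 'r::idom" and level :: "real \<Rightarrow> nat"
  assumes g: "gated J L d e P" and fin: "finite L"
    and L_in: "\<And>l. l \<in> L \<Longrightarrow> \<exists>j\<in>J. fst j < l \<and> l < snd j"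
    and const: "\<And>j l k. j \<in> J \<Longrightarrow> l \<in> L \<Longrightarrow> k \<in> L \<Longrightarrow> fst j < l \<Longrightarrow> l < snd j \<Longrightarrow> fst j < k \<Longrightarrow> k < snd j
      \<Longrightarrow> level l = level k"
    and lev: "\<And>l. l \<in> L \<Longrightarrow> b l \<noteq> 0 \<Longrightarrow> m l \<in> L \<and> level (m l) < level l"
  shows "set_det L (relation_matrix a b m P) dvd 1"
proof -
  have pred: "cyc_pred P l < l \<and> level (cyc_pred P l) = level l" if l: "l \<in> L" "cyc_pred P l \<in> L" for l
  proof -
    obtain j where j: "j \<in> J" "fst j < l" "l < snd j" using L_in[OF l(1)] by blast
    define X where "X = {k \<in> L. fst j < k \<and> k < l}"
    define p where "p = Max (insert (d j) X)"
    have dj: "d j \<notin> L" "fst j < d j" "d j < l"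
      using g j l(1) unfolding gated_def by auto
    have finX: "finite (insert (d j) X)" using fin by (simp add: X_def)
    have pX: "p \<in> insert (d j) X" unfolding p_def using finX by (intro Max_in) auto
    have pmax: "k \<le> p" if "k \<in> insert (d j) X" for k unfolding p_def using finX that by (rule Max_ge)
    have p: "p \<in> insert (d j) L" "fst j < p" "p < l" using pX dj by (auto simp: X_def)
    have gap: "\<forall>k\<in>L. k \<le> p \<or> l \<le> k"
    proof
      fix k assume k: "k \<in> L"
      show "k \<le> p \<or> l \<le> k"
      proof (cases "fst j < k \<and> k < l")
        case True
        then show ?thesis using pmax[of k] k by (simp add: X_def)
      qed (use p in auto)
    qed
    have "cyc_pred P l = p"
      using g[unfolded gated_def, rule_format, OF j(1)] p gap l(1) j(3) by blast
    then have "p \<in> X" using l(2) pX dj by auto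
    then show ?thesis
      using \<open>cyc_pred P l = p\<close> const[OF j(1), of p l] l(1) j p by (auto simp: X_def)
  qed
  \<comment> \<open>Within a level, an unknown depends on an earlier one, so its position decides.\<close>
  define rank where "rank l = level l * (card L + 1) + card {k \<in> L. k < l}" for l
  have small: "card {k \<in> L. k < l} < card L + 1" for l
    using card_mono[OF fin, of "{k \<in> L. k < l}"] by auto
  have mono: "rank k < rank l" if "level k < level l" for k l
  proof -
    have "rank k < Suc (level k) * (card L + 1)" using small[of k] by (simp add: rank_def)
    also have "\<dots> \<le> level l * (card L + 1)" using that by (intro mult_le_mono) auto
    finally show ?thesis by (simp add: rank_def)
  qed
  show ?thesis
  proof (rule relation_matrix_triangular_unit[OF fin, where rank = rank])
    fix l assume l: "l \<in> L"
    show "rank (cyc_pred P l) < rank l" if pl: "cyc_pred P l \<in> L"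
    proof -
      have "{k \<in> L. k < cyc_pred P l} \<subset> {k \<in> L. k < l}" using pred[OF l pl] pl by auto
      then have "card {k \<in> L. k < cyc_pred P l} < card {k \<in> L. k < l}"
        using fin by (intro psubset_card_mono) auto
      then show ?thesis using pred[OF l pl] by (simp add: rank_def)
    qed
    show "rank (cyc_pred P (m l)) < rank l" if "b l \<noteq> 0" and pm: "cyc_pred P (m l) \<in> L"
      using lev[OF l that(1)] pred[OF _ pm] by (intro mono) simp
  qed
qed

lemma meets_inside:
  assumes "agree_off c J D D'" "meets D t t'" "t \<in> inside J"
  shows "t' \<in> inside J"
  using outer_meets_outer[OF assms(1) _ meets_sym[OF assms(2)]] assms(3) by blast

text \<open>
  Consecutive classical passages have counts of different parity.
\<close>

lemma classical_count_next:
  assumes "vknot_diagram D" "c \<le> p" "p < q" "classical D p" "\<And>x. classical D x \<Longrightarrow> p < x \<Longrightarrow> x < q \<Longrightarrow> False"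
  shows "classical_count D c q = Suc (classical_count D c p)"
proof -
  have "x = p" if "classical D x" "p \<le> x" "x < q" for x
    using assms(5)[OF that(1)] that by force
  then have "{x. classical D x \<and> p \<le> x \<and> x < q} = {p}" using assms(3,4) by blast
  then have "classical_count D p q = 1" by (simp add: classical_count_def)
  then show ?thesis using classical_count_add[OF assms(1,2), of q] assms(3) by simp
qed

lemma gatedD:
  assumes "gated J L d e P" "j \<in> J"
  shows "d j \<notin> L" "e j \<notin> L" "fst j < d j" "d j < e j" "e j < snd j"
    "\<And>l. l \<in> L \<Longrightarrow> fst j < l \<Longrightarrow> l < snd j \<Longrightarrow> d j < l \<and> l < e j"
    "\<And>t p. p \<in> insert (d j) L \<Longrightarrow> t \<in> insert (e j) L \<Longrightarrow> fst j < p \<Longrightarrow> p < t \<Longrightarrow> t < snd j \<Longrightarrow>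
       (\<And>l. l \<in> L \<Longrightarrow> fst j < l \<Longrightarrow> l < snd j \<Longrightarrow> l \<le> p \<or> t \<le> l) \<Longrightarrow> cyc_pred P t = p"
proof -
  note g = assms(1)[unfolded gated_def, rule_format, OF assms(2)]
  show "d j \<notin> L" "e j \<notin> L" "fst j < d j" "d j < e j" "e j < snd j" using g by simp_all
  show "d j < l \<and> l < e j" if "l \<in> L" "fst j < l" "l < snd j" for l using g that by simp
  show "cyc_pred P t = p" if h: "p \<in> insert (d j) L" "t \<in> insert (e j) L" "fst j < p" "p < t" "t < snd j"
    "\<And>l. l \<in> L \<Longrightarrow> fst j < l \<Longrightarrow> l < snd j \<Longrightarrow> l \<le> p \<or> t \<le> l" for t p
  proof -
    have "\<forall>l\<in>L. l \<le> p \<or> t \<le> l"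
    proof
      fix l assume "l \<in> L"
      then show "l \<le> p \<or> t \<le> l" using h(6)[of l] h(3,5) by (cases "fst j < l \<and> l < snd j") auto
    qed
    then show ?thesis
      using g[THEN conjunct2, THEN conjunct2, THEN conjunct1, rule_format] h(1-5) by blast
  qed
qed

lemma gated_two:
  assumes "gated J L d e P" "j \<in> J" "x \<in> L" "y \<in> L" "x \<noteq> y"
    "fst j < x" "x < snd j" "fst j < y" "y < snd j"
    and only: "\<And>l. l \<in> L \<Longrightarrow> fst j < l \<Longrightarrow> l < snd j \<Longrightarrow> l = x \<or> l = y"
  shows "cyc_pred P x = (if x < y then d j else y)" "cyc_pred P (e j) = (if x < y then y else x)"
proof -
  note g = gatedD[OF assms(1,2)]
  have b: "d j < x" "x < e j" "d j < y" "y < e j" using g(6) assms by blast+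
  show "cyc_pred P x = (if x < y then d j else y)"
  proof (cases "x < y")
    case True
    have "cyc_pred P x = d j"
      by (rule g(7)) (use assms b g(3) True in \<open>auto dest!: only\<close>)
    then show ?thesis using True by simp
  next
    case False
    have "cyc_pred P x = y"
      by (rule g(7)) (use assms b False in \<open>auto dest!: only\<close>)
    then show ?thesis using False by simp
  qed
  show "cyc_pred P (e j) = (if x < y then y else x)"
    by (rule g(7)) (use assms b g(5) in \<open>auto dest!: only\<close>)
qed

lemma gated_none:
  assumes "gated J L d e P" "j \<in> J" "\<And>l. l \<in> L \<Longrightarrow> fst j < l \<Longrightarrow> l < snd j \<Longrightarrow> False"
  shows "cyc_pred P (e j) = d j"
  by (rule gatedD(7)[OF assms(1,2)]) (use gatedD(3-5)[OF assms(1,2)] assms(3) in auto)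

section \<open>The first Reidemeister move\<close>

lemma agree_outside_disc_agree_off:
  assumes vk: "vknot_diagram D" "vknot_diagram D'" and J: "arcs_in c (set I)"
    and agr: "agree_outside_disc I D D'"
  shows "agree_off c (set I) D D'"
proof -
  obtain z r where ball: "\<forall>t. (curve D t \<in> ball z r \<longleftrightarrow> t \<in> inside (set I)) \<and> (curve D' t \<in> ball z r \<longleftrightarrow> t \<in> inside (set I))"
    and out: "\<forall>t. t \<notin> inside (set I) \<longrightarrow> curve D' t = curve D t \<and> over D' t = over D t \<and>
                            (curve D t \<in> virt D' \<longleftrightarrow> curve D t \<in> virt D)"
    using agr unfolding agree_outside_disc_def Let_def inside_def[symmetric] by (elim exE conjE) (rule that)
  have "curve D t \<noteq> curve D t' \<and> curve D' t \<noteq> curve D' t'"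
    if "t \<in> inside (set I)" "t' \<notin> inside (set I)" for t t'
    using ball[rule_format, of t] ball[rule_format, of t'] that by auto
  then show ?thesis unfolding agree_off_def using vk J out by (intro conjI) simp_all
qed

lemma lpower_dvd_1: "lpower x k dvd 1"
  using lpower_inverse(1)[of x k] by (metis dvd_triv_left)

lemma crossing_coefficients:
  assumes vk: "vknot_diagram D" and m: "meets D t t'"
  shows "own D t = own_coeff (curve D t \<in> virt D) (odd_crossing D (curve D t)) (over D t) (strand_sign D t)"
    "cross D t = cross_coeff (curve D t \<in> virt D) (odd_crossing D (curve D t)) (over D t) (strand_sign D t)"
    "own D t' = own_coeff (curve D t \<in> virt D) (odd_crossing D (curve D t)) (over D t') (- strand_sign D t)"
    "cross D t' = cross_coeff (curve D t \<in> virt D) (odd_crossing D (curve D t)) (over D t') (- strand_sign D t)"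
  using meets_crosses[OF m] meets_crosses[OF meets_sym[OF m]] meets_curve[OF m] strand_sign_partner[OF vk m]
  by (simp_all add: own_def cross_def)

text \<open>
  Here x is the incoming semi-arc of a kink, y its loop and z the outgoing semi-arc. If the first
  passage is the lower one, the first equation contains the loop on both sides, and the coefficient that
  remains is a unit.
\<close>

lemma kink_relations:
  fixes x y z :: laurent
  assumes y: "y = own_coeff vi False ov \<sigma> * x + cross_coeff vi False ov \<sigma> * y"
    and z: "z = own_coeff vi False ov' (- \<sigma>) * y + cross_coeff vi False ov' (- \<sigma>) * x"
    and ov: "vi \<or> ov' \<noteq> ov"
  shows "z = x"
proof -
  consider "vi" | "\<not> vi" "ov" "\<not> ov'" | "\<not> vi" "\<not> ov" "ov'" using ov by blast
  then show ?thesis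
  proof cases
    case 1
    have "z = (lpower Var_q (- \<sigma>) * lpower Var_q \<sigma>) * x"
      using y z 1 by (simp add: own_coeff_def cross_coeff_def mult.assoc)
    then show ?thesis by (simp add: lpower_inverse)
  next
    case 2
    have "z = lpower Var_t \<sigma> * (lpower Var_s \<sigma> * x) + (1 - lpower Var_t \<sigma> * lpower Var_s \<sigma>) * x"
      using y z 2 by (simp add: own_coeff_def cross_coeff_def)
    then show ?thesis by (simp add: algebra_simps)
  next
    case 3
    have "y = lpower Var_t (- \<sigma>) * x + (1 - lpower Var_t (- \<sigma>) * lpower Var_s (- \<sigma>)) * y"
      using y 3 by (simp add: own_coeff_def cross_coeff_def)
    then have "lpower Var_t (- \<sigma>) * (lpower Var_s (- \<sigma>) * y) = lpower Var_t (- \<sigma>) * x"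
      by (simp add: algebra_simps)
    moreover have "z = lpower Var_s (- \<sigma>) * y" using z 3 by (simp add: own_coeff_def cross_coeff_def)
    ultimately show ?thesis by simp
  qed
qed

lemma alexander_reidemeister1:
  assumes vk: "vknot_diagram D" "vknot_diagram D'" and r1: "reidemeister1 D D'"
  shows "alexander D dvd alexander D' \<and> alexander D' dvd alexander D"
proof -
  from r1 obtain a b u v where agr: "agree_outside_disc [(a, b)] D D'"
    and inj: "inj_on (curve D) {a<..<b}"
    and uv: "\<forall>x y. a < x \<and> x < y \<and> y < b \<longrightarrow> (curve D' x = curve D' y \<longleftrightarrow> x = u \<and> y = v)"
    and ord: "a < u" "u < v" "v < b"
    unfolding reidemeister1_def by (elim exE conjE) (rule that)
  define J where "J = {(a, b)}"
  have "arcs_in a J" using agr ord by (simp add: agree_outside_disc_def Let_def arcs_in_def J_def)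
  then have ag: "agree_off a J D D'"
    using agree_outside_disc_agree_off[OF vk _ agr, of a] by (simp add: J_def)
  note agD = agree_offD[OF ag]
  note in_w = inside_window[OF agD(3)]
  have ab: "a < b" "b < a + 1" using arcs_inD(3)[OF agD(3), of "(a, b)"] by (simp_all add: J_def)
  have in_ab: "t \<in> inside J \<longleftrightarrow> a < t \<and> t < b" if "t \<in> {a..<a + 1}" for t using in_w[OF that] by (simp add: J_def)
  have L: "window D a \<inter> inside J = {}"
  proof (rule ccontr)
    assume "window D a \<inter> inside J \<noteq> {}"
    then obtain t where t: "t \<in> {a..<a + 1}" "crosses D t" "t \<in> inside J" by (auto simp: window_def)
    note p = partner[OF vk(1) t(2), of a]
    have "partner D a t \<in> inside J"
      using outer_meets_outer[OF ag _ meets_sym[OF p(2)]] t(3) by blast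
    then have "curve D t = curve D (partner D a t)" "t \<in> {a<..<b}" "partner D a t \<in> {a<..<b}"
      using in_ab[OF t(1)] in_ab[OF p(1)] t(3) meets_curve[OF p(2)] by auto
    then have "t = partner D a t" using inj by (auto dest: inj_onD)
    then show False using p(2) by (auto simp: meets_def)
  qed
  have w: "u \<in> {a..<a + 1}" "v \<in> {a..<a + 1}" using ord ab by auto
  have cuv: "curve D' u = curve D' v" using uv ord by auto
  have m: "meets D' u v" by (rule same_window_meets[OF vk(2) w]) (use ord cuv in auto)
  have pu: "partner D' a u = v" "partner D' a v = u"
    using partner_eq[OF vk(2) m w(2)] partner_eq[OF vk(2) meets_sym[OF m] w(1)] by simp_all
  have only: "t = u \<or> t = v" if t: "t \<in> {a..<a + 1}" "crosses D' t" "t \<in> inside J" for t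
  proof -
    note p = partner[OF vk(2) t(2), of a]
    have "partner D' a t \<in> inside J"
      using outer_meets_outer[OF agree_off_sym[OF ag] _ meets_sym[OF p(2)]] t(3) by blast
    then have "a < t" "t < b" "a < partner D' a t" "partner D' a t < b" "t \<noteq> partner D' a t"
      using in_ab[OF t(1)] in_ab[OF p(1)] t(3) p(2) by (auto simp: meets_def)
    then show ?thesis
      using uv[rule_format, of t "partner D' a t"] uv[rule_format, of "partner D' a t" t] meets_curve[OF p(2)]
      by (cases "t < partner D' a t") auto
  qed
  have L': "window D' a \<inter> inside J = {u, v}"
  proof (intro equalityI subsetI)
    fix t assume "t \<in> window D' a \<inter> inside J"
    then show "t \<in> {u, v}" using only[of t] by (simp add: window_def)
  next
    fix t assume "t \<in> {u, v}"
    then show "t \<in> window D' a \<inter> inside J"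
      using w ord in_ab[of t] meets_crosses[OF m] meets_crosses[OF meets_sym[OF m]] by (auto simp: window_def)
  qed
  have arcs: "{x. classical D x \<and> a < x \<and> x < b} = {}"
  proof -
    have False if x: "classical D x" "a < x" "x < b" for x
    proof -
      have "x \<in> {a..<a + 1}" using x ab by simp
      then have "x \<in> window D a \<inter> inside J" using in_ab[of x] x by (simp add: window_def classical_def)
      then show False using L by simp
    qed
    then show ?thesis by blast
  qed
  have arcs': "{x. classical D' x \<and> a < x \<and> x < b} = (if curve D' u \<in> virt D' then {} else {u, v})"
  proof -
    have "x = u \<or> x = v" if "classical D' x" "a < x" "x < b" for x
      using only[of x] in_ab[of x] that ab by (auto simp: classical_def)
    moreover have "classical D' u \<longleftrightarrow> curve D' u \<notin> virt D'" "classical D' v \<longleftrightarrow> curve D' u \<notin> virt D'"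
      using cuv meets_crosses[OF m] meets_crosses[OF meets_sym[OF m]] by (simp_all add: classical_def)
    ultimately have "x \<in> {x. classical D' x \<and> a < x \<and> x < b} \<longleftrightarrow> (x = u \<or> x = v) \<and> curve D' u \<notin> virt D'" for x
      using ord by auto
    then show ?thesis by auto
  qed
  have even': "\<not> odd_crossing D' (curve D' u)" if nv: "curve D' u \<notin> virt D'"
  proof -
    have "classical_count D' a v = classical_count D' a u + classical_count D' u v"
      using ord by (intro classical_count_add[OF vk(2)]) auto
    also have "classical_count D' u v = 1"
    proof -
      have "{x. classical D' x \<and> u \<le> x \<and> x < v} = {u}"
      proof -
        have "x = u" if x: "classical D' x" "u \<le> x" "x < v" for x
        proof -
          have "x \<in> {x. classical D' x \<and> a < x \<and> x < b}" using x ord by simp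
          then have "x \<in> {u, v}" unfolding arcs' using nv by simp
          then show ?thesis using x by simp
        qed
        moreover have "classical D' u" using nv meets_crosses[OF m] by (simp add: classical_def)
        ultimately show ?thesis using ord by blast
      qed
      then show ?thesis by (simp add: classical_count_def)
    qed
    finally show ?thesis using odd_crossing_iff[OF vk(2) m w nv] by simp
  qed
  note co = crossing_coefficients[OF vk(2) m]
  let ?vi = "curve D' u \<in> virt D'" let ?\<sigma> = "strand_sign D' u"
  have co': "own D' u = own_coeff ?vi False (over D' u) ?\<sigma>" "cross D' u = cross_coeff ?vi False (over D' u) ?\<sigma>"
    "own D' v = own_coeff ?vi False (over D' v) (- ?\<sigma>)" "cross D' v = cross_coeff ?vi False (over D' v) (- ?\<sigma>)"
    using co even' by (cases ?vi; simp add: own_coeff_def cross_coeff_def)+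
  have over: "?vi \<or> over D' v \<noteq> over D' u" using meets_over[OF vk(2) m] by blast
  have preds: "cyc_pred P u = d (a, b)" "cyc_pred P v = u" "cyc_pred P (e (a, b)) = v"
    "d (a, b) \<noteq> u" "d (a, b) \<noteq> v" if g: "gated J {u, v} d e P" for d e P
  proof -
    have j: "(a, b) \<in> J" by (simp add: J_def)
    note g1 = gated_two[OF g j, simplified]
    show "cyc_pred P u = d (a, b)" "cyc_pred P (e (a, b)) = v" using g1[of u v] ord by auto
    show "cyc_pred P v = u" using g1(1)[of v u] ord by auto
    show "d (a, b) \<noteq> u" "d (a, b) \<noteq> v" using gatedD(1)[OF g j] by auto
  qed
  show ?thesis
  proof (rule disc_move[OF ag _ refl refl])
    fix p assume "p \<in> J"
    then have p: "p = (a, b)" by (simp add: J_def)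
    show "even (card {u. classical D u \<and> fst p < u \<and> u < snd p} + card {u. classical D' u \<and> fst p < u \<and> u < snd p})"
      unfolding p fst_conv snd_conv arcs arcs' using ord by simp
  next
    fix P d e
    show "set_det (window D a \<inter> inside J) (relation_matrix (own D) (cross D) (partner D a) P) dvd 1"
      unfolding L by (simp add: set_det_def list_det_def)
  next
    fix P d e assume g: "gated J (window D' a \<inter> inside J) d e P"
    note pr = preds[OF g[unfolded L']]
    let ?F = "relation_matrix (own D') (cross D') (partner D' a) P"
    have F: "?F u u = 1 - cross D' u" "?F u v = 0" "?F v v = 1"
      using pr ord pu by (auto simp: relation_matrix_def)
    have "set_det {u, v} ?F = (\<Prod>l\<in>{u, v}. ?F l l)"
      by (rule set_det_triangular[where rank = "\<lambda>l. if l = u then 0 else 1"]) (use F(2) ord in auto)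
    also have "\<dots> = 1 - cross D' u" using F ord by simp
    also have "\<dots> dvd 1"
      using mult_dvd_mono[OF lpower_dvd_1[of Var_t "- ?\<sigma>"] lpower_dvd_1[of Var_s "- ?\<sigma>"]]
      unfolding co'(2) cross_coeff_def by (simp only: if_splits split: if_split) simp
    finally show "set_det (window D' a \<inter> inside J) ?F dvd 1" unfolding L' .
  next
    fix P P' d e V V' j
    assume g: "gated J (window D a \<inter> inside J) d e P" and g': "gated J (window D' a \<inter> inside J) d e P'"
      and dd: "\<And>j. j \<in> J \<Longrightarrow> V (d j) = V' (d j)"
      and V': "\<And>l. l \<in> window D' a \<inter> inside J \<Longrightarrow> V' l = own D' l * V' (cyc_pred P' l) + cross D' l * V' (cyc_pred P' (partner D' a l))"
      and j: "j \<in> J"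
    note pr = preds[OF g'[unfolded L']]
    have jj: "j = (a, b)" using j by (simp add: J_def)
    have "cyc_pred P (e j) = d j" by (rule gated_none[OF g j]) (simp add: L)
    moreover have "V' v = V' (d (a, b))"
      by (rule kink_relations[of "V' u" ?vi "over D' u" ?\<sigma>])
        (use V'[of u] V'[of v] pr pu co' over in \<open>simp_all add: L'\<close>)
    ultimately show "V (cyc_pred P (e j)) = V' (cyc_pred P' (e j))" using dd[OF j] pr by (simp add: jj)
  qed
qed

section \<open>The second Reidemeister move\<close>

lemma crossing_coefficients_cong:
  assumes vk: "vknot_diagram D" and m: "meets D t t'"
    and vi: "curve D t \<in> virt D \<longleftrightarrow> vi" and od: "\<not> vi \<Longrightarrow> odd_crossing D (curve D t) = od"
    and sg: "strand_sign D t = \<sigma>" and ov: "\<not> vi \<Longrightarrow> over D t = ov"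
  shows "own D t = own_coeff vi od ov \<sigma>" "cross D t = cross_coeff vi od ov \<sigma>"
    "own D t' = own_coeff vi od (\<not> ov) (- \<sigma>)" "cross D t' = cross_coeff vi od (\<not> ov) (- \<sigma>)"
  unfolding crossing_coefficients[OF vk m] vi sg
  using od ov meets_over[OF vk m] vi by (cases vi; simp add: own_coeff_def cross_coeff_def)+

lemma two_classical_passages:
  assumes vk: "vknot_diagram D" and lo: "c \<le> lo"
    and cl: "{x. classical D x \<and> lo < x \<and> x < hi} = {p, q}" and pq: "p \<noteq> q"
  shows "even (classical_count D c p) \<longleftrightarrow> odd (classical_count D c q)"
proof -
  have iff: "classical D x \<and> lo < x \<and> x < hi \<longleftrightarrow> x = p \<or> x = q" for x
    using cl by (metis (mono_tags, lifting) insert_iff mem_Collect_eq singleton_iff)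
  note ip = iff[of p, simplified] and iq = iff[of q, simplified]
  have mid: False if "classical D x" "p < x \<and> x < q \<or> q < x \<and> x < p" for x
    using iff[of x] ip iq that by auto
  show ?thesis
  proof (cases "p < q")
    case True
    have "classical_count D c q = Suc (classical_count D c p)"
      by (rule classical_count_next[OF vk _ True]) (use mid ip lo in auto)
    then show ?thesis by simp
  next
    case False
    then have "q < p" using pq by simp
    have "classical_count D c p = Suc (classical_count D c q)"
      by (rule classical_count_next[OF vk _ \<open>q < p\<close>]) (use mid iq lo in auto)
    then show ?thesis by simp
  qed
qed

lemma alexander_reidemeister2:
  assumes vk: "vknot_diagram D" "vknot_diagram D'" and r2: "reidemeister2 D D'"
  shows "alexander D dvd alexander D' \<and> alexander D' dvd alexander D"
proof -
  from r2 obtain a b c d\<^sub>0 u1 u2 w1 w2 where agr: "agree_outside_disc [(a, b), (c, d\<^sub>0)] D D'"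
    and inj: "inj_on (curve D) ({a<..<b} \<union> {c<..<d\<^sub>0})"
    and inj1: "inj_on (curve D') {a<..<b}" and inj2: "inj_on (curve D') {c<..<d\<^sub>0}"
    and mem: "u1 \<in> {a<..<b}" "u2 \<in> {a<..<b}" "u1 \<noteq> u2" "w1 \<in> {c<..<d\<^sub>0}" "w2 \<in> {c<..<d\<^sub>0}"
    and eq: "\<forall>x\<in>{a<..<b}. \<forall>y\<in>{c<..<d\<^sub>0}. curve D' x = curve D' y \<longleftrightarrow> (x = u1 \<and> y = w1) \<or> (x = u2 \<and> y = w2)"
    and turn: "turn D' u1 w1 * turn D' u2 w2 < 0"
    and dec: "(curve D' u1 \<in> virt D' \<and> curve D' u2 \<in> virt D') \<or>
         (curve D' u1 \<notin> virt D' \<and> curve D' u2 \<notin> virt D' \<and> over D' u1 = over D' u2)"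
    unfolding reidemeister2_def by (elim exE conjE) (rule that)
  define J where "J = {(a, b), (c, d\<^sub>0)}"
  have ord: "a < b" "b < c" "c < d\<^sub>0" "d\<^sub>0 < a + 1"
    using agr by (simp_all add: agree_outside_disc_def Let_def)
  have "arcs_in a J" using ord by (simp add: arcs_in_def J_def)
  then have ag: "agree_off a J D D'"
    using agree_outside_disc_agree_off[OF vk _ agr, of a] by (simp add: J_def)
  note agD = agree_offD[OF ag]
  have in_ab: "t \<in> inside J \<longleftrightarrow> t \<in> {a<..<b} \<or> t \<in> {c<..<d\<^sub>0}" if "t \<in> {a..<a + 1}" for t
    using inside_window[OF agD(3) that] by (simp add: J_def)
  have J: "(a, b) \<in> J" "(c, d\<^sub>0) \<in> J" by (simp_all add: J_def)
  have L: "window D a \<inter> inside J = {}"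
  proof (rule ccontr)
    assume "window D a \<inter> inside J \<noteq> {}"
    then obtain t where t: "t \<in> {a..<a + 1}" "crosses D t" "t \<in> inside J" by (auto simp: window_def)
    note p = partner[OF vk(1) t(2), of a]
    have "partner D a t \<in> inside J" by (rule meets_inside[OF ag p(2) t(3)])
    then have "t \<in> {a<..<b} \<union> {c<..<d\<^sub>0}" "partner D a t \<in> {a<..<b} \<union> {c<..<d\<^sub>0}"
      using in_ab[OF t(1)] in_ab[OF p(1)] t(3) by simp_all
    from inj_onD[OF inj meets_curve[OF p(2), symmetric] this] show False using p(2) by (simp add: meets_def)
  qed
  have w: "u1 \<in> {a..<a + 1}" "u2 \<in> {a..<a + 1}" "w1 \<in> {a..<a + 1}" "w2 \<in> {a..<a + 1}"
    and uw: "u1 < w1" "u2 < w2" using mem ord by auto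
  have c1: "curve D' u1 = curve D' w1" and c2: "curve D' u2 = curve D' w2"
    using eq[rule_format, OF mem(1,4)] eq[rule_format, OF mem(2,5)] by simp_all
  have m1: "meets D' u1 w1" by (rule same_window_meets[OF vk(2) w(1,3)]) (use uw c1 in simp_all)
  have m2: "meets D' u2 w2" by (rule same_window_meets[OF vk(2) w(2,4)]) (use uw c2 in simp_all)
  have ww: "w1 \<noteq> w2"
  proof
    assume "w1 = w2"
    then have "curve D' u1 = curve D' u2" using c1 c2 by simp
    then show False using inj_onD[OF inj1] mem(1-3) by blast
  qed
  have par: "partner D' a u1 = w1" "partner D' a w1 = u1" "partner D' a u2 = w2" "partner D' a w2 = u2"
    using partner_eq[OF vk(2) m1 w(3)] partner_eq[OF vk(2) meets_sym[OF m1] w(1)]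
      partner_eq[OF vk(2) m2 w(4)] partner_eq[OF vk(2) meets_sym[OF m2] w(2)] by simp_all
  have only: "t \<in> {u1, u2, w1, w2}" if t: "t \<in> {a..<a + 1}" "crosses D' t" "t \<in> inside J" for t
  proof -
    note p = partner[OF vk(2) t(2), of a]
    let ?t = "partner D' a t"
    have "?t \<in> inside J" by (rule meets_inside[OF agree_off_sym[OF ag] p(2) t(3)])
    then have i: "t \<in> {a<..<b} \<or> t \<in> {c<..<d\<^sub>0}" "?t \<in> {a<..<b} \<or> ?t \<in> {c<..<d\<^sub>0}"
      using in_ab[OF t(1)] in_ab[OF p(1)] t(3) by simp_all
    have cu: "curve D' t = curve D' ?t" and ne: "t \<noteq> ?t" using p(2) by (auto simp: meets_def)
    consider "t \<in> {a<..<b}" "?t \<in> {a<..<b}" | "t \<in> {c<..<d\<^sub>0}" "?t \<in> {c<..<d\<^sub>0}"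
      | "t \<in> {a<..<b}" "?t \<in> {c<..<d\<^sub>0}" | "?t \<in> {a<..<b}" "t \<in> {c<..<d\<^sub>0}" using i by blast
    then show ?thesis
    proof cases
      case 1
      from inj_onD[OF inj1 cu 1] ne show ?thesis by simp
    next
      case 2
      from inj_onD[OF inj2 cu 2] ne show ?thesis by simp
    next
      case 3
      from eq[rule_format, OF 3] cu show ?thesis by auto
    next
      case 4
      from eq[rule_format, OF 4] cu show ?thesis by auto
    qed
  qed
  have cr: "crosses D' u1" "crosses D' u2" "crosses D' w1" "crosses D' w2"
    using meets_crosses[OF m1] meets_crosses[OF m2] meets_crosses[OF meets_sym[OF m1]] meets_crosses[OF meets_sym[OF m2]]
    by simp_all
  have L': "window D' a \<inter> inside J = {u1, u2, w1, w2}"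
  proof (intro equalityI subsetI)
    fix t assume "t \<in> window D' a \<inter> inside J"
    then show "t \<in> {u1, u2, w1, w2}" using only[of t] by (simp add: window_def)
  next
    fix t assume t: "t \<in> {u1, u2, w1, w2}"
    then have "t \<in> {a..<a + 1}" "crosses D' t" "t \<in> {a<..<b} \<or> t \<in> {c<..<d\<^sub>0}" using w cr mem by auto
    then show "t \<in> window D' a \<inter> inside J" using in_ab by (simp add: window_def)
  qed
  define vi where "vi = (curve D' u1 \<in> virt D')"
  have vi2: "curve D' u2 \<in> virt D' \<longleftrightarrow> vi" using dec by (auto simp: vi_def)
  have cl: "classical D' t \<longleftrightarrow> \<not> vi" if "t \<in> {u1, u2, w1, w2}" for t
    using that cr c1 c2 vi2 vi_def by (auto simp: classical_def)
  have cl_only: "t \<in> {u1, u2, w1, w2}" if "classical D' t" "t \<in> {a<..<b} \<or> t \<in> {c<..<d\<^sub>0}" for t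
  proof -
    have "t \<in> {a..<a + 1}" using that(2) ord by auto
    then show ?thesis using only[of t] in_ab[of t] that by (simp add: classical_def)
  qed
  have arcs: "{x. classical D x \<and> fst p < x \<and> x < snd p} = {}" if p: "p \<in> J" for p
  proof -
    have False if x: "classical D x" "fst p < x" "x < snd p" for x
    proof -
      have "x \<in> {a..<a + 1}" "x \<in> {a<..<b} \<or> x \<in> {c<..<d\<^sub>0}" using x ord p by (auto simp: J_def)
      then have "x \<in> window D a \<inter> inside J" using in_ab[of x] x by (simp add: window_def classical_def)
      then show False using L by simp
    qed
    then show ?thesis by blast
  qed
  have arcs1: "{x. classical D' x \<and> a < x \<and> x < b} = (if vi then {} else {u1, u2})"
  proof -
    have "x \<in> {x. classical D' x \<and> a < x \<and> x < b} \<longleftrightarrow> x \<in> {u1, u2} \<and> \<not> vi" for x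
      using cl_only[of x] cl[of x] mem ord by auto
    then show ?thesis by auto
  qed
  have arcs2: "{x. classical D' x \<and> c < x \<and> x < d\<^sub>0} = (if vi then {} else {w1, w2})"
  proof -
    have "x \<in> {x. classical D' x \<and> c < x \<and> x < d\<^sub>0} \<longleftrightarrow> x \<in> {w1, w2} \<and> \<not> vi" for x
      using cl_only[of x] cl[of x] mem ord by auto
    then show ?thesis by auto
  qed
  define od where "od = odd_crossing D' (curve D' u1)"
  have od2: "odd_crossing D' (curve D' u2) \<longleftrightarrow> od" if nv: "\<not> vi"
  proof -
    have alt: "even (classical_count D' a u1) \<longleftrightarrow> odd (classical_count D' a u2)"
      by (rule two_classical_passages[OF vk(2) _ _ mem(3)]) (use arcs1 nv in auto)
    have alt': "even (classical_count D' a w1) \<longleftrightarrow> odd (classical_count D' a w2)"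
      by (rule two_classical_passages[OF vk(2) _ _ ww]) (use arcs2 nv ord in auto)
    have "curve D' u1 \<notin> virt D'" "curve D' u2 \<notin> virt D'" using nv vi2 by (simp_all add: vi_def)
    then show ?thesis
      unfolding od_def
      using odd_crossing_iff[OF vk(2) m1 w(1,3)] odd_crossing_iff[OF vk(2) m2 w(2,4)]
        alt alt' by (simp add: even_add)
  qed
  define ov where "ov = over D' u1"
  define \<sigma> where "\<sigma> = strand_sign D' u1"
  have \<sigma>2: "strand_sign D' u2 = - \<sigma>"
    using turn strand_sign_eq[OF vk(2) m1] strand_sign_eq[OF vk(2) m2] by (auto simp: \<sigma>_def mult_less_0_iff)
  have over: "\<not> vi \<Longrightarrow> over D' u2 = ov" using dec by (auto simp: vi_def ov_def)
  note c1 = crossing_coefficients_cong[OF vk(2) m1, of vi od \<sigma> ov]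
    and c2 = crossing_coefficients_cong[OF vk(2) m2 vi2 od2 \<sigma>2 over]
  have co: "own D' u1 = own_coeff vi od ov \<sigma>" "cross D' u1 = cross_coeff vi od ov \<sigma>"
    "own D' w1 = own_coeff vi od (\<not> ov) (- \<sigma>)" "cross D' w1 = cross_coeff vi od (\<not> ov) (- \<sigma>)"
    by (rule c1; simp add: vi_def od_def \<sigma>_def ov_def)+
  have co2: "own D' u2 = own_coeff vi od ov (- \<sigma>)" "cross D' u2 = cross_coeff vi od ov (- \<sigma>)"
    "own D' w2 = own_coeff vi od (\<not> ov) \<sigma>" "cross D' w2 = cross_coeff vi od (\<not> ov) \<sigma>"
    using c2 by simp_all
  have ulist: "l = u1 \<or> l = u2" if "l \<in> {u1, u2, w1, w2}" "fst (a, b) < l" "l < snd (a, b)" for l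
    using that mem ord by auto
  have wlist: "l = w1 \<or> l = w2" if "l \<in> {u1, u2, w1, w2}" "fst (c, d\<^sub>0) < l" "l < snd (c, d\<^sub>0)" for l
    using that mem ord by auto
  have preds: "cyc_pred P u1 = (if u1 < u2 then d (a, b) else u2)" "cyc_pred P u2 = (if u1 < u2 then u1 else d (a, b))"
     "cyc_pred P (e (a, b)) = (if u1 < u2 then u2 else u1)"
     "cyc_pred P w1 = (if w1 < w2 then d (c, d\<^sub>0) else w2)" "cyc_pred P w2 = (if w1 < w2 then w1 else d (c, d\<^sub>0))"
     "cyc_pred P (e (c, d\<^sub>0)) = (if w1 < w2 then w2 else w1)"
     if g: "gated J {u1, u2, w1, w2} d e P" for d e P
  proof -
    have mm: "fst (a, b) < u1" "u1 < snd (a, b)" "fst (a, b) < u2" "u2 < snd (a, b)"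
      "fst (c, d\<^sub>0) < w1" "w1 < snd (c, d\<^sub>0)" "fst (c, d\<^sub>0) < w2" "w2 < snd (c, d\<^sub>0)" using mem by simp_all
    have U: "u1 \<in> {u1, u2, w1, w2}" "u2 \<in> {u1, u2, w1, w2}" "w1 \<in> {u1, u2, w1, w2}" "w2 \<in> {u1, u2, w1, w2}" by simp_all
    have ulist': "l = u2 \<or> l = u1" if "l \<in> {u1, u2, w1, w2}" "fst (a, b) < l" "l < snd (a, b)" for l
      using ulist[OF that] by (elim disjE) simp_all
    have wlist': "l = w2 \<or> l = w1" if "l \<in> {u1, u2, w1, w2}" "fst (c, d\<^sub>0) < l" "l < snd (c, d\<^sub>0)" for l
      using wlist[OF that] by (elim disjE) simp_all
    show "cyc_pred P u1 = (if u1 < u2 then d (a, b) else u2)" "cyc_pred P (e (a, b)) = (if u1 < u2 then u2 else u1)"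
      by (rule gated_two[OF g J(1) U(1,2) mem(3) mm(1-4)]; rule ulist; assumption)+
    have "cyc_pred P u2 = (if u2 < u1 then d (a, b) else u1)"
      by (rule gated_two(1)[OF g J(1) U(2,1) mem(3)[symmetric] mm(3,4,1,2)]; rule ulist'; assumption)
    then show "cyc_pred P u2 = (if u1 < u2 then u1 else d (a, b))" using mem(3) by (cases "u1 < u2") simp_all
    show "cyc_pred P w1 = (if w1 < w2 then d (c, d\<^sub>0) else w2)" "cyc_pred P (e (c, d\<^sub>0)) = (if w1 < w2 then w2 else w1)"
      by (rule gated_two[OF g J(2) U(3,4) ww mm(5-8)]; rule wlist; assumption)+
    have "cyc_pred P w2 = (if w2 < w1 then d (c, d\<^sub>0) else w1)"
      by (rule gated_two(1)[OF g J(2) U(4,3) ww[symmetric] mm(7,8,5,6)]; rule wlist'; assumption)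
    then show "cyc_pred P w2 = (if w1 < w2 then w1 else d (c, d\<^sub>0))" using ww by (cases "w1 < w2") simp_all
  qed
  show ?thesis
  proof (rule disc_move[OF ag _ refl refl])
    fix p assume p: "p \<in> J"
    then have "p = (a, b) \<or> p = (c, d\<^sub>0)" by (simp add: J_def)
    then show "even (card {u. classical D u \<and> fst p < u \<and> u < snd p} + card {u. classical D' u \<and> fst p < u \<and> u < snd p})"
      unfolding arcs[OF p] by (elim disjE) (simp_all add: arcs1 arcs2 mem(3) ww)
  next
    fix P d e
    show "set_det (window D a \<inter> inside J) (relation_matrix (own D) (cross D) (partner D a) P) dvd 1"
      unfolding L by (simp add: set_det_def list_det_def)
  next
    fix P d e assume g: "gated J (window D' a \<inter> inside J) d e P"
    show "set_det (window D' a \<inter> inside J) (relation_matrix (own D') (cross D') (partner D' a) P) dvd 1"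
      unfolding L'
    proof (rule gated_unit[OF g[unfolded L'], where level = "\<lambda>l. if (l < b) = ov then 0 else 1"])
      show "\<exists>j\<in>J. fst j < l \<and> l < snd j" if "l \<in> {u1, u2, w1, w2}" for l
        using that mem by (auto simp: J_def)
      show "(if (l < b) = ov then 0 else 1 :: nat) = (if (k < b) = ov then 0 else 1)"
        if "j \<in> J" "fst j < l" "l < snd j" "fst j < k" "k < snd j" for j l k
        using that ord by (auto simp: J_def)
      fix l assume l: "l \<in> {u1, u2, w1, w2}" "cross D' l \<noteq> 0"
      have b: "u1 < b" "u2 < b" "\<not> w1 < b" "\<not> w2 < b" using mem ord by auto
      have z: "cross D' u1 = 0 \<and> cross D' u2 = 0" if ov using that unfolding co co2 by (simp add: cross_coeff_def)
      have z': "cross D' w1 = 0 \<and> cross D' w2 = 0" if "\<not> ov" using that unfolding co co2 by (simp add: cross_coeff_def)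
      have "l = u1 \<or> l = u2 \<or> l = w1 \<or> l = w2" using l(1) by simp
      then show "partner D' a l \<in> {u1, u2, w1, w2} \<and>
         (if (partner D' a l < b) = ov then 0 else 1 :: nat) < (if (l < b) = ov then 0 else 1)"
        using l(2) z z' by (cases ov; elim disjE; simp add: par b)
    qed simp
  next
    fix P P' d e V V' j
    assume g: "gated J (window D a \<inter> inside J) d e P" and g': "gated J (window D' a \<inter> inside J) d e P'"
      and dd: "\<And>j. j \<in> J \<Longrightarrow> V (d j) = V' (d j)"
      and V': "\<And>l. l \<in> window D' a \<inter> inside J \<Longrightarrow> V' l = own D' l * V' (cyc_pred P' l) + cross D' l * V' (cyc_pred P' (partner D' a l))"
      and j: "j \<in> J"
    note pr = preds[OF g'[unfolded L']]
    let ?x = "V' (d (a, b))" let ?y = "V' (d (c, d\<^sub>0))"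
    have "(if u1 < u2 then V' u2 else V' u1) = ?x \<and> (if w1 < w2 then V' w2 else V' w1) = ?y"
    proof (rule bigon_relations)
      show "V' u1 = own_coeff vi od ov \<sigma> * (if u1 < u2 then ?x else V' u2) + cross_coeff vi od ov \<sigma> * (if w1 < w2 then ?y else V' w2)"
        using V'[of u1, unfolded L'] by (simp add: pr par co co2 if_distrib[of V'])
      show "V' u2 = own_coeff vi od ov (- \<sigma>) * (if u1 < u2 then V' u1 else ?x) + cross_coeff vi od ov (- \<sigma>) * (if w1 < w2 then V' w1 else ?y)"
        using V'[of u2, unfolded L'] by (simp add: pr par co co2 if_distrib[of V'])
      show "V' w1 = own_coeff vi od (\<not> ov) (- \<sigma>) * (if w1 < w2 then ?y else V' w2) + cross_coeff vi od (\<not> ov) (- \<sigma>) * (if u1 < u2 then ?x else V' u2)"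
        using V'[of w1, unfolded L'] by (simp add: pr par co co2 if_distrib[of V'])
      show "V' w2 = own_coeff vi od (\<not> ov) \<sigma> * (if w1 < w2 then V' w1 else ?y) + cross_coeff vi od (\<not> ov) \<sigma> * (if u1 < u2 then V' u1 else ?x)"
        using V'[of w2, unfolded L'] by (simp add: pr par co co2 if_distrib[of V'])
    qed
    moreover have "cyc_pred P (e j) = d j" by (rule gated_none[OF g j]) (simp add: L)
    ultimately show "V (cyc_pred P (e j)) = V' (cyc_pred P' (e j))"
      using dd[OF j] pr j by (auto simp: J_def)
  qed
qed

section \<open>The third Reidemeister move\<close>

text \<open>
  The strands are called top, middle and bottom, and TM is the unknown of the passage of the top strand
  through its crossing with the middle one, and so on. The flag fT says that the top strand meets the
  middle strand before the bottom strand; fM says that the middle strand meets the top strand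
  first, and fB that the bottom strand does. After the move, with primed unknowns, all three orders are
  reversed. The relation between orders and signs is the planarity of the triangle. The condition on the
  kinds comes from parity: a strand can be moved across an even crossing only if it treats both strands
  of this crossing alike. All cases are polynomial identities in the variables and their inverses.
\<close>

lemma triangle_relations:
  fixes XT XM XB :: laurent and \<sigma> \<alpha> \<beta> \<gamma> :: int
  assumes \<sigma>: "\<sigma> = 1 \<or> \<sigma> = - 1"
    and \<alpha>: "\<alpha> = (if fT = fM then - \<sigma> else \<sigma>)" and \<beta>: "\<beta> = (if fT = fB then - \<sigma> else \<sigma>)"
    and \<gamma>: "\<gamma> = (if fM = fB then - \<sigma> else \<sigma>)"
    and kinds: "\<not> vTM \<Longrightarrow> \<not> oTM \<Longrightarrow> vTB = vMB \<and> oTB = oMB" "\<not> vMB \<Longrightarrow> \<not> oMB \<Longrightarrow> vTM = vTB \<and> oTM = oTB"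
      "\<not> vTB \<Longrightarrow> \<not> oTB \<Longrightarrow> vTM = vMB \<and> oTM = oMB"
    and V: "TM = own_coeff vTM oTM True \<alpha> * (if fT then XT else TB)"
      "TB = own_coeff vTB oTB True \<beta> * (if fT then TM else XT)"
      "MT = own_coeff vTM oTM False (- \<alpha>) * (if fM then XM else MB) + cross_coeff vTM oTM False (- \<alpha>) * (if fT then XT else TB)"
      "MB = own_coeff vMB oMB True \<gamma> * (if fM then MT else XM)"
      "BT = own_coeff vTB oTB False (- \<beta>) * (if fB then XB else BM) + cross_coeff vTB oTB False (- \<beta>) * (if fT then TM else XT)"
      "BM = own_coeff vMB oMB False (- \<gamma>) * (if fB then BT else XB) + cross_coeff vMB oMB False (- \<gamma>) * (if fM then MT else XM)"
    and V': "TM' = own_coeff vTM oTM True \<alpha> * (if fT then TB' else XT)"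
      "TB' = own_coeff vTB oTB True \<beta> * (if fT then XT else TM')"
      "MT' = own_coeff vTM oTM False (- \<alpha>) * (if fM then MB' else XM) + cross_coeff vTM oTM False (- \<alpha>) * (if fT then TB' else XT)"
      "MB' = own_coeff vMB oMB True \<gamma> * (if fM then XM else MT')"
      "BT' = own_coeff vTB oTB False (- \<beta>) * (if fB then BM' else XB) + cross_coeff vTB oTB False (- \<beta>) * (if fT then XT else TM')"
      "BM' = own_coeff vMB oMB False (- \<gamma>) * (if fB then XB else BT') + cross_coeff vMB oMB False (- \<gamma>) * (if fM then XM else MT')"
  shows "(if fT then TB else TM) = (if fT then TM' else TB') \<and>
    (if fM then MB else MT) = (if fM then MT' else MB') \<and> (if fB then BM else BT) = (if fB then BT' else BM')"
proof -
  define q q' where "q = lpower Var_q 1" and "q' = lpower Var_q (- 1)"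
  define s s' where "s = lpower Var_s 1" and "s' = lpower Var_s (- 1)"
  define t t' where "t = lpower Var_t 1" and "t' = lpower Var_t (- 1)"
  define h h' where "h = lpower Var_theta 1" and "h' = lpower Var_theta (- 1)"
  note abbr = q_def[symmetric] q'_def[symmetric] s_def[symmetric] s'_def[symmetric]
    t_def[symmetric] t'_def[symmetric] h_def[symmetric] h'_def[symmetric]
  have one: "q * q' = 1" "s * s' = 1" "t * t' = 1" "h * h' = 1"
    by (simp_all add: q_def q'_def s_def s'_def t_def t'_def h_def h'_def lpower_mult)
  have one': "q * (q' * z) = z" "s * (s' * z) = z" "t * (t' * z) = z" "h * (h' * z) = z" for z
    by (simp_all add: mult.assoc[symmetric] one)
  have one'': "q' * q = 1" "s' * s = 1" "t' * t = 1" "h' * h = 1"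
    "q' * (q * z) = z" "s' * (s * z) = z" "t' * (t * z) = z" "h' * (h * z) = z" for z
    using one one' by (simp_all add: mult_ac)
  have own_numeral: "own_coeff vi od ov 1 = (if vi then q else if od then h else if ov then s else t')"
    "own_coeff vi od ov (- 1) = (if vi then q' else if od then h' else if ov then s' else t)"
    "cross_coeff vi od ov 1 = (if vi \<or> od \<or> ov then 0 else 1 - t' * s')"
    "cross_coeff vi od ov (- 1) = (if vi \<or> od \<or> ov then 0 else 1 - t * s)" for vi od ov
    by (simp_all add: own_coeff_def cross_coeff_def abbr)
  note rules = \<alpha> \<beta> \<gamma> own_numeral V V' one one' one'' algebra_simps
  \<comment> \<open>Either no crossing is even, or exactly one is and the other two are of the same kind, or all are.\<close>
  consider (none) "vTM \<or> oTM" "vTB \<or> oTB" "vMB \<or> oMB"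
    | (TM) "\<not> vTM" "\<not> oTM" "vTB = vMB" "oTB = oMB" "vMB \<or> oMB"
    | (MB) "\<not> vMB" "\<not> oMB" "vTM = vTB" "oTM = oTB" "vTB \<or> oTB"
    | (TB) "\<not> vTB" "\<not> oTB" "vTM = vMB" "oTM = oMB" "vMB \<or> oMB"
    | (all) "\<not> vTM" "\<not> oTM" "\<not> vTB" "\<not> oTB" "\<not> vMB" "\<not> oMB"
    using kinds by metis
  then show ?thesis
  proof cases
    case none
    have c: "cross_coeff vTM oTM b k = 0" "cross_coeff vTB oTB b k = 0" "cross_coeff vMB oMB b k = 0" for b k
      using none by (auto simp: cross_coeff_def)
    show ?thesis
      by (cases fT; cases fM; cases fB; simp add: V V' c mult_ac)
  next
    case TM
    then show ?thesis
      using \<sigma> by (elim disjE; cases fT; cases fM; cases fB; cases vMB; simp add: rules)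
  next
    case MB
    then show ?thesis
      using \<sigma> by (elim disjE; cases fT; cases fM; cases fB; cases vTB; simp add: rules)
  next
    case TB
    then show ?thesis
      using \<sigma> by (elim disjE; cases fT; cases fM; cases fB; cases vMB; simp add: rules)
  next
    case all
    then show ?thesis
      using \<sigma> by (elim disjE; cases fT; cases fM; cases fB; simp add: rules)
  qed
qed

lemma less_3_cases: "i < (3::nat) \<longleftrightarrow> i = 0 \<or> i = 1 \<or> i = 2"
  by auto

lemma triangle_facts:
  fixes a b :: "nat \<Rightarrow> real" and \<tau> :: "nat \<Rightarrow> nat \<Rightarrow> real"
  assumes vk: "vknot_diagram D" and J: "arcs_in c J" "J = (\<lambda>i. (a i, b i)) ` {..<3}"
    and order: "b 0 < a 1" "b 1 < a 2"
    and closed: "\<forall>t t'. meets D t t' \<longrightarrow> t \<in> inside J \<longrightarrow> t' \<in> inside J"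
    and tri: "triangle D a b \<tau>"
  shows "\<And>i j. i < 3 \<Longrightarrow> j < 3 \<Longrightarrow> i \<noteq> j \<Longrightarrow> a i < \<tau> i j \<and> \<tau> i j < b i"
    "\<And>i j. i < 3 \<Longrightarrow> j < 3 \<Longrightarrow> i \<noteq> j \<Longrightarrow> meets D (\<tau> i j) (\<tau> j i)"
    "\<And>i j. i < 3 \<Longrightarrow> j < 3 \<Longrightarrow> i \<noteq> j \<Longrightarrow> partner D c (\<tau> i j) = \<tau> j i"
    "\<And>i j k. i < 3 \<Longrightarrow> j < 3 \<Longrightarrow> k < 3 \<Longrightarrow> i \<noteq> j \<Longrightarrow> i \<noteq> k \<Longrightarrow> j \<noteq> k \<Longrightarrow> \<tau> i j \<noteq> \<tau> i k"
    "\<And>t. t \<in> window D c \<inter> inside J \<longleftrightarrow> (\<exists>i<3. \<exists>j<3. i \<noteq> j \<and> t = \<tau> i j)"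
proof -
  note closed = closed[rule_format]
  have inj: "inj_on (curve D) {a i<..<b i}" if "i < 3" for i using tri that by (simp add: triangle_def)
  have tau: "\<tau> i j \<in> {a i<..<b i}"
    and eq: "\<And>x y. x \<in> {a i<..<b i} \<Longrightarrow> y \<in> {a j<..<b j} \<Longrightarrow> curve D x = curve D y \<longleftrightarrow> x = \<tau> i j \<and> y = \<tau> j i"
    if "i < 3" "j < 3" "i \<noteq> j" for i j
  proof -
    note t2 = tri[unfolded triangle_def, THEN conjunct2, THEN conjunct1, rule_format, OF that]
    show "\<tau> i j \<in> {a i<..<b i}" by (rule t2[THEN conjunct1])
    show "curve D x = curve D y \<longleftrightarrow> x = \<tau> i j \<and> y = \<tau> j i" if "x \<in> {a i<..<b i}" "y \<in> {a j<..<b j}" for x y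
      by (rule t2[THEN conjunct2, rule_format, OF that])
  qed
  have ab: "c \<le> a i" "a i < b i" "b i < c + 1" if "i < 3" for i
    using arcs_inD(3)[OF J(1), of "(a i, b i)"] that J(2) by auto
  have w: "x \<in> {c..<c + 1}" if "i < 3" "x \<in> {a i<..<b i}" for i x using ab[OF that(1)] that(2) by auto
  have disj: "x \<noteq> y" if "i < 3" "j < 3" "i \<noteq> j" "x \<in> {a i<..<b i}" "y \<in> {a j<..<b j}" for i j x y
  proof -
    have "(i = 0 \<or> i = 1 \<or> i = 2) \<and> (j = 0 \<or> j = 1 \<or> j = 2)" using that(1,2) by (simp only: less_3_cases)
    moreover have "a i < x" "x < b i" "a j < y" "y < b j" using that(4,5) by simp_all
    moreover have "a 1 < b 1" using ab(2)[of 1] by simp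
    ultimately show ?thesis using that(3) order by (elim conjE disjE; simp only: ; linarith)
  qed
  show range: "a i < \<tau> i j \<and> \<tau> i j < b i" if "i < 3" "j < 3" "i \<noteq> j" for i j using tau[OF that] by simp
  show m: "meets D (\<tau> i j) (\<tau> j i)" if h: "i < 3" "j < 3" "i \<noteq> j" for i j
  proof (rule same_window_meets[OF vk, of _ c])
    note t = tau[OF h] tau[OF h(2,1) h(3)[symmetric]]
    show "\<tau> i j \<in> {c..<c + 1}" by (rule w[OF h(1) t(1)])
    show "\<tau> j i \<in> {c..<c + 1}" by (rule w[OF h(2) t(2)])
    show "\<tau> i j \<noteq> \<tau> j i" by (rule disj[OF h t])
    show "curve D (\<tau> i j) = curve D (\<tau> j i)" using eq[OF h t] by simp
  qed
  show par: "partner D c (\<tau> i j) = \<tau> j i" if h: "i < 3" "j < 3" "i \<noteq> j" for i j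
    by (rule partner_eq[OF vk m[OF h] w[OF h(2) tau[OF h(2,1) h(3)[symmetric]]]])
  show "\<tau> i j \<noteq> \<tau> i k" if h: "i < 3" "j < 3" "k < 3" "i \<noteq> j" "i \<noteq> k" "j \<noteq> k" for i j k
  proof
    assume e: "\<tau> i j = \<tau> i k"
    have "\<tau> j i = \<tau> k i" using par[of i j] par[of i k] h e by simp
    moreover have "\<tau> j i \<noteq> \<tau> k i" by (rule disj[of j k]) (use h tau[of j i] tau[of k i] in auto)
    ultimately show False by simp
  qed
  have in_J: "t \<in> inside J \<longleftrightarrow> (\<exists>i<3. t \<in> {a i<..<b i})" if "t \<in> {c..<c + 1}" for t
    unfolding inside_window[OF J(1) that] unfolding J(2) by auto
  show "t \<in> window D c \<inter> inside J \<longleftrightarrow> (\<exists>i<3. \<exists>j<3. i \<noteq> j \<and> t = \<tau> i j)" for t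
  proof
    assume "t \<in> window D c \<inter> inside J"
    then have t: "t \<in> {c..<c + 1}" "crosses D t" "t \<in> inside J" by (simp_all add: window_def)
    note p = partner[OF vk t(2), of c]
    obtain i where i: "i < 3" "t \<in> {a i<..<b i}" using in_J[OF t(1)] t(3) by blast
    obtain j where j: "j < 3" "partner D c t \<in> {a j<..<b j}" using in_J[OF p(1)] closed[OF p(2) t(3)] by blast
    have cu: "curve D t = curve D (partner D c t)" and ne: "t \<noteq> partner D c t" using p(2) by (auto simp: meets_def)
    have "i \<noteq> j" using inj_onD[OF inj[OF i(1)] cu i(2)] j(2) ne by blast
    then show "\<exists>i<3. \<exists>j<3. i \<noteq> j \<and> t = \<tau> i j" using eq[OF i(1) j(1) _ i(2) j(2)] cu i(1) j(1) by blast
  next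
    assume "\<exists>i<3. \<exists>j<3. i \<noteq> j \<and> t = \<tau> i j"
    then obtain i j where h: "i < 3" "j < 3" "i \<noteq> j" "t = \<tau> i j" by blast
    have "t \<in> {a i<..<b i}" using tau[OF h(1-3)] h(4) by simp
    moreover from this have "t \<in> {c..<c + 1}" by (rule w[OF h(1)])
    ultimately show "t \<in> window D c \<inter> inside J"
      using in_J[of t] h meets_crosses[OF m[OF h(1-3)]] by (auto simp: window_def)
  qed
qed

text \<open>
  The condition of equal turning at the corners of a triangle, brought into a form that is independent
  of the cyclic numbering of the strands: reversing the cyclic order changes the sign of the constant.
\<close>

lemma triangle_signs:
  assumes vk: "vknot_diagram D" and tri: "triangle D a b \<tau>"
    and meets: "\<forall>i j. i < 3 \<longrightarrow> j < 3 \<longrightarrow> i \<noteq> j \<longrightarrow> meets D (\<tau> i j) (\<tau> j i)"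
    and ne: "\<forall>i j k. i < 3 \<longrightarrow> j < 3 \<longrightarrow> k < 3 \<longrightarrow> i \<noteq> j \<longrightarrow> i \<noteq> k \<longrightarrow> j \<noteq> k \<longrightarrow> \<tau> i j \<noteq> \<tau> i k"
    and TMB: "T < 3" "M < 3" "B < 3" "T \<noteq> M" "T \<noteq> B" "M \<noteq> B"
  shows "\<exists>\<sigma>. (\<sigma> = 1 \<or> \<sigma> = - 1) \<and>
    strand_sign D (\<tau> T M) = (if (\<tau> T M < \<tau> T B) = (\<tau> M T < \<tau> M B) then - \<sigma> else \<sigma>) \<and>
    strand_sign D (\<tau> T B) = (if (\<tau> T M < \<tau> T B) = (\<tau> B T < \<tau> B M) then - \<sigma> else \<sigma>) \<and>
    strand_sign D (\<tau> M B) = (if (\<tau> M T < \<tau> M B) = (\<tau> B T < \<tau> B M) then - \<sigma> else \<sigma>)"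
proof -
  note meets = meets[rule_format] and ne = ne[rule_format]
  obtain \<rho> where \<rho>: "\<forall>i<3. let j = (i + 1) mod 3; k = (i + 2) mod 3
        in sgn ((\<tau> i j - \<tau> i k) * (\<tau> j k - \<tau> j i) * turn D (\<tau> i j) (\<tau> j i)) = \<rho>"
    using tri unfolding triangle_def by (elim conjE exE) (rule that)
  define F where "F i j k = (\<tau> i j < \<tau> i k)" for i j k
  define g where "g i j = strand_sign D (\<tau> i j)" for i j
  have F_anti: "F i k j = (\<not> F i j k)" if "i < 3" "j < 3" "k < 3" "i \<noteq> j" "i \<noteq> k" "j \<noteq> k" for i j k
    using ne[OF that] by (auto simp: F_def)
  have g_anti: "g j i = - g i j" if "i < 3" "j < 3" "i \<noteq> j" for i j
    unfolding g_def by (rule strand_sign_partner[OF vk meets[OF that]])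
  have turn0: "turn D (\<tau> i j) (\<tau> j i) \<noteq> 0 \<and> g i j = (if turn D (\<tau> i j) (\<tau> j i) > 0 then 1 else - 1)"
    if "i < 3" "j < 3" "i \<noteq> j" for i j
    using meets_turn[OF vk meets[OF that]] strand_sign_eq[OF vk meets[OF that]] by (simp add: g_def)
  define \<sigma> :: int where "\<sigma> = (if \<rho> > 0 then 1 else - 1)"
  have rel: "g i j = (if F i j k = F j k i then \<sigma> else - \<sigma>)"
    if h: "i < 3" "j < 3" "k < 3" "i \<noteq> j" "i \<noteq> k" "j \<noteq> k"
      and e: "sgn ((\<tau> i j - \<tau> i k) * (\<tau> j k - \<tau> j i) * turn D (\<tau> i j) (\<tau> j i)) = \<rho>" for i j k
  proof -
    have "\<tau> i j - \<tau> i k \<noteq> 0" "\<tau> j k - \<tau> j i \<noteq> 0" using ne[of i j k] ne[of j k i] h by auto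
    then show ?thesis
      using turn0[OF h(1,2,4)] e[symmetric] unfolding \<sigma>_def F_def
      by (cases "\<tau> i j < \<tau> i k"; cases "\<tau> j k < \<tau> j i"; cases "turn D (\<tau> i j) (\<tau> j i) > 0")
        (simp_all add: sgn_mult)
  qed
  have \<rho>': "sgn ((\<tau> 0 1 - \<tau> 0 2) * (\<tau> 1 2 - \<tau> 1 0) * turn D (\<tau> 0 1) (\<tau> 1 0)) = \<rho>"
    "sgn ((\<tau> 1 2 - \<tau> 1 0) * (\<tau> 2 0 - \<tau> 2 1) * turn D (\<tau> 1 2) (\<tau> 2 1)) = \<rho>"
    "sgn ((\<tau> 2 0 - \<tau> 2 1) * (\<tau> 0 1 - \<tau> 0 2) * turn D (\<tau> 2 0) (\<tau> 0 2)) = \<rho>"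
    using \<rho>[rule_format, of 0] \<rho>[rule_format, of 1] \<rho>[rule_format, of 2]
    by (simp_all add: Let_def numeral_2_eq_2)
  have r: "g 0 1 = (if F 0 1 2 = F 1 2 0 then \<sigma> else - \<sigma>)" "g 1 2 = (if F 1 2 0 = F 2 0 1 then \<sigma> else - \<sigma>)"
    "g 2 0 = (if F 2 0 1 = F 0 1 2 then \<sigma> else - \<sigma>)"
    by (rule rel; (rule \<rho>' | simp))+
  have anti: "g 1 0 = - g 0 1" "g 2 1 = - g 1 2" "g 0 2 = - g 2 0"
    "F 0 2 1 = (\<not> F 0 1 2)" "F 1 0 2 = (\<not> F 1 2 0)" "F 2 1 0 = (\<not> F 2 0 1)"
    by (rule g_anti F_anti; simp)+
  have one: "\<sigma> = 1 \<or> \<sigma> = - 1" by (simp add: \<sigma>_def)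
  have "(T = 0 \<and> M = 1 \<and> B = 2) \<or> (T = 1 \<and> M = 2 \<and> B = 0) \<or> (T = 2 \<and> M = 0 \<and> B = 1) \<or>
     (T = 0 \<and> M = 2 \<and> B = 1) \<or> (T = 2 \<and> M = 1 \<and> B = 0) \<or> (T = 1 \<and> M = 0 \<and> B = 2)"
    using TMB by (auto simp: less_3_cases)
  then have "\<exists>\<sigma>'. (\<sigma>' = \<sigma> \<or> \<sigma>' = - \<sigma>) \<and> g T M = (if F T M B = F M T B then - \<sigma>' else \<sigma>') \<and>
     g T B = (if F T M B = F B T M then - \<sigma>' else \<sigma>') \<and> g M B = (if F M T B = F B T M then - \<sigma>' else \<sigma>')"
  proof (elim disjE conjE)
    assume "T = 0" "M = 1" "B = 2"
    then show ?thesis by (intro exI[of _ \<sigma>]) (auto simp: r anti simp del: One_nat_def)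
  next
    assume "T = 1" "M = 2" "B = 0"
    then show ?thesis by (intro exI[of _ \<sigma>]) (auto simp: r anti simp del: One_nat_def)
  next
    assume "T = 2" "M = 0" "B = 1"
    then show ?thesis by (intro exI[of _ \<sigma>]) (auto simp: r anti simp del: One_nat_def)
  next
    assume "T = 0" "M = 2" "B = 1"
    then show ?thesis by (intro exI[of _ "- \<sigma>"]) (auto simp: r anti simp del: One_nat_def)
  next
    assume "T = 2" "M = 1" "B = 0"
    then show ?thesis by (intro exI[of _ "- \<sigma>"]) (auto simp: r anti simp del: One_nat_def)
  next
    assume "T = 1" "M = 0" "B = 2"
    then show ?thesis by (intro exI[of _ "- \<sigma>"]) (auto simp: r anti simp del: One_nat_def)
  qed
  then obtain \<sigma>' where \<sigma>': "\<sigma>' = \<sigma> \<or> \<sigma>' = - \<sigma>" "g T M = (if F T M B = F M T B then - \<sigma>' else \<sigma>')"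
     "g T B = (if F T M B = F B T M then - \<sigma>' else \<sigma>')" "g M B = (if F M T B = F B T M then - \<sigma>' else \<sigma>')"
    by (elim exE conjE) (rule that)
  have "\<sigma>' = 1 \<or> \<sigma>' = - 1" using one \<sigma>'(1) by auto
  then show ?thesis using \<sigma>'(2-4) unfolding g_def F_def by (intro exI[of _ \<sigma>'] conjI)
qed

lemma triangle_gated:
  fixes a b :: "nat \<Rightarrow> real" and \<tau> :: "nat \<Rightarrow> nat \<Rightarrow> real"
  assumes J: "arcs_in c J" "J = (\<lambda>i. (a i, b i)) ` {..<3}" and order: "b 0 < a 1" "b 1 < a 2"
    and L: "\<forall>t. t \<in> L \<longleftrightarrow> (\<exists>i<3. \<exists>j<3. i \<noteq> j \<and> t = \<tau> i j)"
    and range: "\<forall>i j. i < 3 \<longrightarrow> j < 3 \<longrightarrow> i \<noteq> j \<longrightarrow> a i < \<tau> i j \<and> \<tau> i j < b i"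
    and ne: "\<forall>i j k. i < 3 \<longrightarrow> j < 3 \<longrightarrow> k < 3 \<longrightarrow> i \<noteq> j \<longrightarrow> i \<noteq> k \<longrightarrow> j \<noteq> k \<longrightarrow> \<tau> i j \<noteq> \<tau> i k"
    and g: "gated J L d e P"
    and h: "i < 3" "j < 3" "k < 3" "i \<noteq> j" "i \<noteq> k" "j \<noteq> k"
  shows "cyc_pred P (\<tau> i j) = (if \<tau> i j < \<tau> i k then d (a i, b i) else \<tau> i k)"
    "cyc_pred P (e (a i, b i)) = (if \<tau> i j < \<tau> i k then \<tau> i k else \<tau> i j)"
proof -
  note L = L[rule_format] and range = range[rule_format] and ne = ne[rule_format]
  have ab: "a i < b i" if "i < 3" for i
    using arcs_inD(3)[OF J(1), of "(a i, b i)"] that J(2) by auto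
  have jJ: "(a i, b i) \<in> J" using h(1) J(2) by auto
  have only: "l = \<tau> i j \<or> l = \<tau> i k" if l: "l \<in> L" "a i < l" "l < b i" for l
  proof -
    obtain i' j' where l': "i' < 3" "j' < 3" "i' \<noteq> j'" "l = \<tau> i' j'" using L l(1) by blast
    have "a i' < l" "l < b i'" using range[OF l'(1-3)] l'(4) by auto
    then have "i' = i" using l l'(1) h(1) order ab[of 0] ab[of 1] ab[of 2] by (auto simp: less_3_cases)
    then have "j' = j \<or> j' = k" using l' h by auto
    then show ?thesis using l'(4) \<open>i' = i\<close> by auto
  qed
  have mem: "\<tau> i j \<in> L" "\<tau> i k \<in> L" unfolding L using h by blast+
  note two = gated_two[OF g jJ mem ne[OF h]]
  show "cyc_pred P (\<tau> i j) = (if \<tau> i j < \<tau> i k then d (a i, b i) else \<tau> i k)"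
    using two(1) range[of i j] range[of i k] h only by simp
  show "cyc_pred P (e (a i, b i)) = (if \<tau> i j < \<tau> i k then \<tau> i k else \<tau> i j)"
    using two(2) range[of i j] range[of i k] h only by simp
qed

lemma triangle_equations:
  fixes a b :: "nat \<Rightarrow> real" and \<tau> :: "nat \<Rightarrow> nat \<Rightarrow> real" and V :: "real \<Rightarrow> laurent"
  assumes J: "arcs_in c J" "J = (\<lambda>i. (a i, b i)) ` {..<3}" and order: "b 0 < a 1" "b 1 < a 2"
    and L: "\<forall>t. t \<in> L \<longleftrightarrow> (\<exists>i<3. \<exists>j<3. i \<noteq> j \<and> t = \<tau> i j)"
    and range: "\<forall>i j. i < 3 \<longrightarrow> j < 3 \<longrightarrow> i \<noteq> j \<longrightarrow> a i < \<tau> i j \<and> \<tau> i j < b i"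
    and ne: "\<forall>i j k. i < 3 \<longrightarrow> j < 3 \<longrightarrow> k < 3 \<longrightarrow> i \<noteq> j \<longrightarrow> i \<noteq> k \<longrightarrow> j \<noteq> k \<longrightarrow> \<tau> i j \<noteq> \<tau> i k"
    and g: "gated J L d e P"
    and par: "\<forall>i j. i < 3 \<longrightarrow> j < 3 \<longrightarrow> i \<noteq> j \<longrightarrow> m (\<tau> i j) = \<tau> j i"
    and TMB: "T < 3" "M < 3" "B < 3" "T \<noteq> M" "T \<noteq> B" "M \<noteq> B"
    and zero: "x (\<tau> T M) = 0" "x (\<tau> T B) = 0" "x (\<tau> M B) = 0"
    and V: "\<forall>l. l \<in> L \<longrightarrow> V l = w l * V (cyc_pred P l) + x l * V (cyc_pred P (m l))"
  defines "X \<equiv> \<lambda>i. V (d (a i, b i))"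
  defines "fT \<equiv> \<tau> T M < \<tau> T B" and "fM \<equiv> \<tau> M T < \<tau> M B" and "fB \<equiv> \<tau> B T < \<tau> B M"
  shows "V (\<tau> T M) = w (\<tau> T M) * (if fT then X T else V (\<tau> T B))"
    "V (\<tau> T B) = w (\<tau> T B) * (if fT then V (\<tau> T M) else X T)"
    "V (\<tau> M T) = w (\<tau> M T) * (if fM then X M else V (\<tau> M B)) + x (\<tau> M T) * (if fT then X T else V (\<tau> T B))"
    "V (\<tau> M B) = w (\<tau> M B) * (if fM then V (\<tau> M T) else X M)"
    "V (\<tau> B T) = w (\<tau> B T) * (if fB then X B else V (\<tau> B M)) + x (\<tau> B T) * (if fT then V (\<tau> T M) else X T)"
    "V (\<tau> B M) = w (\<tau> B M) * (if fB then V (\<tau> B T) else X B) + x (\<tau> B M) * (if fM then V (\<tau> M T) else X M)"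
    "V (cyc_pred P (e (a T, b T))) = (if fT then V (\<tau> T B) else V (\<tau> T M))"
    "V (cyc_pred P (e (a M, b M))) = (if fM then V (\<tau> M B) else V (\<tau> M T))"
    "V (cyc_pred P (e (a B, b B))) = (if fB then V (\<tau> B M) else V (\<tau> B T))"
proof -
  note tg = triangle_gated[OF J order L range ne g]
  note L = L[rule_format] and range = range[rule_format] and ne = ne[rule_format]
    and par = par[rule_format] and V = V[rule_format]
  have mem: "\<tau> i j \<in> L" if "i < 3" "j < 3" "i \<noteq> j" for i j unfolding L using that by blast
  have pred: "V (cyc_pred P (\<tau> i j)) = (if \<tau> i j < \<tau> i k then X i else V (\<tau> i k))"
    and pred': "V (cyc_pred P (\<tau> i k)) = (if \<tau> i j < \<tau> i k then V (\<tau> i j) else X i)"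
    if h: "i < 3" "j < 3" "k < 3" "i \<noteq> j" "i \<noteq> k" "j \<noteq> k" for i j k
    using tg(1)[OF h] tg(1)[OF h(1,3,2,5,4) h(6)[symmetric]] ne[OF h] by (auto simp: X_def)
  have eqn: "V (\<tau> i j) = w (\<tau> i j) * V (cyc_pred P (\<tau> i j)) + x (\<tau> i j) * V (cyc_pred P (\<tau> j i))"
    if "i < 3" "j < 3" "i \<noteq> j" for i j
    using V[OF mem[OF that]] par[OF that] by simp
  note sym = TMB(4-6)[symmetric]
  note pT = pred[OF TMB(1,2,3,4,5,6), folded fT_def] pred'[OF TMB(1,2,3,4,5,6), folded fT_def]
    and pM = pred[OF TMB(2,1,3) sym(1) TMB(6,5), folded fM_def] pred'[OF TMB(2,1,3) sym(1) TMB(6,5), folded fM_def]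
    and pB = pred[OF TMB(3,1,2) sym(2,3) TMB(4), folded fB_def] pred'[OF TMB(3,1,2) sym(2,3) TMB(4), folded fB_def]
  show "V (\<tau> T M) = w (\<tau> T M) * (if fT then X T else V (\<tau> T B))"
    using eqn[OF TMB(1,2,4)] unfolding zero pT by simp
  show "V (\<tau> T B) = w (\<tau> T B) * (if fT then V (\<tau> T M) else X T)"
    using eqn[OF TMB(1,3,5)] unfolding zero pT by simp
  show "V (\<tau> M B) = w (\<tau> M B) * (if fM then V (\<tau> M T) else X M)"
    using eqn[OF TMB(2,3,6)] unfolding zero pM by simp
  show "V (\<tau> M T) = w (\<tau> M T) * (if fM then X M else V (\<tau> M B)) + x (\<tau> M T) * (if fT then X T else V (\<tau> T B))"
    using eqn[OF TMB(2,1) sym(1)] unfolding pT pM .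
  show "V (\<tau> B T) = w (\<tau> B T) * (if fB then X B else V (\<tau> B M)) + x (\<tau> B T) * (if fT then V (\<tau> T M) else X T)"
    using eqn[OF TMB(3,1) sym(2)] unfolding pT pB .
  show "V (\<tau> B M) = w (\<tau> B M) * (if fB then V (\<tau> B T) else X B) + x (\<tau> B M) * (if fM then V (\<tau> M T) else X M)"
    using eqn[OF TMB(3,2) sym(3)] unfolding pM pB .
  show "V (cyc_pred P (e (a T, b T))) = (if fT then V (\<tau> T B) else V (\<tau> T M))"
    "V (cyc_pred P (e (a M, b M))) = (if fM then V (\<tau> M B) else V (\<tau> M T))"
    "V (cyc_pred P (e (a B, b B))) = (if fB then V (\<tau> B M) else V (\<tau> B T))"
    unfolding tg(2)[OF TMB] tg(2)[OF TMB(2,1,3) sym(1) TMB(6,5)] tg(2)[OF TMB(3,1,2) sym(2,3) TMB(4)]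
    unfolding fT_def fM_def fB_def by (rule if_distrib)+
qed

lemma triangle_unit:
  fixes a b :: "nat \<Rightarrow> real" and \<tau> :: "nat \<Rightarrow> nat \<Rightarrow> real" and w x :: "real \<Rightarrow> laurent"
  assumes J: "arcs_in c J" "J = (\<lambda>i. (a i, b i)) ` {..<3}" and order: "b 0 < a 1" "b 1 < a 2"
    and L: "\<forall>t. t \<in> L \<longleftrightarrow> (\<exists>i<3. \<exists>j<3. i \<noteq> j \<and> t = \<tau> i j)"
    and range: "\<forall>i j. i < 3 \<longrightarrow> j < 3 \<longrightarrow> i \<noteq> j \<longrightarrow> a i < \<tau> i j \<and> \<tau> i j < b i"
    and g: "gated J L d e P" and fin: "finite L"
    and par: "\<forall>i j. i < 3 \<longrightarrow> j < 3 \<longrightarrow> i \<noteq> j \<longrightarrow> m (\<tau> i j) = \<tau> j i"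
    and TMB: "T < 3" "M < 3" "B < 3" "T \<noteq> M" "T \<noteq> B" "M \<noteq> B"
    and zero: "x (\<tau> T M) = 0" "x (\<tau> T B) = 0" "x (\<tau> M B) = 0"
  shows "set_det L (relation_matrix w x m P) dvd 1"
proof -
  note L = L[rule_format] and range = range[rule_format] and par = par[rule_format]
  have ab: "a i < b i" if "i < 3" for i
    using arcs_inD(3)[OF J(1), of "(a i, b i)"] that J(2) by auto
  have same_arc: "i = j" if "i < 3" "j < 3" "a i < l" "l < b i" "a j < l" "l < b j" for i j l
    using that order ab[of 0] ab[of 1] ab[of 2] by (auto simp: less_3_cases)
  define arc where "arc l = (THE i. i < 3 \<and> a i < l \<and> l < b i)" for l
  have arc: "arc l = i" if "i < 3" "a i < l" "l < b i" for i l
    unfolding arc_def by (rule the_equality) (use that same_arc in blast)+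
  define level where "level i = (if i = T then 0 else if i = M then 1 else 2 :: nat)" for i
  show ?thesis
  proof (rule gated_unit[OF g fin, where level = "\<lambda>l. level (arc l)"])
    fix l assume "l \<in> L"
    then obtain i j where h: "i < 3" "j < 3" "i \<noteq> j" "l = \<tau> i j" using L by blast
    show "\<exists>j\<in>J. fst j < l \<and> l < snd j"
      using range[OF h(1-3)] h J(2) by (intro bexI[of _ "(a i, b i)"]) auto
    show "m l \<in> L \<and> level (arc (m l)) < level (arc l)" if "x l \<noteq> 0"
    proof -
      have ml: "m l = \<tau> j i" using par[OF h(1-3)] h(4) by simp
      have "arc l = i" "arc (m l) = j"
        using arc range[OF h(1-3)] range[OF h(2,1) h(3)[symmetric]] h ml by auto
      moreover have "m l \<in> L" unfolding L ml using h by blast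
      moreover have "\<not> (i = T \<and> j = M) \<and> \<not> (i = T \<and> j = B) \<and> \<not> (i = M \<and> j = B)"
        using zero that h(4) by auto
      moreover have "i \<in> {T, M, B}" "j \<in> {T, M, B}" using h(1,2) TMB by (auto simp: less_3_cases)
      ultimately show ?thesis using h(3) TMB(4-6) by (auto simp: level_def)
    qed
  next
    fix j l k assume j: "j \<in> J" "fst j < l" "l < snd j" "fst j < k" "k < snd j"
    then obtain i where "i < 3" "j = (a i, b i)" using J(2) by auto
    then show "level (arc l) = level (arc k)" using arc[of i l] arc[of i k] j by simp
  qed
qed

lemma triangle_classical:
  fixes a b :: "nat \<Rightarrow> real" and \<tau> :: "nat \<Rightarrow> nat \<Rightarrow> real"
  assumes vk: "vknot_diagram D" and J: "arcs_in c J" "J = (\<lambda>i. (a i, b i)) ` {..<3}"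
    and order: "b 0 < a 1" "b 1 < a 2"
    and closed: "\<forall>t t'. meets D t t' \<longrightarrow> t \<in> inside J \<longrightarrow> t' \<in> inside J"
    and tri: "triangle D a b \<tau>"
    and h: "i < 3" "j < 3" "k < 3" "i \<noteq> j" "i \<noteq> k" "j \<noteq> k"
  shows "classical_count D c (\<tau> i j) = classical_count D c (a i) + (if classical D (a i) then 1 else 0)
      + (if \<tau> i k < \<tau> i j \<and> curve D (\<tau> i k) \<notin> virt D then 1 else 0)"
    "card {u. classical D u \<and> a i < u \<and> u < b i}
      = (if curve D (\<tau> i j) \<in> virt D then 0 else 1) + (if curve D (\<tau> i k) \<in> virt D then 0 else 1)"
proof -
  note tf = triangle_facts[OF vk J order closed tri]
  have ab: "c \<le> a i" "a i < b i" "b i < c + 1" if "i < 3" for i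
    using arcs_inD(3)[OF J(1), of "(a i, b i)"] that J(2) by auto
  have cl: "classical D (\<tau> i j) \<longleftrightarrow> curve D (\<tau> i j) \<notin> virt D" "classical D (\<tau> i k) \<longleftrightarrow> curve D (\<tau> i k) \<notin> virt D"
    using meets_crosses[OF tf(2)[OF h(1,2,4)]] meets_crosses[OF tf(2)[OF h(1,3,5)]] by (simp_all add: classical_def)
  have only: "x = \<tau> i j \<or> x = \<tau> i k" if x: "classical D x" "a i < x" "x < b i" for x
  proof -
    have "x \<in> {c..<c + 1}" using x ab[OF h(1)] by auto
    moreover from this have "x \<in> inside J"
      unfolding inside_window[OF J(1) \<open>x \<in> {c..<c + 1}\<close>] using x h(1) J(2) by (intro bexI[of _ "(a i, b i)"]) auto
    ultimately have "x \<in> window D c \<inter> inside J" using x(1) by (simp add: window_def classical_def)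
    then obtain i' j' where l': "i' < 3" "j' < 3" "i' \<noteq> j'" "x = \<tau> i' j'" using tf(5) by blast
    have "a i' < x" "x < b i'" using tf(1)[OF l'(1-3)] l'(4) by auto
    then have "i' = i" using x l'(1) h(1) order ab[of 0] ab[of 1] ab[of 2] by (auto simp: less_3_cases)
    moreover from this have "j' = j \<or> j' = k" using l' h by auto
    ultimately show ?thesis using l'(4) by auto
  qed
  note r = tf(1)[OF h(1,2,4)] tf(1)[OF h(1,3,5)]
  have "x \<in> {x. classical D x \<and> a i \<le> x \<and> x < \<tau> i j} \<longleftrightarrow>
      x \<in> (if classical D (a i) then {a i} else {}) \<union>
      (if \<tau> i k < \<tau> i j \<and> curve D (\<tau> i k) \<notin> virt D then {\<tau> i k} else {})" for x
    using only[of x] r cl by (cases "x = a i") auto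
  then have set1: "{x. classical D x \<and> a i \<le> x \<and> x < \<tau> i j} =
      (if classical D (a i) then {a i} else {}) \<union>
      (if \<tau> i k < \<tau> i j \<and> curve D (\<tau> i k) \<notin> virt D then {\<tau> i k} else {})" by blast
  have "classical_count D (a i) (\<tau> i j) = (if classical D (a i) then 1 else 0)
      + (if \<tau> i k < \<tau> i j \<and> curve D (\<tau> i k) \<notin> virt D then 1 else 0)"
    unfolding classical_count_def set1 using r by auto
  moreover have "classical_count D c (\<tau> i j) = classical_count D c (a i) + classical_count D (a i) (\<tau> i j)"
    using r ab[OF h(1)] by (intro classical_count_add[OF vk]) auto
  ultimately show "classical_count D c (\<tau> i j) = classical_count D c (a i) + (if classical D (a i) then 1 else 0)
      + (if \<tau> i k < \<tau> i j \<and> curve D (\<tau> i k) \<notin> virt D then 1 else 0)" by simp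
  have "x \<in> {u. classical D u \<and> a i < u \<and> u < b i} \<longleftrightarrow>
     x \<in> (if curve D (\<tau> i j) \<in> virt D then {} else {\<tau> i j}) \<union> (if curve D (\<tau> i k) \<in> virt D then {} else {\<tau> i k})" for x
    using only[of x] r cl by auto
  then have "{u. classical D u \<and> a i < u \<and> u < b i} =
     (if curve D (\<tau> i j) \<in> virt D then {} else {\<tau> i j}) \<union> (if curve D (\<tau> i k) \<in> virt D then {} else {\<tau> i k})" by blast
  then show "card {u. classical D u \<and> a i < u \<and> u < b i}
      = (if curve D (\<tau> i j) \<in> virt D then 0 else 1) + (if curve D (\<tau> i k) \<in> virt D then 0 else 1)"
    using tf(4)[OF h] by simp
qed

lemma if_Not: "(if \<not> p then x else y) = (if p then y else x)"
  by simp

lemma two_others: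
  assumes "i < (3::nat)"
  obtains j k where "j < 3" "k < 3" "i \<noteq> j" "i \<noteq> k" "j \<noteq> k"
proof -
  have "(i = 0 \<or> i = 1 \<or> i = 2)" using assms by auto
  then show thesis using that[of 1 2] that[of 0 2] that[of 0 1] by auto
qed

text \<open>
  If some strand has only virtual crossings, it depends on no other strand and may be taken as the
  bottom one; otherwise the over and under information orders the strands.
\<close>

lemma triangle_layers:
  assumes dec: "(\<exists>i<3. \<forall>j<3. j \<noteq> i \<longrightarrow> curve D (\<tau> i j) \<in> virt D) \<or>
         (\<forall>i<3. \<forall>j<3. i \<noteq> j \<longrightarrow> curve D (\<tau> i j) \<notin> virt D) \<and>
         (\<exists>i<3. \<forall>j<3. j \<noteq> i \<longrightarrow> over D (\<tau> i j))"
    and cu: "\<And>i j. i < 3 \<Longrightarrow> j < 3 \<Longrightarrow> i \<noteq> j \<Longrightarrow> curve D (\<tau> j i) = curve D (\<tau> i j)"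
    and ov: "\<And>i j. i < 3 \<Longrightarrow> j < 3 \<Longrightarrow> i \<noteq> j \<Longrightarrow> curve D (\<tau> i j) \<notin> virt D \<Longrightarrow> over D (\<tau> j i) = (\<not> over D (\<tau> i j))"
  obtains T M B where "T < (3::nat)" "M < 3" "B < 3" "T \<noteq> M" "T \<noteq> B" "M \<noteq> B"
    "curve D (\<tau> T M) \<in> virt D \<or> over D (\<tau> T M)" "curve D (\<tau> T B) \<in> virt D \<or> over D (\<tau> T B)"
    "curve D (\<tau> M B) \<in> virt D \<or> over D (\<tau> M B)"
    "(curve D (\<tau> T M) \<notin> virt D \<and> curve D (\<tau> T B) \<notin> virt D \<and> curve D (\<tau> M B) \<notin> virt D) \<or>
     (curve D (\<tau> T B) \<in> virt D \<and> curve D (\<tau> M B) \<in> virt D)"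
proof -
  from dec show thesis
  proof
    assume "\<exists>i<3. \<forall>j<3. j \<noteq> i \<longrightarrow> curve D (\<tau> i j) \<in> virt D"
    then obtain i where i: "i < 3" "\<forall>j<3. j \<noteq> i \<longrightarrow> curve D (\<tau> i j) \<in> virt D" by blast
    obtain j k where jk: "j < 3" "k < 3" "i \<noteq> j" "i \<noteq> k" "j \<noteq> k" using two_others[OF i(1)] .
    have v: "curve D (\<tau> j i) \<in> virt D" "curve D (\<tau> k i) \<in> virt D"
      using i(2) jk cu[OF i(1) jk(1,3)] cu[OF i(1) jk(2,4)] by auto
    show thesis
    proof (cases "over D (\<tau> j k)")
      case True
      show thesis by (rule that[of j k i]) (use i(1) jk v True in auto)
    next
      case False
      have "curve D (\<tau> k j) \<in> virt D \<or> over D (\<tau> k j)"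
        using ov[OF jk(1,2,5)] cu[OF jk(1,2,5)] False by auto
      then show thesis by (intro that[of k j i]) (use i(1) jk v in auto)
    qed
  next
    assume a: "(\<forall>i<3. \<forall>j<3. i \<noteq> j \<longrightarrow> curve D (\<tau> i j) \<notin> virt D) \<and>
         (\<exists>i<3. \<forall>j<3. j \<noteq> i \<longrightarrow> over D (\<tau> i j))"
    then obtain i where i: "i < 3" "\<forall>j<3. j \<noteq> i \<longrightarrow> over D (\<tau> i j)" by blast
    have cl: "curve D (\<tau> p q) \<notin> virt D" if "p < 3" "q < 3" "p \<noteq> q" for p q
      using a[THEN conjunct1, rule_format, OF that] .
    obtain j k where jk: "j < 3" "k < 3" "i \<noteq> j" "i \<noteq> k" "j \<noteq> k" using two_others[OF i(1)] .
    have o: "over D (\<tau> i j)" "over D (\<tau> i k)" using i(2) jk by auto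
    show thesis
    proof (cases "over D (\<tau> j k)")
      case True
      show thesis by (rule that[of i j k]) (use i(1) jk cl o True in auto)
    next
      case False
      then have "over D (\<tau> k j)" using ov[OF jk(1,2,5) cl[OF jk(1,2,5)]] by simp
      then show thesis by (intro that[of i k j]) (use i(1) jk cl o in auto)
    qed
  qed
qed

lemma layered_coefficients:
  assumes vk: "vknot_diagram D" and m: "meets D t t'"
    and vi: "curve D t \<in> virt D \<longleftrightarrow> vi" and od: "\<not> vi \<Longrightarrow> odd_crossing D (curve D t) = od"
    and sg: "strand_sign D t = \<sigma>" and ov: "vi \<or> over D t"
  shows "own D t = own_coeff vi od True \<sigma>" "cross D t = 0"
    "own D t' = own_coeff vi od False (- \<sigma>)" "cross D t' = cross_coeff vi od False (- \<sigma>)"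
  using crossing_coefficients_cong[OF vk m vi od sg, of True] ov by (auto simp: cross_coeff_def)

text \<open>
  Reversing the order of two crossings on both strands through a third crossing changes the counts at
  its two passages by the same amount modulo 2, so every crossing keeps its parity. If all three
  crossings are classical, the sum of the three parity conditions shows that an even number of them is
  odd.
\<close>

lemma alexander_reidemeister3:
  assumes vk: "vknot_diagram D" "vknot_diagram D'" and r3: "reidemeister3 D D'"
  shows "alexander D dvd alexander D' \<and> alexander D' dvd alexander D"
proof -
  from r3 obtain a b \<tau> \<tau>' where agr: "agree_outside_disc (map (\<lambda>i. (a i, b i)) [0..<3]) D D'"
    and tri: "triangle D a b \<tau>" and tri': "triangle D' a b \<tau>'"
    and flip: "\<forall>i<3. \<forall>j<3. \<forall>k<3. distinct [i, j, k] \<longrightarrow> (\<tau> i j < \<tau> i k \<longleftrightarrow> \<tau>' i k < \<tau>' i j)"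
    and keep: "\<forall>i<3. \<forall>j<3. i \<noteq> j \<longrightarrow>
           turn D (\<tau> i j) (\<tau> j i) * turn D' (\<tau>' i j) (\<tau>' j i) > 0 \<and>
           (curve D' (\<tau>' i j) \<in> virt D' \<longleftrightarrow> curve D (\<tau> i j) \<in> virt D) \<and>
           (curve D (\<tau> i j) \<notin> virt D \<longrightarrow> over D' (\<tau>' i j) = over D (\<tau> i j))"
    and dec: "(\<exists>i<3. \<forall>j<3. j \<noteq> i \<longrightarrow> curve D (\<tau> i j) \<in> virt D) \<or>
         (\<forall>i<3. \<forall>j<3. i \<noteq> j \<longrightarrow> curve D (\<tau> i j) \<notin> virt D) \<and>
         (\<exists>i<3. \<forall>j<3. j \<noteq> i \<longrightarrow> over D (\<tau> i j))"
    unfolding reidemeister3_def by (elim exE conjE) (rule that)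
  define J where "J = (\<lambda>i. (a i, b i)) ` {..<3::nat}"
  have setJ: "set (map (\<lambda>i. (a i, b i)) [0..<3]) = J" by (simp add: J_def atLeast0LessThan)
  have upt3: "[0..<3] = [0, 1, 2::nat]" by (simp add: upt_rec numeral_3_eq_3 numeral_2_eq_2)
  have ord: "a 0 < b 0" "b 0 < a 1" "a 1 < b 1" "b 1 < a 2" "a 2 < b 2" "b 2 < a 0 + 1"
    using agr unfolding agree_outside_disc_def Let_def upt3 by simp_all
  have J3: "J = {(a 0, b 0), (a 1, b 1), (a 2, b 2)}" by (auto simp: J_def less_3_cases)
  define c where "c = a 0"
  have arcs: "arcs_in c J" using ord unfolding arcs_in_def J3 c_def by simp
  have ag: "agree_off c J D D'"
    using agree_outside_disc_agree_off[OF vk _ agr, unfolded setJ, OF arcs] .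
  have closed: "\<forall>t t'. meets D t t' \<longrightarrow> t \<in> inside J \<longrightarrow> t' \<in> inside J"
    using meets_inside[OF ag] by (intro allI impI)
  have closed': "\<forall>t t'. meets D' t t' \<longrightarrow> t \<in> inside J \<longrightarrow> t' \<in> inside J"
    using meets_inside[OF agree_off_sym[OF ag]] by (intro allI impI)
  note tf = triangle_facts[OF vk(1) arcs J_def ord(2,4) closed tri]
  note tf' = triangle_facts[OF vk(2) arcs J_def ord(2,4) closed' tri']
  have to: "\<forall>i j. i < 3 \<longrightarrow> j < 3 \<longrightarrow> i \<noteq> j \<longrightarrow> a i < \<tau> i j \<and> \<tau> i j < b i"
    "\<forall>i j. i < 3 \<longrightarrow> j < 3 \<longrightarrow> i \<noteq> j \<longrightarrow> meets D (\<tau> i j) (\<tau> j i)"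
    "\<forall>i j. i < 3 \<longrightarrow> j < 3 \<longrightarrow> i \<noteq> j \<longrightarrow> partner D c (\<tau> i j) = \<tau> j i"
    "\<forall>i j k. i < 3 \<longrightarrow> j < 3 \<longrightarrow> k < 3 \<longrightarrow> i \<noteq> j \<longrightarrow> i \<noteq> k \<longrightarrow> j \<noteq> k \<longrightarrow> \<tau> i j \<noteq> \<tau> i k"
    "\<forall>t. t \<in> window D c \<inter> inside J \<longleftrightarrow> (\<exists>i<3. \<exists>j<3. i \<noteq> j \<and> t = \<tau> i j)"
    by (intro allI impI; rule tf; assumption)+
  have to': "\<forall>i j. i < 3 \<longrightarrow> j < 3 \<longrightarrow> i \<noteq> j \<longrightarrow> a i < \<tau>' i j \<and> \<tau>' i j < b i"
    "\<forall>i j. i < 3 \<longrightarrow> j < 3 \<longrightarrow> i \<noteq> j \<longrightarrow> meets D' (\<tau>' i j) (\<tau>' j i)"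
    "\<forall>i j. i < 3 \<longrightarrow> j < 3 \<longrightarrow> i \<noteq> j \<longrightarrow> partner D' c (\<tau>' i j) = \<tau>' j i"
    "\<forall>i j k. i < 3 \<longrightarrow> j < 3 \<longrightarrow> k < 3 \<longrightarrow> i \<noteq> j \<longrightarrow> i \<noteq> k \<longrightarrow> j \<noteq> k \<longrightarrow> \<tau>' i j \<noteq> \<tau>' i k"
    "\<forall>t. t \<in> window D' c \<inter> inside J \<longleftrightarrow> (\<exists>i<3. \<exists>j<3. i \<noteq> j \<and> t = \<tau>' i j)"
    by (intro allI impI; rule tf'; assumption)+
  have cu: "curve D (\<tau> j i) = curve D (\<tau> i j)" if "i < 3" "j < 3" "i \<noteq> j" for i j
    by (rule meets_curve[OF tf(2)[OF that]])
  have ovr: "over D (\<tau> j i) = (\<not> over D (\<tau> i j))"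
    if "i < 3" "j < 3" "i \<noteq> j" "curve D (\<tau> i j) \<notin> virt D" for i j
    by (rule meets_over[OF vk(1) tf(2)[OF that(1-3)] that(4)])
  obtain T M B where TMB: "T < 3" "M < 3" "B < 3" "T \<noteq> M" "T \<noteq> B" "M \<noteq> B"
    and top: "curve D (\<tau> T M) \<in> virt D \<or> over D (\<tau> T M)" "curve D (\<tau> T B) \<in> virt D \<or> over D (\<tau> T B)"
      "curve D (\<tau> M B) \<in> virt D \<or> over D (\<tau> M B)"
    and kinds: "(curve D (\<tau> T M) \<notin> virt D \<and> curve D (\<tau> T B) \<notin> virt D \<and> curve D (\<tau> M B) \<notin> virt D) \<or>
     (curve D (\<tau> T B) \<in> virt D \<and> curve D (\<tau> M B) \<in> virt D)"
    by (rule triangle_layers[OF dec cu ovr])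
  note sym = TMB(4-6)[symmetric]
  define vi where "vi i j = (curve D (\<tau> i j) \<in> virt D)" for i j
  define od where "od i j = odd_crossing D (curve D (\<tau> i j))" for i j
  define sg where "sg i j = strand_sign D (\<tau> i j)" for i j
  define F where "F i j k = (\<tau> i j < \<tau> i k)" for i j k
  have vi_sym: "vi j i = vi i j" if "i < 3" "j < 3" "i \<noteq> j" for i j using cu[OF that] by (simp add: vi_def)
  have vi': "curve D' (\<tau>' i j) \<in> virt D' \<longleftrightarrow> vi i j" if "i < 3" "j < 3" "i \<noteq> j" for i j
    using keep[rule_format, OF that] by (simp add: vi_def)
  have sg': "strand_sign D' (\<tau>' i j) = sg i j" if "i < 3" "j < 3" "i \<noteq> j" for i j
  proof -
    have "turn D (\<tau> i j) (\<tau> j i) * turn D' (\<tau>' i j) (\<tau>' j i) > 0" using keep[rule_format, OF that] by simp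
    then have "turn D (\<tau> i j) (\<tau> j i) > 0 \<longleftrightarrow> turn D' (\<tau>' i j) (\<tau>' j i) > 0" by (auto simp: zero_less_mult_iff)
    then show ?thesis
      unfolding sg_def strand_sign_eq[OF vk(1) tf(2)[OF that]] strand_sign_eq[OF vk(2) tf'(2)[OF that]] by simp
  qed
  have F_anti: "F i k j = (\<not> F i j k)" if "i < 3" "j < 3" "k < 3" "i \<noteq> j" "i \<noteq> k" "j \<noteq> k" for i j k
    using tf(4)[OF that] by (auto simp: F_def)
  have F': "\<tau>' i j < \<tau>' i k \<longleftrightarrow> \<not> F i j k" if h: "i < 3" "j < 3" "k < 3" "i \<noteq> j" "i \<noteq> k" "j \<noteq> k" for i j k
  proof -
    have "F i j k \<longleftrightarrow> \<tau>' i k < \<tau>' i j" using flip[rule_format, of i j k] h by (simp add: F_def)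
    then show ?thesis using tf'(4)[OF h] by auto
  qed
  \<comment> \<open>The arc begins at \<open>a i\<close>, which may be a classical passage on the boundary of the disc.\<close>
  define n where "n X i = classical_count X c (a i) + (if classical X (a i) then 1 else 0)" for X i
  have count: "classical_count D c (\<tau> i j) = n D i + (if \<not> F i j k \<and> \<not> vi i k then 1 else 0)"
    "classical_count D' c (\<tau>' i j) = n D' i + (if F i j k \<and> \<not> vi i k then 1 else 0)"
    if h: "i < 3" "j < 3" "k < 3" "i \<noteq> j" "i \<noteq> k" "j \<noteq> k" for i j k
  proof -
    note h' = h(1,3,2,5,4) h(6)[symmetric]
    have f: "\<tau> i k < \<tau> i j \<longleftrightarrow> \<not> F i j k" using F_anti[OF h] by (simp add: F_def)
    have f': "\<tau>' i k < \<tau>' i j \<longleftrightarrow> F i j k" using F'[OF h'] F_anti[OF h] by simp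
    show "classical_count D c (\<tau> i j) = n D i + (if \<not> F i j k \<and> \<not> vi i k then 1 else 0)"
      using triangle_classical(1)[OF vk(1) arcs J_def ord(2,4) closed tri h] unfolding f vi_def[symmetric] n_def by simp
    show "classical_count D' c (\<tau>' i j) = n D' i + (if F i j k \<and> \<not> vi i k then 1 else 0)"
      using triangle_classical(1)[OF vk(2) arcs J_def ord(2,4) closed' tri' h]
      unfolding f' vi'[OF h(1,3,5)] n_def by simp
  qed
  have even_arcs: "even (card {u. classical D u \<and> fst p < u \<and> u < snd p}
       + card {u. classical D' u \<and> fst p < u \<and> u < snd p})" if p: "p \<in> J" for p
  proof -
    obtain i where i: "i < 3" "p = (a i, b i)" using p J_def by auto
    obtain j k where jk: "j < 3" "k < 3" "i \<noteq> j" "i \<noteq> k" "j \<noteq> k" using two_others[OF i(1)] .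
    note h = i(1) jk
    show ?thesis
      unfolding i(2) fst_conv snd_conv
        triangle_classical(2)[OF vk(1) arcs J_def ord(2,4) closed tri h]
        triangle_classical(2)[OF vk(2) arcs J_def ord(2,4) closed' tri' h]
        vi'[OF h(1,2,4)] vi'[OF h(1,3,5)] vi_def[symmetric] by simp
  qed
  have in_win: "\<tau> i j \<in> {c..<c + 1}" "\<tau>' i j \<in> {c..<c + 1}" if "i < 3" "j < 3" "i \<noteq> j" for i j
  proof -
    have "a 0 \<le> a i" "b i \<le> b 2" using that(1) ord by (auto simp: less_3_cases)
    then show "\<tau> i j \<in> {c..<c + 1}" "\<tau>' i j \<in> {c..<c + 1}"
      using tf(1)[OF that] tf'(1)[OF that] ord(6) by (auto simp: c_def)
  qed
  have n_even: "even (n D i + n D' i)" if i: "i < 3" for i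
  proof -
    have w: "a i \<in> {c..<c + 1}" using i ord by (auto simp: less_3_cases c_def)
    have o: "a i \<notin> inside J"
      unfolding inside_window[OF arcs w] using i ord by (auto simp: J3 less_3_cases)
    show ?thesis
      using agree_classical_count[OF ag even_arcs w o] agree_classical[OF ag o] by (simp add: n_def)
  qed
  have od_iff: "od i j \<longleftrightarrow> even (n D i + (if \<not> F i j k \<and> \<not> vi i k then 1 else 0)
       + (n D j + (if \<not> F j i k \<and> \<not> vi j k then 1 else 0)))"
    "odd_crossing D' (curve D' (\<tau>' i j)) \<longleftrightarrow> even (n D' i + (if F i j k \<and> \<not> vi i k then 1 else 0)
       + (n D' j + (if F j i k \<and> \<not> vi j k then 1 else 0)))"
    if h: "i < 3" "j < 3" "k < 3" "i \<noteq> j" "i \<noteq> k" "j \<noteq> k" and cl: "\<not> vi i j" for i j k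
  proof -
    note hj = h(2,1,3) h(4)[symmetric] h(6,5)
    show "od i j \<longleftrightarrow> even (n D i + (if \<not> F i j k \<and> \<not> vi i k then 1 else 0)
       + (n D j + (if \<not> F j i k \<and> \<not> vi j k then 1 else 0)))"
      unfolding od_def count(1)[OF h, symmetric] count(1)[OF hj, symmetric]
      by (rule odd_crossing_iff[OF vk(1) tf(2)[OF h(1,2,4)] in_win(1)[OF h(1,2,4)] in_win(1)[OF hj(1,2,4)]])
        (use cl in \<open>simp add: vi_def\<close>)
    show "odd_crossing D' (curve D' (\<tau>' i j)) \<longleftrightarrow> even (n D' i + (if F i j k \<and> \<not> vi i k then 1 else 0)
       + (n D' j + (if F j i k \<and> \<not> vi j k then 1 else 0)))"
      unfolding count(2)[OF h, symmetric] count(2)[OF hj, symmetric]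
      by (rule odd_crossing_iff[OF vk(2) tf'(2)[OF h(1,2,4)] in_win(2)[OF h(1,2,4)] in_win(2)[OF hj(1,2,4)]])
        (use cl vi'[OF h(1,2,4)] in simp)
  qed
  have od': "odd_crossing D' (curve D' (\<tau>' i j)) = od i j"
    if h: "i < 3" "j < 3" "k < 3" "i \<noteq> j" "i \<noteq> k" "j \<noteq> k" and cl: "\<not> vi i j" and third: "vi i k = vi j k" for i j k
    unfolding od_iff[OF h cl] third using n_even[OF h(1)] n_even[OF h(2)]
    by (cases "vi j k"; cases "F i j k"; cases "F j i k") (simp_all add: even_add)
  note vv = kinds[folded vi_def]
  have odTM: "\<not> vi T M \<Longrightarrow> odd_crossing D' (curve D' (\<tau>' T M)) = od T M"
    using od'[OF TMB] vv by auto
  have odTB: "\<not> vi T B \<Longrightarrow> odd_crossing D' (curve D' (\<tau>' T B)) = od T B"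
    using od'[OF TMB(1,3,2,5,4) sym(3)] vv vi_sym[OF TMB(2,3,6)] by auto
  have odMB: "\<not> vi M B \<Longrightarrow> odd_crossing D' (curve D' (\<tau>' M B)) = od M B"
    using od'[OF TMB(2,3,1,6) sym(1,2)] vv vi_sym[OF TMB(1,2,4)] vi_sym[OF TMB(1,3,5)] by auto
  have od_virt: "vi i j \<Longrightarrow> \<not> od i j" for i j
    using odd_crossing_not_virtual[OF vk(1)] by (auto simp: vi_def od_def)
  have parity: "od T M = (od T B \<noteq> od M B)" if "\<not> vi T M" "\<not> vi T B" "\<not> vi M B"
  proof -
    have s: "\<not> vi M T" "\<not> vi B T" "\<not> vi B M"
      using that vi_sym[OF TMB(1,2,4)] vi_sym[OF TMB(1,3,5)] vi_sym[OF TMB(2,3,6)] by auto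
    show ?thesis
      using od_iff(1)[OF TMB that(1)] od_iff(1)[OF TMB(1,3,2,5,4) sym(3) that(2)]
        od_iff(1)[OF TMB(2,3,1,6) sym(1,2) that(3)] that s
        F_anti[OF TMB] F_anti[OF TMB(2,1,3) sym(1) TMB(6,5)] F_anti[OF TMB(3,1,2) sym(2,3) TMB(4)]
      by (cases "F T M B"; cases "F M T B"; cases "F B T M"; cases "even (n D T)";
          cases "even (n D M)"; cases "even (n D B)"; simp add: even_add)
  qed
  note lay = layered_coefficients[OF vk(1) tf(2)[OF TMB(1,2,4)], of "vi T M" "od T M" "sg T M"]
    layered_coefficients[OF vk(1) tf(2)[OF TMB(1,3,5)], of "vi T B" "od T B" "sg T B"]
    layered_coefficients[OF vk(1) tf(2)[OF TMB(2,3,6)], of "vi M B" "od M B" "sg M B"]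
  have co: "own D (\<tau> T M) = own_coeff (vi T M) (od T M) True (sg T M)" "cross D (\<tau> T M) = 0"
    "own D (\<tau> M T) = own_coeff (vi T M) (od T M) False (- sg T M)"
    "cross D (\<tau> M T) = cross_coeff (vi T M) (od T M) False (- sg T M)"
    "own D (\<tau> T B) = own_coeff (vi T B) (od T B) True (sg T B)" "cross D (\<tau> T B) = 0"
    "own D (\<tau> B T) = own_coeff (vi T B) (od T B) False (- sg T B)"
    "cross D (\<tau> B T) = cross_coeff (vi T B) (od T B) False (- sg T B)"
    "own D (\<tau> M B) = own_coeff (vi M B) (od M B) True (sg M B)" "cross D (\<tau> M B) = 0"
    "own D (\<tau> B M) = own_coeff (vi M B) (od M B) False (- sg M B)"
    "cross D (\<tau> B M) = cross_coeff (vi M B) (od M B) False (- sg M B)"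
    by (rule lay; use top in \<open>simp add: vi_def od_def sg_def\<close>)+
  note lay' = layered_coefficients[OF vk(2) tf'(2)[OF TMB(1,2,4)] vi'[OF TMB(1,2,4)] odTM sg'[OF TMB(1,2,4)]]
    layered_coefficients[OF vk(2) tf'(2)[OF TMB(1,3,5)] vi'[OF TMB(1,3,5)] odTB sg'[OF TMB(1,3,5)]]
    layered_coefficients[OF vk(2) tf'(2)[OF TMB(2,3,6)] vi'[OF TMB(2,3,6)] odMB sg'[OF TMB(2,3,6)]]
  have top': "vi T M \<or> over D' (\<tau>' T M)" "vi T B \<or> over D' (\<tau>' T B)" "vi M B \<or> over D' (\<tau>' M B)"
    using keep[rule_format, OF TMB(1,2,4)] keep[rule_format, OF TMB(1,3,5)] keep[rule_format, OF TMB(2,3,6)] top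
    by (simp_all add: vi_def) blast+
  have co': "own D' (\<tau>' T M) = own_coeff (vi T M) (od T M) True (sg T M)" "cross D' (\<tau>' T M) = 0"
    "own D' (\<tau>' M T) = own_coeff (vi T M) (od T M) False (- sg T M)"
    "cross D' (\<tau>' M T) = cross_coeff (vi T M) (od T M) False (- sg T M)"
    "own D' (\<tau>' T B) = own_coeff (vi T B) (od T B) True (sg T B)" "cross D' (\<tau>' T B) = 0"
    "own D' (\<tau>' B T) = own_coeff (vi T B) (od T B) False (- sg T B)"
    "cross D' (\<tau>' B T) = cross_coeff (vi T B) (od T B) False (- sg T B)"
    "own D' (\<tau>' M B) = own_coeff (vi M B) (od M B) True (sg M B)" "cross D' (\<tau>' M B) = 0"
    "own D' (\<tau>' B M) = own_coeff (vi M B) (od M B) False (- sg M B)"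
    "cross D' (\<tau>' B M) = cross_coeff (vi M B) (od M B) False (- sg M B)"
    by (rule lay'; simp add: top')+
  obtain \<sigma> :: int where \<sigma>: "\<sigma> = 1 \<or> \<sigma> = - 1"
    "sg T M = (if F T M B = F M T B then - \<sigma> else \<sigma>)" "sg T B = (if F T M B = F B T M then - \<sigma> else \<sigma>)"
    "sg M B = (if F M T B = F B T M then - \<sigma> else \<sigma>)"
    using triangle_signs[OF vk(1) tri to(2) to(4) TMB, folded sg_def F_def] by (elim exE conjE) (rule that)
  have flags: "\<tau>' T M < \<tau>' T B \<longleftrightarrow> \<not> F T M B" "\<tau>' M T < \<tau>' M B \<longleftrightarrow> \<not> F M T B" "\<tau>' B T < \<tau>' B M \<longleftrightarrow> \<not> F B T M"
    using F'[OF TMB] F'[OF TMB(2,1,3) sym(1) TMB(6,5)] F'[OF TMB(3,1,2) sym(2,3) TMB(4)] by simp_all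
  have flags0: "\<tau> T M < \<tau> T B \<longleftrightarrow> F T M B" "\<tau> M T < \<tau> M B \<longleftrightarrow> F M T B" "\<tau> B T < \<tau> B M \<longleftrightarrow> F B T M"
    by (simp_all add: F_def)
  have kind_rule: "\<not> vi T M \<Longrightarrow> \<not> od T M \<Longrightarrow> vi T B = vi M B \<and> od T B = od M B"
    "\<not> vi M B \<Longrightarrow> \<not> od M B \<Longrightarrow> vi T M = vi T B \<and> od T M = od T B"
    "\<not> vi T B \<Longrightarrow> \<not> od T B \<Longrightarrow> vi T M = vi M B \<and> od T M = od M B"
    using vv parity od_virt[of T B] od_virt[of M B] by auto
  show ?thesis
  proof (rule disc_move[OF ag even_arcs refl refl])
    fix P d e assume g: "gated J (window D c \<inter> inside J) d e P"
    show "set_det (window D c \<inter> inside J) (relation_matrix (own D) (cross D) (partner D c) P) dvd 1"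
      by (rule triangle_unit[OF arcs J_def ord(2,4) to(5) to(1) g _ to(3) TMB co(2,6,10)])
        (simp add: finite_window[OF vk(1)])
  next
    fix P d e assume g: "gated J (window D' c \<inter> inside J) d e P"
    show "set_det (window D' c \<inter> inside J) (relation_matrix (own D') (cross D') (partner D' c) P) dvd 1"
      by (rule triangle_unit[OF arcs J_def ord(2,4) to'(5) to'(1) g _ to'(3) TMB co'(2,6,10)])
        (simp add: finite_window[OF vk(2)])
  next
    fix P P' d e V V' j
    assume g: "gated J (window D c \<inter> inside J) d e P" and g': "gated J (window D' c \<inter> inside J) d e P'"
      and dd: "\<And>j. j \<in> J \<Longrightarrow> V (d j) = V' (d j)"
      and V: "\<And>l. l \<in> window D c \<inter> inside J \<Longrightarrow> V l = own D l * V (cyc_pred P l) + cross D l * V (cyc_pred P (partner D c l))"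
      and V': "\<And>l. l \<in> window D' c \<inter> inside J \<Longrightarrow> V' l = own D' l * V' (cyc_pred P' l) + cross D' l * V' (cyc_pred P' (partner D' c l))"
      and j: "j \<in> J"
    have Vo: "\<forall>l. l \<in> window D c \<inter> inside J \<longrightarrow> V l = own D l * V (cyc_pred P l) + cross D l * V (cyc_pred P (partner D c l))"
      using V by (intro allI impI)
    have Vo': "\<forall>l. l \<in> window D' c \<inter> inside J \<longrightarrow> V' l = own D' l * V' (cyc_pred P' l) + cross D' l * V' (cyc_pred P' (partner D' c l))"
      using V' by (intro allI impI)
    note eqs = triangle_equations[OF arcs J_def ord(2,4) to(5) to(1) to(4) g to(3) TMB co(2,6,10) Vo, unfolded flags0 co]
    note eqs' = triangle_equations[OF arcs J_def ord(2,4) to'(5) to'(1) to'(4) g' to'(3) TMB co'(2,6,10) Vo', unfolded flags co']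
    have X: "V' (d (a i, b i)) = V (d (a i, b i))" if "i < 3" for i
      using dd[of "(a i, b i)"] that by (auto simp: J_def)
    note eqs'' = eqs'[unfolded X[OF TMB(1)] X[OF TMB(2)] X[OF TMB(3)] if_Not]
    have main: "(if F T M B then V (\<tau> T B) else V (\<tau> T M)) = (if F T M B then V' (\<tau>' T M) else V' (\<tau>' T B)) \<and>
      (if F M T B then V (\<tau> M B) else V (\<tau> M T)) = (if F M T B then V' (\<tau>' M T) else V' (\<tau>' M B)) \<and>
      (if F B T M then V (\<tau> B M) else V (\<tau> B T)) = (if F B T M then V' (\<tau>' B T) else V' (\<tau>' B M))"
      by (rule triangle_relations[OF \<sigma> kind_rule(1,2,3) eqs(1-6) eqs''(1-6)])
    obtain i where i: "i < 3" "j = (a i, b i)" using j J_def by auto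
    have "i = T \<or> i = M \<or> i = B" using i(1) TMB by (auto simp: less_3_cases)
    then show "V (cyc_pred P (e j)) = V' (cyc_pred P' (e j))"
      unfolding i(2) using main eqs(7-9) eqs''(7-9) by (elim disjE) (simp_all only:)
  qed
qed

section \<open>Invariance and the width of the invariant\<close>

lemma alexander_vmove:
  assumes "vmove D D'"
  shows "alexander D dvd alexander D' \<and> alexander D' dvd alexander D"
proof -
  have vk: "vknot_diagram D" "vknot_diagram D'" using assms by (simp_all add: vmove_def)
  from assms consider "planar_isotopy D D'" | "reidemeister1 D D'" | "reidemeister2 D D'" | "reidemeister3 D D'"
    unfolding vmove_def by (elim conjE disjE)
  then show ?thesis
  proof cases
    case 1
    then show ?thesis using alexander_planar_isotopy[OF vk] by simp
  next
    case 2
    then show ?thesis by (rule alexander_reidemeister1[OF vk])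
  next
    case 3
    then show ?thesis by (rule alexander_reidemeister2[OF vk])
  next
    case 4
    then show ?thesis by (rule alexander_reidemeister3[OF vk])
  qed
qed

lemma equivclp_vmove:
  assumes "equivclp vmove D D'" "vknot_diagram D"
  shows "vknot_diagram D' \<and> alexander D dvd alexander D' \<and> alexander D' dvd alexander D"
  using assms
proof (induction rule: equivclp_induct)
  case base
  then show ?case by simp
next
  case (step E E')
  then have E: "alexander D dvd alexander E" "alexander E dvd alexander D" by simp_all
  have "vknot_diagram E'" "alexander E dvd alexander E'" "alexander E' dvd alexander E"
    using step.hyps(2) alexander_vmove[of E E'] alexander_vmove[of E' E] by (auto simp: vmove_def)
  then show ?case using E by (meson dvd_trans)
qed

lemma width_le_on_knot:
  assumes vk: "vknot_diagram D\<^sub>0" and K: "K = {D. equivclp vmove D\<^sub>0 D}"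
    and f: "parity_virtual_alexander K f" and D: "D \<in> K"
    and x: "x = Var_q \<or> x = Var_theta"
  shows "vknot_diagram D \<and> width x f \<le> width x (alexander D)"
proof -
  obtain E where E: "E \<in> K" "diagram_pva E f" using f by (auto simp: parity_virtual_alexander_def)
  have e: "vknot_diagram E \<and> alexander D\<^sub>0 dvd alexander E \<and> alexander E dvd alexander D\<^sub>0"
    and d: "vknot_diagram D \<and> alexander D\<^sub>0 dvd alexander D \<and> alexander D dvd alexander D\<^sub>0"
    using equivclp_vmove[OF _ vk] E(1) D by (simp_all add: K)
  have "width x f \<le> width x (alexander E)" using diagram_pva_width_le_alexander[of E f x] e E(2) x by blast
  also have "\<dots> = width x (alexander D)"
    by (rule width_cong_dvd) (use e d dvd_trans in blast)+
  finally show ?thesis using d by blast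
qed

theorem theorem4:
  fixes K :: "vdiagram set" and f :: laurent
  assumes "virtual_knot K"
    and "parity_virtual_alexander K f"
  shows "width Var_q f \<le> 2 * int (min_virtual K)
       \<and> width Var_theta f \<le> 2 * int (min_odd K)"
proof -
  obtain D\<^sub>0 where D\<^sub>0: "vknot_diagram D\<^sub>0" "K = {D. equivclp vmove D\<^sub>0 D}"
    using assms(1) by (auto simp: virtual_knot_def)
  then have ne: "D\<^sub>0 \<in> K" by simp
  note bound = width_le_on_knot[OF D\<^sub>0 assms(2)]
  have "\<exists>D\<in>K. num_virtual D = min_virtual K"
    unfolding min_virtual_def by (rule LeastI_ex) (use ne in blast)
  then obtain D where D: "D \<in> K" "num_virtual D = min_virtual K" by blast
  have "\<exists>D\<in>K. num_odd D = min_odd K"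
    unfolding min_odd_def by (rule LeastI_ex) (use ne in blast)
  then obtain E where E: "E \<in> K" "num_odd E = min_odd K" by blast
  have "width Var_q f \<le> 2 * int (min_virtual K)"
    using bound[OF D(1), of Var_q] width_q_alexander[of D] D(2) by simp
  moreover have "width Var_theta f \<le> 2 * int (min_odd K)"
    using bound[OF E(1), of Var_theta] width_theta_alexander[of E] E(2) by simp
  ultimately show ?thesis by blast
qed

end
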